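(* Let $U\subseteq\mathbb{H}^n$ be open and let $T\in\mathcal{D}_{\mathbb{H},k}(U)$ be a Heisenberg current whose support $\operatorname{spt}T$ is compact. Then $M(T)<\infty$ if and only if $T$ is representable by integration, i.e. $T=\overrightarrow{T}\wedge\mu_T$.
   Context: **Heisenberg group.** For $n\ge 1$, $\mathbb{H}^n=(\mathbb{R}^{2n+1},* )$ with coordinates $(x,y,\tau)$, $x,y\in\mathbb{R}^n$, $\tau\in\mathbb{R}$, and $(x,y,\tau)*(x',y',\tau')=(x+x',y+y',\tau+\tau'+\frac12\sum_j(x_jy_j'-y_jx_j'))$. Left invariant fields: $W_j=\partial_{x_j}-\frac12y_j\partial_\tau$, $W_{n+j}=\partial_{y_j}+\frac12x_j\partial_\tau$ ($1\le j\le n$), $W_{2n+1}=\partial_\tau$, declared orthonormal; they span the Lie algebra $\mathfrak{h}$, and $\mathfrak{h}_1=\operatorname{span}\{W_1,\dots,W_{2n}\}$. Dual basis: $dw_j=dx_j$, $dw_{n+j}=dy_j$, $dw_{2n+1}=\theta:=d\tau-\frac12\sum_j(x_jdy_j-y_jdx_j)$. $\bigwedge_k$, $\bigwedge^k$ denote $k$-vectors and $k$-covectors with the induced inner products and norm $|\cdot|$; $\langle\omega|v\rangle$ is the duality pairing; $*:\bigwedge_k\mathfrak{h}\to\bigwedge_{2n+1-k}\mathfrak{h}$ is the Hodge operator. **Rumin forms and currents.** $\Omega^k$ denotes smooth $k$-forms, $I^k=\{\alpha\wedge\theta+\beta\wedge d\theta:\alpha\in\Omega^{k-1},\beta\in\Omega^{k-2}\}$,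 $J^k=\{\alpha\in\Omega^k:\alpha\wedge\theta=0,\ \alpha\wedge d\theta=0\}$. $\mathcal{D}^k_{\mathbb{H}}(U)$ is the (locally convex) space of compactly supported smooth sections on $U$ of $\Omega^k/I^k$ if $k\le n$ (for $k=0$: compactly supported smooth functions), and of $J^k$ if $n+1\le k\le 2n+1$. $\mathcal{D}_{\mathbb{H},k}(U)$ is the set of continuous linear functionals $\mathcal{D}^k_{\mathbb{H}}(U)\to\mathbb{R}$ (Heisenberg currents). $\operatorname{spt}T$ is the complement in $U$ of the union of all open $V\subseteq U$ such that $T(\omega)=0$ for every $\omega\in\mathcal{D}^k_{\mathbb{H}}(U)$ with $\operatorname{spt}\omega\subseteq V$. **Mass.** For $k\le n$, a simple $v=v_1\wedge\dots\wedge v_k\in\bigwedge_k\mathfrak{h}_1$ is integrable if the distribution spanned by the left invariant fields $v_1,\dots,v_k$ is integrable. For $k\ge n+1$, a $k$-vector is called simple integrable here if it is $*v$ with $v\in\bigwedge_{2n+1-k}\mathfrak{h}_1$ simple and integrable. ${}_H\bigwedge_k$ is the linear span of the simple integrable $k$-vectors (${}_H\bigwedge_0=\mathbb{R}$); for $k\le n$ these annihilate $I^k$, so $\langle\omega|v\rangle$ is well defined for $\omega\in\mathcal{D}^k_{\mathbb{H}}(U)$ and $v\in{}_H\bigwedge_k$. Comass: $\|\omega(p)\|^*=\sup\{\langle\omega(p)|v\rangle: v\text{ a unit simple integrable }k\text{-vector}\}$. Mass: $M(T)=\sup\{T(\omega):\omega\in\mathcal{D}^k_{\mathbb{H}}(U),\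 \|\omega(p)\|^*\le1\ \forall p\}$. $T$ is representable by integration, written $T=\overrightarrow{T}\wedge\mu_T$, if there are a Radon measure $\mu_T$ on $U$ and a $\mu_T$-measurable $\overrightarrow{T}:U\to{}_H\bigwedge_k$ with $\|\overrightarrow{T}(p)\|=1$ for $\mu_T$-a.e. $p$ (norm dual to the comass) and $T(\omega)=\int\langle\omega(p)|\overrightarrow{T}(p)\rangle\,d\mu_T(p)$ for all $\omega\in\mathcal{D}^k_{\mathbb{H}}(U)$. *)

theory Defs
  imports "HOL-Analysis.Analysis"
begin

section \<open>The Heisenberg group\<close>

text \<open>
  Points of the Heisenberg group are triples \<open>(x, y, \<tau>)\<close>.  The finite linearly ordered
  type \<open>'n\<close> plays the role of \<open>{1..n}\<close>, so \<open>n = CARD('n) \<ge> 1\<close>; its order only fixes the signs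
  in the exterior algebra.
\<close>

type_synonym 'n heis = "(real ^ 'n) \<times> (real ^ 'n) \<times> real"

definition heis_mult :: "'n::finite heis \<Rightarrow> 'n heis \<Rightarrow> 'n heis" where
  "heis_mult p q = (case (p, q) of ((x, y, t), (x', y', t')) \<Rightarrow>
     (x + x', y + y', t + t' + (\<Sum>j\<in>UNIV. x $ j * y' $ j - y $ j * x' $ j) / 2))"

text \<open>
  \<open>IX j\<close>, \<open>IY j\<close>, \<open>IT\<close> are the indices \<open>j\<close>, \<open>n + j\<close>, \<open>2n + 1\<close>.
\<close>

datatype 'n hidx = IX 'n | IY 'n | IT

instance hidx :: (finite) finite
proof
  have "(UNIV :: 'a hidx set) = range IX \<union> range IY \<union> {IT}"
  proof (rule equalityI; rule subsetI)
    fix i :: "'a hidx" show "i \<in> range IX \<union> range IY \<union> {IT}" by (cases i) auto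
  qed auto
  moreover have "finite (range IX \<union> range IY \<union> {IT :: 'a hidx})" by simp
  ultimately show "finite (UNIV :: 'a hidx set)" by (rule ssubst)
qed

instantiation hidx :: (linorder) linorder
begin

fun less_eq_hidx :: "'a hidx \<Rightarrow> 'a hidx \<Rightarrow> bool" where
  "less_eq_hidx (IX a) (IX b) = (a \<le> b)"
| "less_eq_hidx (IX a) (IY b) = True"
| "less_eq_hidx (IX a) IT = True"
| "less_eq_hidx (IY a) (IX b) = False"
| "less_eq_hidx (IY a) (IY b) = (a \<le> b)"
| "less_eq_hidx (IY a) IT = True"
| "less_eq_hidx IT (IX b) = False"
| "less_eq_hidx IT (IY b) = False"
| "less_eq_hidx IT IT = True"

definition less_hidx :: "'a hidx \<Rightarrow> 'a hidx \<Rightarrow> bool" where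
  "less_hidx i j \<longleftrightarrow> i \<le> j \<and> \<not> j \<le> i"

instance
proof
  fix i j k :: "'a hidx"
  show "i < j \<longleftrightarrow> i \<le> j \<and> \<not> j \<le> i" by (rule less_hidx_def)
  show "i \<le> i" by (cases i) auto
  show "i \<le> k" if "i \<le> j" "j \<le> k" using that by (cases i; cases j; cases k) auto
  show "i = j" if "i \<le> j" "j \<le> i" using that by (cases i; cases j) auto
  show "i \<le> j \<or> j \<le> i" by (cases i; cases j) auto
qed

end

fun W :: "'n::finite hidx \<Rightarrow> 'n heis \<Rightarrow> 'n heis" where
  "W (IX j) (x, y, t) = (axis j 1, 0, - (y $ j) / 2)"
| "W (IY j) (x, y, t) = (0, axis j 1, x $ j / 2)"
| "W IT (x, y, t) = (0, 0, 1)"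

text \<open>
  An element of the Lie algebra is given by its coordinates with respect to the frame \<open>W\<close>.
\<close>

type_synonym 'n lie = "real ^ 'n hidx"

definition left_inv_field :: "'n::finite lie \<Rightarrow> 'n heis \<Rightarrow> 'n heis" where
  "left_inv_field v p = (\<Sum>i\<in>UNIV. v $ i *\<^sub>R W i p)"

definition horizontal :: "'n::finite lie set" where
  "horizontal = {v. v $ IT = 0}"

definition theta_form :: "'n::finite heis \<Rightarrow> 'n heis \<Rightarrow> real" where
  "theta_form p u = (case (p, u) of ((x, y, t), (a, b, c)) \<Rightarrow>
     c - (\<Sum>j\<in>UNIV. x $ j * b $ j - y $ j * a $ j) / 2)"

section \<open>The exterior algebra\<close>

text \<open>
  A multivector is given by its coordinates in the basis \<open>W\<^sub>I = W\<^bsub>i1\<^esub> \<and> \<dots> \<and> W\<^bsub>ik\<^esub>\<close>, and a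
  multicovector by its coordinates in the dual basis \<open>dw\<^sub>I\<close>, where \<open>I = {i1 < \<dots> < ik}\<close> ranges over
  all sets of indices.  These bases are orthonormal for the induced inner products, so
  \<open>norm\<close> is the induced norm, and the duality pairing of \<open>c\<close> with \<open>v\<close> is \<open>c \<bullet> v\<close>.
\<close>

type_synonym 'n ext = "real ^ 'n hidx set"

definition Lam :: "int \<Rightarrow> 'n::finite ext set" where
  "Lam d = {v. \<forall>I. v $ I \<noteq> 0 \<longrightarrow> int (card I) = d}"

definition shuffle_sign :: "'n::{finite,linorder} hidx set \<Rightarrow> 'n hidx set \<Rightarrow> real" where
  "shuffle_sign I J = (- 1) ^ card {(i, j). i \<in> I \<and> j \<in> J \<and> j < i}"

definition wedge :: "'n::{finite,linorder} ext \<Rightarrow> 'n ext \<Rightarrow> 'n ext" (infixr "\<and>\<^sub>e" 71) where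
  "a \<and>\<^sub>e b = (\<chi> K. \<Sum>I\<in>Pow K. shuffle_sign I (K - I) * a $ I * b $ (K - I))"

text \<open>
  The Hodge operator, characterised by \<open>v \<and> *w = (v \<bullet> w) W\<^sub>1 \<and> \<dots> \<and> W\<^bsub>2n+1\<^esub>\<close>,
  maps \<open>W\<^sub>I\<close> to \<open>\<plusminus>W\<^bsub>-I\<^esub>\<close>.
\<close>

definition hodge :: "'n::{finite,linorder} ext \<Rightarrow> 'n ext" where
  "hodge v = (\<chi> J. shuffle_sign (- J) J * v $ (- J))"

definition vec1 :: "'n::finite lie \<Rightarrow> 'n ext" where
  "vec1 v = (\<Sum>i\<in>UNIV. v $ i *\<^sub>R axis {i} 1)"

definition wedge_list :: "'n::{finite,linorder} lie list \<Rightarrow> 'n ext" where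
  "wedge_list vs = foldr (\<lambda>v a. vec1 v \<and>\<^sub>e a) vs (axis {} 1)"

definition theta :: "'n::finite ext" where
  "theta = axis {IT} 1"

text \<open>
  In the left invariant coframe, \<open>d\<theta> = - (\<Sum>j. dx\<^sub>j \<and> dy\<^sub>j)\<close> has constant coefficients;
  see \<open>dtheta_exterior_derivative\<close> below.
\<close>

definition dtheta :: "'n::finite ext" where
  "dtheta = - (\<Sum>j\<in>UNIV. axis {IX j, IY j} 1)"

section \<open>Smooth maps and simple integrable vectors\<close>

fun dderiv :: "'a::real_normed_vector list \<Rightarrow> ('a \<Rightarrow> 'b::real_normed_vector) \<Rightarrow> 'a \<Rightarrow> 'b" where
  "dderiv [] f = f"
| "dderiv (v # vs) f = dderiv vs (\<lambda>x. frechet_derivative f (at x) v)"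

definition smooth_on :: "'a::real_normed_vector set \<Rightarrow> ('a \<Rightarrow> 'b::real_normed_vector) \<Rightarrow> bool" where
  "smooth_on S f \<longleftrightarrow> (\<forall>vs. \<forall>x\<in>S. dderiv vs f differentiable (at x))"

text \<open>
  Integrability of a distribution of constant rank: through every point \<open>p\<close> passes an integral
  manifold, given by a local parametrisation \<open>\<phi>\<close>.  The parameter domain is a neighbourhood \<open>V \<inter> E\<close>
  of \<open>0\<close> in a linear space \<open>E\<close> of the same dimension as the distribution, so that the derivative
  of \<open>\<phi>\<close> is injective on \<open>E\<close>.
\<close>

definition integrable_distribution :: "('a::euclidean_space \<Rightarrow> 'a set) \<Rightarrow> bool" where
  "integrable_distribution D \<longleftrightarrow>
     (\<forall>p. \<exists>(E :: 'a set) V (\<phi> :: 'a \<Rightarrow> 'a). subspace E \<and> dim E = dim (D p) \<and> open V \<and> 0 \<in> V \<and> smooth_on V \<phi> \<and> \<phi> 0 = p \<and>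
        (\<forall>u\<in>V \<inter> E. frechet_derivative \<phi> (at u) ` E = D (\<phi> u)))"

definition spanned_distribution :: "'n::finite lie list \<Rightarrow> 'n heis \<Rightarrow> 'n heis set" where
  "spanned_distribution vs p = span ((\<lambda>v. left_inv_field v p) ` set vs)"

text \<open>
  The factor \<open>c\<close> is only relevant in degree \<open>0\<close>, where it makes every scalar (in particular
  both \<open>1\<close> and \<open>-1\<close>) a simple integrable vector.
\<close>

definition simple_integrable_horizontal :: "nat \<Rightarrow> 'n::{finite,linorder} ext set" where
  "simple_integrable_horizontal k =
     {c *\<^sub>R wedge_list vs | c vs.
        length vs = k \<and> set vs \<subseteq> horizontal \<and> integrable_distribution (spanned_distribution vs)}"

definition simple_integrable :: "nat \<Rightarrow> 'n::{finite,linorder} ext set" where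
  "simple_integrable k =
     (if k \<le> CARD('n) then simple_integrable_horizontal k
      else hodge ` simple_integrable_horizontal (2 * CARD('n) + 1 - k))"

definition HLam :: "nat \<Rightarrow> 'n::{finite,linorder} ext set" where
  "HLam k = span (simple_integrable k)"

section \<open>Rumin forms\<close>

text \<open>
  A differential form is the map giving its coordinates in the left invariant coframe; since
  the change of frame is smooth, the form is smooth iff this map is.  Its values
  outside the open set under consideration are irrelevant.
\<close>

type_synonym 'n form = "'n heis \<Rightarrow> 'n ext"

definition forms :: "'n::finite heis set \<Rightarrow> int \<Rightarrow> 'n form set" where
  "forms U d = {\<omega>. smooth_on U \<omega> \<and> (\<forall>p\<in>U. \<omega> p \<in> Lam d)}"

text \<open>For \<open>k < 2\<close> the negative degrees force \<open>\<beta>\<close>, and for \<open>k = 0\<close> also \<open>\<alpha>\<close>, to vanish.\<close>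

definition rumin_I :: "'n::{finite,linorder} heis set \<Rightarrow> nat \<Rightarrow> 'n form set" where
  "rumin_I U k = {\<omega>. \<exists>\<alpha>\<in>forms U (int k - 1). \<exists>\<beta>\<in>forms U (int k - 2).
                       \<forall>p\<in>U. \<omega> p = \<alpha> p \<and>\<^sub>e theta + \<beta> p \<and>\<^sub>e dtheta}"

definition rumin_J :: "'n::{finite,linorder} heis set \<Rightarrow> nat \<Rightarrow> 'n form set" where
  "rumin_J U k = {\<omega>\<in>forms U (int k). \<forall>p\<in>U. \<omega> p \<and>\<^sub>e theta = 0 \<and> \<omega> p \<and>\<^sub>e dtheta = 0}"

text \<open>
  The Rumin \<open>k\<close>-forms on \<open>U\<close> are the classes \<open>rumin_class U k \<omega>\<close> with \<open>\<omega> \<in> rumin_reps U k\<close>,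
  that is, the elements of \<open>\<Omega>\<^sup>k/I\<^sup>k\<close> for \<open>k \<le> n\<close>.  For \<open>k > n\<close> a class merely identifies maps that
  agree on \<open>U\<close>, so the classes are the elements of \<open>J\<^sup>k\<close>.
\<close>

definition rumin_reps :: "'n::{finite,linorder} heis set \<Rightarrow> nat \<Rightarrow> 'n form set" where
  "rumin_reps U k = (if k \<le> CARD('n) then forms U (int k) else rumin_J U k)"

definition rumin_null :: "'n::{finite,linorder} heis set \<Rightarrow> nat \<Rightarrow> 'n form set" where
  "rumin_null U k = (if k \<le> CARD('n) then rumin_I U k else {\<omega>. \<forall>p\<in>U. \<omega> p = 0})"

definition rumin_class :: "'n::{finite,linorder} heis set \<Rightarrow> nat \<Rightarrow> 'n form \<Rightarrow> 'n form set" where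
  "rumin_class U k \<omega> = {\<omega>'\<in>rumin_reps U k. (\<lambda>p. \<omega>' p - \<omega> p) \<in> rumin_null U k}"

definition rumin_spt :: "'n::{finite,linorder} heis set \<Rightarrow> nat \<Rightarrow> 'n form \<Rightarrow> 'n heis set" where
  "rumin_spt U k \<omega> = U - \<Union>{V. open V \<and> V \<subseteq> U \<and> \<omega> \<in> rumin_null V k}"

text \<open>\<open>test_reps U k\<close> are the representatives of the elements of \<open>test_space U k\<close>.\<close>

definition test_reps :: "'n::{finite,linorder} heis set \<Rightarrow> nat \<Rightarrow> 'n form set" where
  "test_reps U k = {\<omega>\<in>rumin_reps U k. compact (rumin_spt U k \<omega>)}"

definition test_space :: "'n::{finite,linorder} heis set \<Rightarrow> nat \<Rightarrow> 'n form set set" where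
  "test_space U k = rumin_class U k ` test_reps U k"

text \<open>
  The locally convex topology of the test space is the usual inductive limit topology: a convex
  set is a neighbourhood of \<open>0\<close> iff, for every compact \<open>K \<subseteq> U\<close>, its trace on the classes supported
  in \<open>K\<close> is one, these classes carrying the topology induced by the quotient of the \<open>C\<^sup>\<infinity>\<close>
  topology on forms (uniform convergence of all derivatives on compact sets \<open>L\<close>).
\<close>

definition test_nhd0 :: "'n::{finite,linorder} heis set \<Rightarrow> nat \<Rightarrow> 'n form set set \<Rightarrow> bool" where
  "test_nhd0 U k N \<longleftrightarrow> N \<subseteq> test_space U k \<and>
     (\<forall>\<omega>\<in>test_reps U k. \<forall>\<eta>\<in>test_reps U k. \<forall>t\<in>{0..1::real}.
        rumin_class U k \<omega> \<in> N \<longrightarrow> rumin_class U k \<eta> \<in> N \<longrightarrow>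
        rumin_class U k (\<lambda>p. t *\<^sub>R \<omega> p + (1 - t) *\<^sub>R \<eta> p) \<in> N) \<and>
     (\<forall>K. compact K \<and> K \<subseteq> U \<longrightarrow>
        (\<exists>L m. \<exists>\<epsilon>>0. compact L \<and> L \<subseteq> U \<and>
           (\<forall>\<omega>\<in>test_reps U k. rumin_spt U k \<omega> \<subseteq> K \<longrightarrow>
              (\<forall>p\<in>L. \<forall>vs. length vs \<le> m \<and> set vs \<subseteq> Basis \<longrightarrow> norm (dderiv vs \<omega> p) < \<epsilon>) \<longrightarrow>
              rumin_class U k \<omega> \<in> N)))"

definition test_open :: "'n::{finite,linorder} heis set \<Rightarrow> nat \<Rightarrow> 'n form set set \<Rightarrow> bool" where
  "test_open U k G \<longleftrightarrow> G \<subseteq> test_space U k \<and>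
     (\<forall>\<omega>\<in>test_reps U k. rumin_class U k \<omega> \<in> G \<longrightarrow>
        (\<exists>N. test_nhd0 U k N \<and>
           (\<forall>\<eta>\<in>test_reps U k. rumin_class U k \<eta> \<in> N \<longrightarrow> rumin_class U k (\<lambda>p. \<omega> p + \<eta> p) \<in> G)))"

definition test_topology :: "'n::{finite,linorder} heis set \<Rightarrow> nat \<Rightarrow> 'n form set topology" where
  "test_topology U k = topology (test_open U k)"

section \<open>Heisenberg currents\<close>

definition heis_current ::
  "'n::{finite,linorder} heis set \<Rightarrow> nat \<Rightarrow> ('n form set \<Rightarrow> real) \<Rightarrow> bool" where
  "heis_current U k T \<longleftrightarrow>
     (\<forall>\<omega>\<in>test_reps U k. \<forall>\<eta>\<in>test_reps U k. \<forall>a b.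
        T (rumin_class U k (\<lambda>p. a *\<^sub>R \<omega> p + b *\<^sub>R \<eta> p))
          = a * T (rumin_class U k \<omega>) + b * T (rumin_class U k \<eta>)) \<and>
     continuous_map (test_topology U k) euclideanreal T"

definition current_spt ::
  "'n::{finite,linorder} heis set \<Rightarrow> nat \<Rightarrow> ('n form set \<Rightarrow> real) \<Rightarrow> 'n heis set" where
  "current_spt U k T = U - \<Union>{V. open V \<and> V \<subseteq> U \<and>
     (\<forall>\<omega>\<in>test_reps U k. rumin_spt U k \<omega> \<subseteq> V \<longrightarrow> T (rumin_class U k \<omega>) = 0)}"

text \<open>
  For \<open>k \<le> n\<close> the elements of \<open>HLam k\<close> annihilate \<open>I\<^sup>k\<close>, so the pairing with a Rumin form at a
  point, and hence the comass, can be computed with any representative.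
\<close>

definition comass :: "nat \<Rightarrow> 'n::{finite,linorder} ext \<Rightarrow> ereal" where
  "comass k c = (SUP v\<in>{v\<in>simple_integrable k. norm v = 1}. ereal (c \<bullet> v))"

definition mass ::
  "'n::{finite,linorder} heis set \<Rightarrow> nat \<Rightarrow> ('n form set \<Rightarrow> real) \<Rightarrow> ereal" where
  "mass U k T =
     (SUP \<omega>\<in>{\<omega>\<in>test_reps U k. \<forall>p\<in>U. comass k (\<omega> p) \<le> 1}. ereal (T (rumin_class U k \<omega>)))"

definition rumin_covectors :: "nat \<Rightarrow> 'n::{finite,linorder} ext set" where
  "rumin_covectors k =
     (if k \<le> CARD('n) then Lam (int k)
      else {c\<in>Lam (int k). c \<and>\<^sub>e theta = 0 \<and> c \<and>\<^sub>e dtheta = 0})"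

definition dual_norm :: "nat \<Rightarrow> 'n::{finite,linorder} ext \<Rightarrow> ereal" where
  "dual_norm k v = (SUP c\<in>{c\<in>rumin_covectors k. comass k c \<le> 1}. ereal (c \<bullet> v))"

definition radon_measure_on :: "'a::euclidean_space set \<Rightarrow> 'a measure \<Rightarrow> bool" where
  "radon_measure_on U \<mu> \<longleftrightarrow>
     sets \<mu> = sets (restrict_space borel U) \<and>
     (\<forall>K. compact K \<and> K \<subseteq> U \<longrightarrow> emeasure \<mu> K < \<infinity>) \<and>
     (\<forall>B\<in>sets \<mu>. emeasure \<mu> B = (SUP K\<in>{K. compact K \<and> K \<subseteq> B}. emeasure \<mu> K))"

text \<open>The notion of \<open>\<mu>\<close>-measurability is measurability for the completion of \<open>\<mu>\<close>.\<close>

definition representable_by_integration ::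
  "'n::{finite,linorder} heis set \<Rightarrow> nat \<Rightarrow> ('n form set \<Rightarrow> real) \<Rightarrow> bool" where
  "representable_by_integration U k T \<longleftrightarrow>
     (\<exists>\<mu> v. radon_measure_on U \<mu> \<and>
        v \<in> borel_measurable (completion \<mu>) \<and> (\<forall>p\<in>U. v p \<in> HLam k) \<and>
        (AE p in \<mu>. dual_norm k (v p) = 1) \<and>
        (\<forall>\<omega>\<in>test_reps U k. T (rumin_class U k \<omega>) = (\<integral>p. \<omega> p \<bullet> v p \<partial>completion \<mu>)))"

section \<open>Consistency of the conventions\<close>

lemma heis_mult_has_derivative:
  "(heis_mult p has_derivative
     (\<lambda>v. (fst v, fst (snd v), snd (snd v) +
        (\<Sum>j\<in>UNIV. fst p $ j * fst (snd v) $ j - fst (snd p) $ j * fst v $ j) / 2))) (at q)"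
proof -
  have eq: "heis_mult p = (\<lambda>q. (fst p + fst q, fst (snd p) + fst (snd q),
      snd (snd p) + snd (snd q) +
      (\<Sum>j\<in>UNIV. fst p $ j * fst (snd q) $ j - fst (snd p) $ j * fst q $ j) / 2))"
    by (auto simp: heis_mult_def fun_eq_iff split: prod.splits)
  show ?thesis unfolding eq
    by (auto intro!: derivative_eq_intros bounded_linear.has_derivative[OF bounded_linear_vec_nth])
qed

lemma W_left_invariant:
  "frechet_derivative (heis_mult p) (at q) (W i q) = W i (heis_mult p q)"
proof -
  have *: "frechet_derivative (heis_mult p) (at q) =
     (\<lambda>v. (fst v, fst (snd v), snd (snd v) +
        (\<Sum>j\<in>UNIV. fst p $ j * fst (snd v) $ j - fst (snd p) $ j * fst v $ j) / 2))"
    by (rule frechet_derivative_at[OF heis_mult_has_derivative, symmetric])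
  show ?thesis
    unfolding * by (cases p; cases q; cases i)
      (auto simp: heis_mult_def axis_def sum_subtractf if_distrib if_distribR sum_negf
        add_divide_distrib cong: if_cong)
qed

lemma theta_form_W: "theta_form p (W i p) = (if i = IT then 1 else 0)"
  by (cases p; cases i)
    (auto simp: theta_form_def axis_def if_distrib if_distribR sum_negf cong: if_cong)

lemma theta_form_derivative:
  "frechet_derivative (\<lambda>q. theta_form q b) (at p) a =
     - (\<Sum>j\<in>UNIV. fst a $ j * fst (snd b) $ j - fst (snd a) $ j * fst b $ j) / 2"
proof -
  have eq: "(\<lambda>q. theta_form q b) = (\<lambda>q. snd (snd b) -
      (\<Sum>j\<in>UNIV. fst q $ j * fst (snd b) $ j - fst (snd q) $ j * fst b $ j) / 2)"
    by (auto simp: theta_form_def fun_eq_iff split: prod.splits)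
  have "((\<lambda>q. theta_form q b) has_derivative (\<lambda>a.
     - (\<Sum>j\<in>UNIV. fst a $ j * fst (snd b) $ j - fst (snd a) $ j * fst b $ j) / 2)) (at p)"
    unfolding eq
    by (auto intro!: derivative_eq_intros bounded_linear.has_derivative[OF bounded_linear_vec_nth])
  from frechet_derivative_at[OF this, symmetric] show ?thesis by simp
qed

lemma W_components:
  "fst (W (IX a) p) = axis a 1" "fst (snd (W (IX a) p)) = 0"
  "fst (W (IY a) p) = 0" "fst (snd (W (IY a) p)) = axis a 1"
  "fst (W IT p) = 0" "fst (snd (W IT p)) = 0"
  by (cases p; simp)+

lemma dtheta_exterior_derivative:
  fixes p :: "'n::{finite,linorder} heis"
  assumes "i < j"
  shows "frechet_derivative (\<lambda>q. theta_form q (W j p)) (at p) (W i p)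
           - frechet_derivative (\<lambda>q. theta_form q (W i p)) (at p) (W j p)
         = dtheta $ {i, j}"
proof -
  have nth: "dtheta $ I = - (\<Sum>l\<in>UNIV. if I = {IX l, IY l} then 1 else 0)" for I :: "'n hidx set"
    by (simp add: dtheta_def axis_def)
  have XY: "{IX a, IY b} = {IX l, IY l} \<longleftrightarrow> l = a \<and> l = b" for a b l :: 'n
    by (auto simp: doubleton_eq_iff)
  have sum_axis: "(\<Sum>l\<in>UNIV. axis a (1 :: real) $ l * axis b 1 $ l) = (if a = b then 1 else 0)"
    for a b :: 'n
  proof -
    have "axis a (1 :: real) $ l * axis b 1 $ l = (if l = a then (if a = b then 1 else 0) else 0)" for l
      by (auto simp: axis_def)
    then show ?thesis by simp
  qed
  show ?thesis
  proof (cases "\<exists>a b. i = IX a \<and> j = IY b")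
    case True
    then obtain a b where ij: "i = IX a" "j = IY b" by blast
    have "dtheta $ {i, j} = - (if a = b then 1 else 0)"
      unfolding nth ij XY by (cases "a = b") (auto intro!: sum.neutral)
    then show ?thesis
      unfolding theta_form_derivative ij W_components
      using sum_axis[of a b] sum_axis[of b a] by (simp add: sum_negf)
  next
    case False
    with assms consider a b where "i = IX a" "j = IX b" | a where "i = IX a" "j = IT"
      | a b where "i = IY a" "j = IY b" | a where "i = IY a" "j = IT"
      by (cases i; cases j) (auto simp: less_hidx_def)
    then show ?thesis
      by cases (simp_all add: theta_form_derivative W_components nth doubleton_eq_iff)
  qed
qed

lemma hodge_wedge: "(v \<and>\<^sub>e hodge w) $ UNIV = v \<bullet> w"
proof -
  have "shuffle_sign I J * shuffle_sign I J = 1" for I J :: "'a hidx set"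
    by (simp add: shuffle_sign_def flip: power_add mult_2)
  then have *: "shuffle_sign I J * x * (shuffle_sign I J * y) = x * y"
    for I J :: "'a hidx set" and x y
    by (metis (no_types) mult.assoc mult.commute mult.left_neutral)
  have "(v \<and>\<^sub>e hodge w) $ UNIV =
      (\<Sum>I\<in>UNIV. shuffle_sign I (- I) * v $ I * (shuffle_sign I (- I) * w $ I))"
    by (simp add: wedge_def hodge_def flip: Compl_eq_Diff_UNIV)
  then show ?thesis unfolding * by (simp add: inner_vec_def)
qed

lemma istopology_test_open: "istopology (test_open U k)"
proof -
  have nhd: "test_nhd0 U k (N \<inter> N')" if N: "test_nhd0 U k N" and N': "test_nhd0 U k N'" for N N'
    unfolding test_nhd0_def
  proof (intro conjI allI impI)
    show "N \<inter> N' \<subseteq> test_space U k" using N by (auto simp: test_nhd0_def)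
    show "\<forall>\<omega>\<in>test_reps U k. \<forall>\<eta>\<in>test_reps U k. \<forall>t\<in>{0..1}.
        rumin_class U k \<omega> \<in> N \<inter> N' \<longrightarrow> rumin_class U k \<eta> \<in> N \<inter> N' \<longrightarrow>
        rumin_class U k (\<lambda>p. t *\<^sub>R \<omega> p + (1 - t) *\<^sub>R \<eta> p) \<in> N \<inter> N'"
    proof (intro ballI impI IntI)
      fix \<omega> \<eta> :: "'a form" and t :: real
      assume *: "\<omega> \<in> test_reps U k" "\<eta> \<in> test_reps U k" "t \<in> {0..1}"
        "rumin_class U k \<omega> \<in> N \<inter> N'" "rumin_class U k \<eta> \<in> N \<inter> N'"
      show "rumin_class U k (\<lambda>p. t *\<^sub>R \<omega> p + (1 - t) *\<^sub>R \<eta> p) \<in> N"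
        by (rule N[unfolded test_nhd0_def, THEN conjunct2, THEN conjunct1, rule_format,
              OF *(1,2,3) IntD1[OF *(4)] IntD1[OF *(5)]])
      show "rumin_class U k (\<lambda>p. t *\<^sub>R \<omega> p + (1 - t) *\<^sub>R \<eta> p) \<in> N'"
        by (rule N'[unfolded test_nhd0_def, THEN conjunct2, THEN conjunct1, rule_format,
              OF *(1,2,3) IntD2[OF *(4)] IntD2[OF *(5)]])
    qed
    fix K assume K: "compact K \<and> K \<subseteq> U"
    obtain L m e where b: "e > 0" "compact L" "L \<subseteq> U"
      and r: "\<forall>\<omega>\<in>test_reps U k. rumin_spt U k \<omega> \<subseteq> K \<longrightarrow>
        (\<forall>p\<in>L. \<forall>vs. length vs \<le> m \<and> set vs \<subseteq> Basis \<longrightarrow> norm (dderiv vs \<omega> p) < e) \<longrightarrow>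
        rumin_class U k \<omega> \<in> N"
      using N[unfolded test_nhd0_def, THEN conjunct2, THEN conjunct2, THEN spec, THEN mp, OF K]
      by (elim exE conjE) (rule that)
    obtain L' m' e' where b': "e' > 0" "compact L'" "L' \<subseteq> U"
      and r': "\<forall>\<omega>\<in>test_reps U k. rumin_spt U k \<omega> \<subseteq> K \<longrightarrow>
        (\<forall>p\<in>L'. \<forall>vs. length vs \<le> m' \<and> set vs \<subseteq> Basis \<longrightarrow> norm (dderiv vs \<omega> p) < e') \<longrightarrow>
        rumin_class U k \<omega> \<in> N'"
      using N'[unfolded test_nhd0_def, THEN conjunct2, THEN conjunct2, THEN spec, THEN mp, OF K]
      by (elim exE conjE) (rule that)
    show "\<exists>L m. \<exists>\<epsilon>>0. compact L \<and> L \<subseteq> U \<and>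
           (\<forall>\<omega>\<in>test_reps U k. rumin_spt U k \<omega> \<subseteq> K \<longrightarrow>
              (\<forall>p\<in>L. \<forall>vs. length vs \<le> m \<and> set vs \<subseteq> Basis \<longrightarrow> norm (dderiv vs \<omega> p) < \<epsilon>) \<longrightarrow>
              rumin_class U k \<omega> \<in> N \<inter> N')"
    proof (rule exI[of _ "L \<union> L'"], rule exI[of _ "max m m'"], rule exI[of _ "min e e'"],
        intro conjI ballI impI)
      fix \<omega> :: "'a form"
      assume \<omega>: "\<omega> \<in> test_reps U k" "rumin_spt U k \<omega> \<subseteq> K"
        and *: "\<forall>p\<in>L \<union> L'. \<forall>vs. length vs \<le> max m m' \<and> set vs \<subseteq> Basis \<longrightarrow>
                  norm (dderiv vs \<omega> p) < min e e'"
      have "rumin_class U k \<omega> \<in> N" by (rule r[THEN bspec, OF \<omega>(1), THEN mp, OF \<omega>(2), THEN mp])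
        (use * in auto)
      moreover have "rumin_class U k \<omega> \<in> N'" by (rule r'[THEN bspec, OF \<omega>(1), THEN mp, OF \<omega>(2), THEN mp])
        (use * in auto)
      ultimately show "rumin_class U k \<omega> \<in> N \<inter> N'" by simp
    qed (use b b' in auto)
  qed
  show ?thesis
    unfolding istopology_def
  proof (intro conjI allI impI)
    fix S S' assume S: "test_open U k S" and S': "test_open U k S'"
    show "test_open U k (S \<inter> S')"
      unfolding test_open_def
    proof (intro conjI ballI impI)
      show "S \<inter> S' \<subseteq> test_space U k" using S by (auto simp: test_open_def)
      fix \<omega> assume \<omega>: "\<omega> \<in> test_reps U k" "rumin_class U k \<omega> \<in> S \<inter> S'"
      obtain N where N: "test_nhd0 U k N"
        "\<And>\<eta>. \<eta> \<in> test_reps U k \<Longrightarrow> rumin_class U k \<eta> \<in> N \<Longrightarrow> rumin_class U k (\<lambda>p. \<omega> p + \<eta> p) \<in> S"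
        using S \<omega> unfolding test_open_def by blast
      obtain N' where N': "test_nhd0 U k N'"
        "\<And>\<eta>. \<eta> \<in> test_reps U k \<Longrightarrow> rumin_class U k \<eta> \<in> N' \<Longrightarrow> rumin_class U k (\<lambda>p. \<omega> p + \<eta> p) \<in> S'"
        using S' \<omega> unfolding test_open_def by blast
      show "\<exists>N. test_nhd0 U k N \<and> (\<forall>\<eta>\<in>test_reps U k. rumin_class U k \<eta> \<in> N \<longrightarrow>
              rumin_class U k (\<lambda>p. \<omega> p + \<eta> p) \<in> S \<inter> S')"
        using nhd[OF N(1) N'(1)] N(2) N'(2) by blast
    qed
  next
    fix \<K> assume "\<forall>S\<in>\<K>. test_open U k S"
    then show "test_open U k (\<Union>\<K>)"
      unfolding test_open_def by (meson UnionE UnionI Union_least)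
  qed
qed

lemma openin_test_topology: "openin (test_topology U k) = test_open U k"
  by (simp add: test_topology_def istopology_test_open)

lemma dderiv_cong:
  assumes "open S" and "\<And>y. y \<in> S \<Longrightarrow> f y = g y" and "x \<in> S"
  shows "dderiv vs f x = dderiv vs g x"
  using assms(2,3)
proof (induction vs arbitrary: f g x)
  case (Cons v vs)
  have iff: "(f has_derivative D) (at y) \<longleftrightarrow> (g has_derivative D) (at y)" if "y \<in> S" for y D
  proof
    assume "(f has_derivative D) (at y)"
    then show "(g has_derivative D) (at y)"
      by (rule has_derivative_transform_within_open[OF _ assms(1) that]) (rule Cons.prems(1))
  next
    assume "(g has_derivative D) (at y)"
    then show "(f has_derivative D) (at y)"
      by (rule has_derivative_transform_within_open[OF _ assms(1) that])
        (rule Cons.prems(1)[symmetric])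
  qed
  have eq: "frechet_derivative f (at y) = frechet_derivative g (at y)" if "y \<in> S" for y
    unfolding frechet_derivative_def by (rule arg_cong[where f = Eps], rule ext, rule iff[OF that])
  have *: "frechet_derivative f (at y) v = frechet_derivative g (at y) v" if "y \<in> S" for y
    by (rule fun_cong[OF eq[OF that]])
  show ?case unfolding dderiv.simps by (rule Cons.IH[OF * Cons.prems(2)])
qed simp

lemma smooth_on_differentiable:
  assumes "smooth_on S f" and "x \<in> S"
  shows "f differentiable (at x)"
  using assms(1)[unfolded smooth_on_def, THEN spec[of _ "[]"], THEN bspec, OF assms(2)] by simp

lemma smooth_on_dderiv:
  assumes "smooth_on S f"
  shows "smooth_on S (\<lambda>x. frechet_derivative f (at x) v)"
  unfolding smooth_on_def
proof (intro allI ballI)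
  fix vs x assume "x \<in> S"
  with assms[unfolded smooth_on_def, THEN spec[of _ "v # vs"]]
  show "dderiv vs (\<lambda>x. frechet_derivative f (at x) v) differentiable (at x)"
    by simp
qed

lemma dderiv_lincomb:
  assumes "open S" and "smooth_on S f" and "smooth_on S g" and "x \<in> S"
  shows "dderiv vs (\<lambda>x. a *\<^sub>R f x + b *\<^sub>R g x) x = a *\<^sub>R dderiv vs f x + b *\<^sub>R dderiv vs g x"
  using assms(2-4)
proof (induction vs arbitrary: f g x)
  case (Cons v vs)
  let ?f = "\<lambda>x. frechet_derivative f (at x) v" and ?g = "\<lambda>x. frechet_derivative g (at x) v"
  have sm: "smooth_on S ?f" "smooth_on S ?g"
    by (rule smooth_on_dderiv[OF Cons.prems(1)], rule smooth_on_dderiv[OF Cons.prems(2)])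
  have fr: "frechet_derivative (\<lambda>x. a *\<^sub>R f x + b *\<^sub>R g x) (at y) v = a *\<^sub>R ?f y + b *\<^sub>R ?g y"
    if "y \<in> S" for y
  proof -
    have "f differentiable (at y)" "g differentiable (at y)"
      using smooth_on_differentiable[OF Cons.prems(1) that]
        smooth_on_differentiable[OF Cons.prems(2) that] .
    then have D: "((\<lambda>x. a *\<^sub>R f x + b *\<^sub>R g x) has_derivative
        (\<lambda>v. a *\<^sub>R frechet_derivative f (at y) v + b *\<^sub>R frechet_derivative g (at y) v)) (at y)"
      by (intro has_derivative_add has_derivative_scaleR_right)
        (simp_all add: frechet_derivative_works[symmetric])
    show ?thesis using fun_cong[OF frechet_derivative_at[OF D], of v] by simp
  qed
  have "dderiv (v # vs) (\<lambda>x. a *\<^sub>R f x + b *\<^sub>R g x) x = dderiv vs (\<lambda>x. a *\<^sub>R ?f x + b *\<^sub>R ?g x) x"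
    unfolding dderiv.simps by (rule dderiv_cong[OF assms(1) fr Cons.prems(3)])
  also have "\<dots> = a *\<^sub>R dderiv vs ?f x + b *\<^sub>R dderiv vs ?g x"
    by (rule Cons.IH[OF sm Cons.prems(3)])
  finally show ?case by simp
qed simp

lemma smooth_on_lincomb:
  assumes "open S" and "smooth_on S f" and "smooth_on S g"
  shows "smooth_on S (\<lambda>x. a *\<^sub>R f x + b *\<^sub>R g x)"
  unfolding smooth_on_def
proof (intro allI ballI)
  fix vs x assume x: "x \<in> S"
  have "dderiv vs f differentiable (at x)" "dderiv vs g differentiable (at x)"
    by (rule assms(2,3)[unfolded smooth_on_def, THEN spec, THEN bspec, OF x])+
  then obtain D E
    where D: "(dderiv vs f has_derivative D) (at x)" and E: "(dderiv vs g has_derivative E) (at x)"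
    unfolding differentiable_def by (elim exE)
  from D E have "((\<lambda>y. a *\<^sub>R dderiv vs f y + b *\<^sub>R dderiv vs g y) has_derivative
      (\<lambda>v. a *\<^sub>R D v + b *\<^sub>R E v)) (at x)"
    by (intro has_derivative_add has_derivative_scaleR_right)
  then have "(dderiv vs (\<lambda>x. a *\<^sub>R f x + b *\<^sub>R g x) has_derivative (\<lambda>v. a *\<^sub>R D v + b *\<^sub>R E v)) (at x)"
    by (rule has_derivative_transform_within_open[OF _ assms(1) x])
      (rule dderiv_lincomb[OF assms, symmetric])
  then show "dderiv vs (\<lambda>x. a *\<^sub>R f x + b *\<^sub>R g x) differentiable (at x)"
    by (rule differentiableI)
qed

lemma smooth_on_subset:
  assumes "smooth_on S f" and "S' \<subseteq> S"
  shows "smooth_on S' f"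
  unfolding smooth_on_def
proof (intro allI ballI)
  fix vs x assume "x \<in> S'"
  then have "x \<in> S" using assms(2) by (rule subsetD[rotated])
  then show "dderiv vs f differentiable (at x)"
    by (rule assms(1)[unfolded smooth_on_def, THEN spec, THEN bspec])
qed

lemma Lam_lincomb:
  assumes "v \<in> Lam d" and "w \<in> Lam d"
  shows "a *\<^sub>R v + b *\<^sub>R w \<in> Lam d"
  unfolding Lam_def
proof (intro CollectI allI impI)
  fix I assume "(a *\<^sub>R v + b *\<^sub>R w) $ I \<noteq> 0"
  then have "v $ I \<noteq> 0 \<or> w $ I \<noteq> 0" by auto
  then show "int (card I) = d" using assms unfolding Lam_def by blast
qed

lemma forms_lincomb:
  assumes "open U" and "\<omega> \<in> forms U d" and "\<eta> \<in> forms U d"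
  shows "(\<lambda>p. a *\<^sub>R \<omega> p + b *\<^sub>R \<eta> p) \<in> forms U d"
  unfolding forms_def
proof (intro CollectI conjI ballI)
  show "smooth_on U (\<lambda>p. a *\<^sub>R \<omega> p + b *\<^sub>R \<eta> p)"
    using assms by (intro smooth_on_lincomb) (simp_all add: forms_def)
  show "a *\<^sub>R \<omega> p + b *\<^sub>R \<eta> p \<in> Lam d" if "p \<in> U" for p
    using assms that by (intro Lam_lincomb) (simp_all add: forms_def)
qed

lemma wedge_nth: "(a \<and>\<^sub>e b) $ K = (\<Sum>I\<in>Pow K. shuffle_sign I (K - I) * a $ I * b $ (K - I))"
  unfolding wedge_def by (rule vec_lambda_beta)

lemma wedge_lincomb: "(a *\<^sub>R v + b *\<^sub>R w) \<and>\<^sub>e u = a *\<^sub>R (v \<and>\<^sub>e u) + b *\<^sub>R (w \<and>\<^sub>e u)"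
  unfolding vec_eq_iff wedge_nth vector_add_component vector_scaleR_component real_scaleR_def
    sum_distrib_left sum.distrib[symmetric]
  by (intro allI sum.cong refl) (simp add: algebra_simps)

lemma rumin_null_lincomb:
  fixes U :: "'n::{finite,linorder} heis set"
  assumes "open U" and "\<omega> \<in> rumin_null U k" and "\<eta> \<in> rumin_null U k"
  shows "(\<lambda>p. a *\<^sub>R \<omega> p + b *\<^sub>R \<eta> p) \<in> rumin_null U k"
proof (cases "k \<le> CARD('n)")
  case True
  then have "\<omega> \<in> rumin_I U k" "\<eta> \<in> rumin_I U k"
    using assms(2,3) by (simp_all add: rumin_null_def)
  then obtain \<alpha> \<beta> \<alpha>' \<beta>' where
    *: "\<alpha> \<in> forms U (int k - 1)" "\<beta> \<in> forms U (int k - 2)"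
      "\<alpha>' \<in> forms U (int k - 1)" "\<beta>' \<in> forms U (int k - 2)"
    and eq: "\<forall>p\<in>U. \<omega> p = \<alpha> p \<and>\<^sub>e theta + \<beta> p \<and>\<^sub>e dtheta" "\<forall>p\<in>U. \<eta> p = \<alpha>' p \<and>\<^sub>e theta + \<beta>' p \<and>\<^sub>e dtheta"
    unfolding rumin_I_def by blast
  have "(\<lambda>p. a *\<^sub>R \<omega> p + b *\<^sub>R \<eta> p) \<in> rumin_I U k"
    unfolding rumin_I_def
  proof (rule CollectI, rule bexI, rule bexI, rule ballI)
    fix p assume "p \<in> U"
    then show "a *\<^sub>R \<omega> p + b *\<^sub>R \<eta> p =
        (a *\<^sub>R \<alpha> p + b *\<^sub>R \<alpha>' p) \<and>\<^sub>e theta + (a *\<^sub>R \<beta> p + b *\<^sub>R \<beta>' p) \<and>\<^sub>e dtheta"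
      using eq by (simp add: wedge_lincomb scaleR_add_right)
  qed (rule forms_lincomb[OF assms(1)] *)+
  then show ?thesis using True by (simp add: rumin_null_def)
next
  case False
  then show ?thesis using assms by (simp add: rumin_null_def)
qed

lemma forms_subset:
  assumes "\<omega> \<in> forms U d" and "V \<subseteq> U"
  shows "\<omega> \<in> forms V d"
  using assms smooth_on_subset[of U \<omega> V] by (auto simp: forms_def)

lemma rumin_null_subset:
  fixes U :: "'n::{finite,linorder} heis set"
  assumes "\<omega> \<in> rumin_null U k" and "V \<subseteq> U"
  shows "\<omega> \<in> rumin_null V k"
proof (cases "k \<le> CARD('n)")
  case True
  then have "\<omega> \<in> rumin_I U k" using assms(1) by (simp add: rumin_null_def)
  then obtain \<alpha> \<beta> where *: "\<alpha> \<in> forms U (int k - 1)" "\<beta> \<in> forms U (int k - 2)"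
    and eq: "\<forall>p\<in>U. \<omega> p = \<alpha> p \<and>\<^sub>e theta + \<beta> p \<and>\<^sub>e dtheta"
    unfolding rumin_I_def by (elim CollectE bexE)
  have "\<omega> \<in> rumin_I V k"
    unfolding rumin_I_def
  proof (rule CollectI, rule bexI, rule bexI, rule ballI)
    fix p assume "p \<in> V"
    with assms(2) have "p \<in> U" by (rule subsetD)
    with eq show "\<omega> p = \<alpha> p \<and>\<^sub>e theta + \<beta> p \<and>\<^sub>e dtheta" by (rule bspec)
  qed (rule forms_subset[OF _ assms(2)], rule *)+
  then show ?thesis using True by (simp add: rumin_null_def)
next
  case False
  then show ?thesis using assms by (auto simp: rumin_null_def)
qed

lemma test_reps_lincomb:
  fixes U :: "'n::{finite,linorder} heis set"
  assumes U: "open U" and \<omega>: "\<omega> \<in> test_reps U k" and \<eta>: "\<eta> \<in> test_reps U k"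
  shows "(\<lambda>p. a *\<^sub>R \<omega> p + b *\<^sub>R \<eta> p) \<in> test_reps U k"
proof -
  let ?c = "\<lambda>p. a *\<^sub>R \<omega> p + b *\<^sub>R \<eta> p"
  have reps: "?c \<in> rumin_reps U k"
  proof (cases "k \<le> CARD('n)")
    case True
    then show ?thesis
      using \<omega> \<eta> forms_lincomb[OF U, of \<omega> "int k" \<eta> a b] by (simp add: test_reps_def rumin_reps_def)
  next
    case False
    then have "\<omega> \<in> rumin_J U k" "\<eta> \<in> rumin_J U k"
      using \<omega> \<eta> by (simp_all add: test_reps_def rumin_reps_def)
    then have "?c \<in> rumin_J U k"
      using forms_lincomb[OF U, of \<omega> "int k" \<eta> a b] by (simp add: rumin_J_def wedge_lincomb)
    with False show ?thesis by (simp add: rumin_reps_def)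
  qed
  have sub: "rumin_spt U k ?c \<subseteq> rumin_spt U k \<omega> \<union> rumin_spt U k \<eta>"
  proof
    fix p assume p: "p \<in> rumin_spt U k ?c"
    show "p \<in> rumin_spt U k \<omega> \<union> rumin_spt U k \<eta>"
    proof (rule ccontr)
      assume "p \<notin> rumin_spt U k \<omega> \<union> rumin_spt U k \<eta>"
      then obtain V V' where V: "open V" "V \<subseteq> U" "p \<in> V" "\<omega> \<in> rumin_null V k"
        and V': "open V'" "V' \<subseteq> U" "p \<in> V'" "\<eta> \<in> rumin_null V' k"
        using p unfolding rumin_spt_def by blast
      have "?c \<in> rumin_null (V \<inter> V') k"
        by (intro rumin_null_lincomb open_Int V(1) V'(1) rumin_null_subset[OF V(4)]
            rumin_null_subset[OF V'(4)] Int_lower1 Int_lower2)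
      moreover have "open (V \<inter> V')" "V \<inter> V' \<subseteq> U" "p \<in> V \<inter> V'" using V V' by auto
      ultimately show False using p unfolding rumin_spt_def by blast
    qed
  qed
  define G where "G = \<Union>{V. open V \<and> V \<subseteq> U \<and> ?c \<in> rumin_null V k}"
  have "open G" unfolding G_def by (rule open_Union) blast
  have c: "compact (rumin_spt U k \<omega> \<union> rumin_spt U k \<eta>)"
    using \<omega> \<eta> by (simp add: test_reps_def compact_Un)
  have spt: "rumin_spt U k ?c = U - G" unfolding rumin_spt_def G_def ..
  have "rumin_spt U k \<omega> \<union> rumin_spt U k \<eta> \<subseteq> U" unfolding rumin_spt_def by blast
  with sub have "rumin_spt U k ?c = (rumin_spt U k \<omega> \<union> rumin_spt U k \<eta>) - G"
    unfolding spt by blast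
  then have "compact (rumin_spt U k ?c)" using compact_diff[OF c \<open>open G\<close>] by simp
  with reps show ?thesis by (simp add: test_reps_def)
qed

lemma topspace_test_topology:
  assumes "open U"
  shows "topspace (test_topology U k) = test_space U k"
proof -
  have in_space: "rumin_class U k \<omega> \<in> test_space U k" if "\<omega> \<in> test_reps U k" for \<omega>
    using that by (simp add: test_space_def)
  have nhd: "test_nhd0 U k (test_space U k)"
    unfolding test_nhd0_def
  proof (intro conjI ballI allI impI)
    fix K
    show "\<exists>L m. \<exists>\<epsilon>>0. compact L \<and> L \<subseteq> U \<and>
           (\<forall>\<omega>\<in>test_reps U k. rumin_spt U k \<omega> \<subseteq> K \<longrightarrow>
              (\<forall>p\<in>L. \<forall>vs. length vs \<le> m \<and> set vs \<subseteq> Basis \<longrightarrow> norm (dderiv vs \<omega> p) < \<epsilon>) \<longrightarrow>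
              rumin_class U k \<omega> \<in> test_space U k)"
      by (rule exI[of _ "{}"], rule exI[of _ 0], rule exI[of _ 1]) (simp add: in_space)
  qed (rule subset_refl, rule in_space, rule test_reps_lincomb[OF assms], assumption+)
  have add: "rumin_class U k (\<lambda>p. \<omega> p + \<eta> p) \<in> test_space U k"
    if "\<omega> \<in> test_reps U k" "\<eta> \<in> test_reps U k" for \<omega> \<eta>
    using in_space[OF test_reps_lincomb[OF assms that, of 1 1]] by simp
  have "test_open U k (test_space U k)"
    unfolding test_open_def using nhd add by blast
  moreover have "G \<subseteq> test_space U k" if "test_open U k G" for G
    using that unfolding test_open_def by blast
  ultimately show ?thesis
    unfolding topspace_def openin_test_topology by blast
qed

end

theory Submission
  imports Defs
begin

text \<open>
  If the mass of \<open>T\<close> is finite, \<open>T\<close> is a functional on test forms that is bounded in the sup norm.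
  Its variation, defined on open sets by the supremum of the functional over test forms of norm at
  most one, extends to a finite Borel measure by Caratheodory's criterion, and a layer cake argument
  bounds the functional by the \<open>L\<^sup>1\<close> norm of this measure.  Adding the measure makes each component
  a positive functional, hence a measure with a Radon-Nikodym density, and these densities are the
  components of a vector field representing \<open>T\<close>.  A covector on which all simple integrable vectors
  vanish is not seen by \<open>T\<close>, so this field may be replaced by one with values in \<open>HLam k\<close>; dividing
  it by its dual norm and multiplying the measure by that norm gives the representation.  Conversely,
  a representing measure vanishes off the support of \<open>T\<close>, and it is finite on that compact set.
\<close>

section \<open>Calculus of smooth maps\<close>

text \<open>Two features shape the proof. Test forms are smooth, so absolute values, maxima and
  truncations lead out of the class; smooth steps and cutoffs stand in for them throughout. Moreover
  the comass is in general only a seminorm: it does not change when a covector orthogonal to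
  \<open>HLam k\<close> is added, so forms of comass at most one need not be uniformly bounded. When
  the functional is bounded, only the estimate of the comass by the Euclidean norm enters; and the
  dual norm is finite on \<open>HLam k\<close> but possibly not elsewhere, which is why the density
  has to be moved into \<open>HLam k\<close> before it can be normalised. The measure theory
  concerns maps into a full Euclidean space, whereas test forms take values in a subspace of
  covectors and, in low degrees, matter only up to a further subspace. The current is therefore
  composed with a linear projection onto the Rumin covectors, and independence of the representative
  is recovered afterwards, almost everywhere, because the zero class is mapped to zero.\<close>

lemma smooth_on_coinduct:
  assumes "open S" and "P f"
    and step: "\<And>f x. P f \<Longrightarrow> x \<in> S \<Longrightarrow> f differentiable (at x)"
      "\<And>f v. P f \<Longrightarrow> \<exists>g. P g \<and> (\<forall>x\<in>S. frechet_derivative f (at x) v = g x)"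
  shows "smooth_on S f"
proof -
  \<comment> \<open>\<open>dderiv\<close> applies the first direction innermost, so the induction on
    the list keeps f arbitrary and trades it for a map g equal to its directional derivative. The
    two agree only on S, which suffices because S is open.\<close>
  have "dderiv vs f differentiable (at x)" if "P f" "x \<in> S" for vs f x
    using that
  proof (induction vs arbitrary: f x)
    case Nil
    then show ?case by (simp add: step(1))
  next
    case (Cons v vs)
    obtain g where g: "P g" "\<And>x. x \<in> S \<Longrightarrow> frechet_derivative f (at x) v = g x"
      using step(2)[OF Cons.prems(1), of v] by blast
    obtain D where "(dderiv vs g has_derivative D) (at x)"
      using Cons.IH[OF g(1) Cons.prems(2)] by (auto simp: differentiable_def)
    then have "(dderiv vs (\<lambda>x. frechet_derivative f (at x) v) has_derivative D) (at x)"
      by (rule has_derivative_transform_within_open[OF _ \<open>open S\<close> Cons.prems(2)])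
        (rule dderiv_cong[OF \<open>open S\<close>], simp_all add: g(2))
    then show ?case by (auto simp: differentiable_def)
  qed
  then show ?thesis using \<open>P f\<close> by (auto simp: smooth_on_def)
qed

lemma smooth_on_cong:
  fixes f g :: "'a::real_normed_vector \<Rightarrow> 'b::real_normed_vector"
  assumes "open S" and "smooth_on S f" and "\<And>x. x \<in> S \<Longrightarrow> g x = f x"
  shows "smooth_on S g"
proof (rule smooth_on_coinduct[OF assms(1), where P = "\<lambda>g. \<exists>f. smooth_on S f \<and> (\<forall>x\<in>S. g x = f x)"])
  show "\<exists>f. smooth_on S f \<and> (\<forall>x\<in>S. g x = f x)" using assms by blast
next
  have der: "(h has_derivative frechet_derivative f (at x)) (at x)"
    if "x \<in> S" "smooth_on S f" "\<forall>x\<in>S. h x = f x" for f h x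
    by (rule has_derivative_transform_within_open[OF _ assms(1) that(1), of f])
      (use that in \<open>auto simp: frechet_derivative_works[symmetric] intro: smooth_on_differentiable\<close>)
  show "h differentiable (at x)"
    if h: "\<exists>f. smooth_on S f \<and> (\<forall>x\<in>S. h x = f x)" and x: "x \<in> S" for h x
  proof -
    obtain f where "smooth_on S f" "\<forall>x\<in>S. h x = f x" using h by blast
    from der[OF x this] show ?thesis by (rule differentiableI)
  qed
  show "\<exists>g. (\<exists>f. smooth_on S f \<and> (\<forall>x\<in>S. g x = f x)) \<and> (\<forall>x\<in>S. frechet_derivative h (at x) v = g x)"
    if h: "\<exists>f. smooth_on S f \<and> (\<forall>x\<in>S. h x = f x)" for h v
  proof -
    obtain f where f: "smooth_on S f" "\<forall>x\<in>S. h x = f x" using h by blast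
    show ?thesis
      by (rule exI[of _ "\<lambda>x. frechet_derivative f (at x) v"])
        (use smooth_on_dderiv[OF f(1), of v] frechet_derivative_at[OF der[OF _ f]] in auto)
  qed
qed

lemma smooth_on_Un: "smooth_on (S \<union> T) f \<longleftrightarrow> smooth_on S f \<and> smooth_on T f"
  by (auto simp: smooth_on_def)

lemma smooth_on_const: "smooth_on S (\<lambda>x. c)"
proof -
  have "smooth_on UNIV (\<lambda>x. c)"
    by (rule smooth_on_coinduct[OF open_UNIV, where P = "\<lambda>f. \<exists>c. f = (\<lambda>x. c)"]) auto
  then show ?thesis by (rule smooth_on_subset) simp
qed

lemma smooth_on_linear:
  assumes "open S" and "bounded_linear h" and "smooth_on S f"
  shows "smooth_on S (\<lambda>x. h (f x))"
proof (rule smooth_on_coinduct[OF assms(1), where P = "\<lambda>g. \<exists>f. smooth_on S f \<and> g = (\<lambda>x. h (f x))"])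
  show "\<exists>f'. smooth_on S f' \<and> (\<lambda>x. h (f x)) = (\<lambda>x. h (f' x))" using assms by blast
next
  have der: "((\<lambda>x. h (f x)) has_derivative (\<lambda>v. h (frechet_derivative f (at x) v))) (at x)"
    if "x \<in> S" "smooth_on S f" for f and x
    using smooth_on_differentiable[OF that(2,1)] bounded_linear.has_derivative[OF assms(2)]
    by (simp add: frechet_derivative_works)
  show "g differentiable (at x)" if "\<exists>f. smooth_on S f \<and> g = (\<lambda>x. h (f x))" "x \<in> S" for g x
    using that der by (blast intro: differentiableI)
  show "\<exists>g'. (\<exists>f. smooth_on S f \<and> g' = (\<lambda>x. h (f x))) \<and> (\<forall>x\<in>S. frechet_derivative g (at x) v = g' x)"
    if g: "\<exists>f. smooth_on S f \<and> g = (\<lambda>x. h (f x))" for g v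
  proof -
    obtain f where f: "smooth_on S f" "g = (\<lambda>x. h (f x))" using g by blast
    show ?thesis
      by (rule exI[of _ "\<lambda>x. h (frechet_derivative f (at x) v)"])
        (use smooth_on_dderiv[OF f(1), of v] frechet_derivative_at[OF der[OF _ f(1)], symmetric] f(2) in auto)
  qed
qed

lemma smooth_on_id: "smooth_on S (\<lambda>x. x)"
proof -
  \<comment> \<open>Constants belong to the class because they are the directional derivatives of
    the identity.\<close>
  have "smooth_on UNIV (\<lambda>x::'a. x)"
    by (rule smooth_on_coinduct[OF open_UNIV, where P = "\<lambda>f. f = (\<lambda>x. x) \<or> (\<exists>c. f = (\<lambda>x. c))"]) auto
  then show ?thesis by (rule smooth_on_subset) simp
qed

lemma smooth_on_diff:
  assumes "open S" and "smooth_on S f" and "smooth_on S g"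
  shows "smooth_on S (\<lambda>x. f x - g x)"
  using smooth_on_lincomb[OF assms, of 1 "-1"] by simp

text \<open>
  Since smoothness is coinductive, a class of maps consists of smooth maps as soon as it is closed
  under directional derivatives; for products this class is the set of sums of products.
\<close>

inductive_set sums_of :: "('a \<Rightarrow> 'b::real_normed_vector) set \<Rightarrow> ('a \<Rightarrow> 'b) set" for G where
  gen: "f \<in> G \<Longrightarrow> f \<in> sums_of G"
| add: "f \<in> sums_of G \<Longrightarrow> g \<in> sums_of G \<Longrightarrow> (\<lambda>x. f x + g x) \<in> sums_of G"

lemma smooth_on_sums_of:
  fixes G :: "('a::real_normed_vector \<Rightarrow> 'b::real_normed_vector) set"
  assumes "open S" and "f \<in> sums_of G"
    and G: "\<And>f x. f \<in> G \<Longrightarrow> x \<in> S \<Longrightarrow> f differentiable (at x)"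
      "\<And>f v. f \<in> G \<Longrightarrow> \<exists>g\<in>sums_of G. \<forall>x\<in>S. frechet_derivative f (at x) v = g x"
  shows "smooth_on S f"
proof (rule smooth_on_coinduct[OF assms(1), where P = "\<lambda>f. f \<in> sums_of G"])
  show d: "f differentiable (at x)" if "f \<in> sums_of G" "x \<in> S" for f x
    using that by induction (auto intro: G(1))
  show "\<exists>g. g \<in> sums_of G \<and> (\<forall>x\<in>S. frechet_derivative f (at x) v = g x)" if "f \<in> sums_of G" for f v
    using that
  proof induction
    case (gen f)
    then show ?case using G(2)[OF gen, of v] by blast
  next
    case (add f g)
    obtain f' where f': "f' \<in> sums_of G" "\<forall>x\<in>S. frechet_derivative f (at x) v = f' x"
      using add.IH(1) by blast
    obtain g' where g': "g' \<in> sums_of G" "\<forall>x\<in>S. frechet_derivative g (at x) v = g' x"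
      using add.IH(2) by blast
    have "frechet_derivative (\<lambda>x. f x + g x) (at x) v = f' x + g' x" if "x \<in> S" for x
    proof -
      have "((\<lambda>x. f x + g x) has_derivative
          (\<lambda>v. frechet_derivative f (at x) v + frechet_derivative g (at x) v)) (at x)"
        using d[OF add.hyps(1) that] d[OF add.hyps(2) that]
        by (auto simp: frechet_derivative_works intro: has_derivative_add)
      from frechet_derivative_at[OF this, symmetric] show ?thesis using f' g' that by simp
    qed
    then show ?case using sums_of.add[OF f'(1) g'(1)] by blast
  qed
qed (rule assms(2))

lemma smooth_on_bilinear:
  fixes h :: "'b::real_normed_vector \<Rightarrow> 'c::real_normed_vector \<Rightarrow> 'd::real_normed_vector"
    and f :: "'a::real_normed_vector \<Rightarrow> 'b"
  assumes "open S" and "bounded_bilinear h" and "smooth_on S f" and "smooth_on S g"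
  shows "smooth_on S (\<lambda>x. h (f x) (g x))"
proof -
  define G where "G = {F. \<exists>f g. F = (\<lambda>x. h (f x) (g x)) \<and> smooth_on S f \<and> smooth_on S g}"
  have G: "(\<lambda>x. h (f x) (g x)) \<in> sums_of G" if "smooth_on S f" "smooth_on S g" for f g
    by (rule sums_of.gen) (use that in \<open>auto simp: G_def\<close>)
  have der: "((\<lambda>x. h (f x) (g x)) has_derivative
      (\<lambda>v. h (f x) (frechet_derivative g (at x) v) + h (frechet_derivative f (at x) v) (g x))) (at x)"
    if "x \<in> S" "smooth_on S f" "smooth_on S g" for f g x
    using smooth_on_differentiable[OF that(2,1)] smooth_on_differentiable[OF that(3,1)]
    by (auto simp: frechet_derivative_works intro: bounded_bilinear.FDERIV[OF assms(2)])
  show ?thesis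
  proof (rule smooth_on_sums_of[OF assms(1)])
    show "(\<lambda>x. h (f x) (g x)) \<in> sums_of G" by (rule G[OF assms(3,4)])
    show "F differentiable (at x)" if "F \<in> G" "x \<in> S" for F x
      using that unfolding G_def by (auto intro: differentiableI der)
    show "\<exists>F'\<in>sums_of G. \<forall>x\<in>S. frechet_derivative F (at x) v = F' x" if F: "F \<in> G" for F v
    proof -
      obtain a b where ab: "F = (\<lambda>x. h (a x) (b x))" "smooth_on S a" "smooth_on S b"
        using F unfolding G_def by auto
      let ?a = "\<lambda>x. frechet_derivative a (at x) v" and ?b = "\<lambda>x. frechet_derivative b (at x) v"
      have "(\<lambda>x. h (a x) (?b x) + h (?a x) (b x)) \<in> sums_of G"
        using ab by (intro sums_of.add G smooth_on_dderiv)
      then show ?thesis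
        by (rule bexI[rotated]) (use frechet_derivative_at[OF der[OF _ ab(2,3)], symmetric] ab(1) in auto)
    qed
  qed
qed

lemmas smooth_on_scaleR = smooth_on_bilinear[OF _ bounded_bilinear_scaleR]
lemmas smooth_on_mult = smooth_on_bilinear[OF _ bounded_bilinear_mult]
lemmas smooth_on_inner = smooth_on_bilinear[OF _ bounded_bilinear_inner]

text \<open>Each differentiation of f composed with \<phi> leaves behind a directional derivative of
  \<phi>. The generators carry a free smooth factor \<psi> that absorbs it, and the closure of C
  under derivatives supplies the outer functions.\<close>

lemma smooth_on_compose_real:
  fixes C :: "(real \<Rightarrow> real) set" and \<phi> :: "'a::real_normed_vector \<Rightarrow> real"
  assumes "open S" and "f \<in> C" and C: "\<And>f. f \<in> C \<Longrightarrow> \<exists>f'\<in>C. \<forall>x. (f has_real_derivative f' x) (at x)"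
    and \<phi>: "smooth_on S \<phi>"
  shows "smooth_on S (\<lambda>x. f (\<phi> x))"
proof -
  define G where "G = {F. \<exists>f\<in>C. \<exists>\<psi>. F = (\<lambda>x. f (\<phi> x) * \<psi> x) \<and> smooth_on S \<psi>}"
  have G: "(\<lambda>x. f (\<phi> x) * \<psi> x) \<in> sums_of G" if "f \<in> C" "smooth_on S \<psi>" for f \<psi>
    by (rule sums_of.gen) (use that in \<open>auto simp: G_def\<close>)
  have der: "((\<lambda>x. f (\<phi> x) * \<psi> x) has_derivative
      (\<lambda>v. f (\<phi> x) * frechet_derivative \<psi> (at x) v + (frechet_derivative \<phi> (at x) v * f' (\<phi> x)) * \<psi> x)) (at x)"
    if "x \<in> S" "\<forall>x. (f has_real_derivative f' x) (at x)" "smooth_on S \<psi>" for f f' \<psi> x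
  proof (rule has_derivative_mult)
    show "(\<psi> has_derivative frechet_derivative \<psi> (at x)) (at x)"
      using smooth_on_differentiable[OF that(3,1)] by (simp add: frechet_derivative_works)
    have "(\<phi> has_derivative frechet_derivative \<phi> (at x)) (at x)"
      using smooth_on_differentiable[OF \<phi> that(1)] by (simp add: frechet_derivative_works)
    moreover have "(f has_derivative (\<lambda>v. v * f' (\<phi> x))) (at (\<phi> x))"
      using that(2) by (simp add: has_field_derivative_def mult.commute[of _ "f' _"])
    ultimately show "((\<lambda>x. f (\<phi> x)) has_derivative (\<lambda>v. frechet_derivative \<phi> (at x) v * f' (\<phi> x))) (at x)"
      by (rule has_derivative_compose)
  qed
  show ?thesis
  proof (rule smooth_on_sums_of[OF assms(1)])
    show "(\<lambda>x. f (\<phi> x)) \<in> sums_of G" using G[OF assms(2) smooth_on_const[of S 1]] by simp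
    show "F differentiable (at x)" if F: "F \<in> G" and x: "x \<in> S" for F x
    proof -
      obtain f \<psi> where f: "F = (\<lambda>x. f (\<phi> x) * \<psi> x)" "f \<in> C" "smooth_on S \<psi>"
        using F unfolding G_def by auto
      obtain f' where "\<forall>x. (f has_real_derivative f' x) (at x)" using C[OF f(2)] by auto
      from der[OF x this f(3)] show ?thesis unfolding f(1) by (rule differentiableI)
    qed
    show "\<exists>F'\<in>sums_of G. \<forall>x\<in>S. frechet_derivative F (at x) v = F' x" if F: "F \<in> G" for F v
    proof -
      obtain f \<psi> where f: "F = (\<lambda>x. f (\<phi> x) * \<psi> x)" "f \<in> C" "smooth_on S \<psi>"
        using F unfolding G_def by auto
      obtain f' where f': "f' \<in> C" "\<forall>x. (f has_real_derivative f' x) (at x)" using C[OF f(2)] by auto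
      let ?\<psi> = "\<lambda>x. frechet_derivative \<psi> (at x) v" and ?\<phi> = "\<lambda>x. frechet_derivative \<phi> (at x) v * \<psi> x"
      have "(\<lambda>x. f (\<phi> x) * ?\<psi> x + f' (\<phi> x) * ?\<phi> x) \<in> sums_of G"
        using f f' \<phi> by (intro sums_of.add G smooth_on_dderiv smooth_on_mult[OF \<open>open S\<close>])
      then show ?thesis
        by (rule bexI[rotated])
          (use frechet_derivative_at[OF der[OF _ f'(2) f(3)], symmetric] f(1) in \<open>auto simp: mult_ac\<close>)
    qed
  qed
qed


section \<open>Smooth cutoff functions\<close>

text \<open>The derivatives of exp(-1/s), extended by zero, are combinations of the members of this
  family with integer coefficients; indexing by the power j makes the family closed under
  differentiation in this sense.\<close>

definition flat_exp :: "nat \<Rightarrow> real \<Rightarrow> real" where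
  "flat_exp j s = (if s > 0 then exp (- 1 / s) / s ^ j else 0)"

text \<open>One term of the exponential series at 1/s, that of order j + 2, gives the estimate. The
  two extra powers make the difference quotient at 0 tend to 0.\<close>

lemma flat_exp_le:
  assumes "s > 0"
  shows "flat_exp j s \<le> fact (j + 2) * s\<^sup>2"
proof -
  have "(1 / s) ^ (j + 2) / fact (j + 2) \<le> exp (1 / s)"
  proof -
    have "(\<Sum>n\<in>{j + 2}. inverse (fact n) * (1 / s) ^ n) \<le> (\<Sum>n. inverse (fact n) * (1 / s) ^ n)"
      by (rule sum_le_suminf[OF summable_exp]) (use assms in auto)
    also have "\<dots> = exp (1 / s)" by (simp add: exp_def scaleR_conv_of_real)
    finally show ?thesis by (simp add: field_simps)
  qed
  then have "inverse (fact (j + 2) * s ^ (j + 2)) \<le> exp (1 / s)"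
    by (simp only: power_one_over inverse_eq_divide divide_divide_eq_left mult.commute)
  then have "inverse (exp (1 / s)) \<le> inverse (inverse (fact (j + 2) * s ^ (j + 2)))"
    by (rule le_imp_inverse_le) (use assms in simp)
  then have "exp (- 1 / s) \<le> (fact (j + 2) * s\<^sup>2) * s ^ j"
    by (simp only: exp_minus[symmetric] inverse_inverse_eq power_add minus_divide_left mult_ac)
  then show ?thesis using assms
    by (simp only: flat_exp_def if_True pos_divide_le_eq zero_less_power)
qed

lemma flat_exp_nonneg: "0 \<le> flat_exp j s"
  by (simp add: flat_exp_def)

text \<open>Only s = 0 goes beyond the quotient rule; there \<open>flat_exp_le\<close> bounds the
  difference quotient by a multiple of |h|.\<close>

lemma has_derivative_flat_exp:
  "(flat_exp j has_real_derivative flat_exp (j + 2) s - j * flat_exp (j + 1) s) (at s)"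
proof (cases s "0 :: real" rule: linorder_cases)
  case less
  have "((\<lambda>s. 0) has_real_derivative 0) (at s)" by simp
  then have "(flat_exp j has_real_derivative 0) (at s)"
    by (rule has_field_derivative_transform_within_open[OF _ open_lessThan[of 0]])
      (use less in \<open>auto simp: flat_exp_def\<close>)
  then show ?thesis using less by (simp add: flat_exp_def)
next
  case equal
  have "((\<lambda>h. flat_exp j h / h) \<longlongrightarrow> 0) (at 0)"
  proof (rule Lim_null_comparison)
    show "\<forall>\<^sub>F h in at 0. norm (flat_exp j h / h) \<le> fact (j + 2) * \<bar>h\<bar>"
    proof (rule always_eventually, rule allI)
      fix h :: real
      show "norm (flat_exp j h / h) \<le> fact (j + 2) * \<bar>h\<bar>"
      proof (cases "h > 0")
        case True
        with flat_exp_le[OF True, of j] flat_exp_nonneg[of j h] show ?thesis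
          by (simp add: divide_le_eq power2_eq_square mult.assoc del: fact_Suc)
      next
        case False
        then have "norm (flat_exp j h / h) = 0" by (simp add: flat_exp_def)
        also have "0 \<le> fact (j + 2) * \<bar>h\<bar>" by (intro mult_nonneg_nonneg) auto
        finally show ?thesis .
      qed
    qed
    show "((\<lambda>h. fact (j + 2) * \<bar>h\<bar>) \<longlongrightarrow> 0) (at (0::real))"
      by (intro tendsto_mult_right_zero tendsto_rabs_zero tendsto_ident_at)
  qed
  then have "(flat_exp j has_real_derivative 0) (at 0)"
    by (simp add: DERIV_def flat_exp_def)
  then show ?thesis using equal by (simp add: flat_exp_def)
next
  case greater
  have "((\<lambda>s. exp (- 1 / s) / s ^ j) has_real_derivative
      exp (- 1 / s) / s ^ (j + 2) - j * (exp (- 1 / s) / s ^ (j + 1))) (at s)"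
  proof -
    have "j * s ^ (j - 1) * s = j * s ^ j" by (cases j) auto
    then have "j * s ^ (j - 1) = j * s ^ j / s" using greater by (simp add: field_simps)
    then show ?thesis using greater
      by (auto intro!: derivative_eq_intros simp: field_simps power2_eq_square)
  qed
  then have "(flat_exp j has_real_derivative
      exp (- 1 / s) / s ^ (j + 2) - j * (exp (- 1 / s) / s ^ (j + 1))) (at s)"
    by (rule has_field_derivative_transform_within_open[OF _ open_greaterThan[of 0]])
      (use greater in \<open>auto simp: flat_exp_def\<close>)
  then show ?thesis using greater by (simp add: flat_exp_def)
qed

text \<open>The product \<open>flat_exp i (2 * s - 1) * flat_exp j (1 - s)\<close> is a bump,
  positive exactly for 1/2 < s < 1. The class contains the density of the smooth step together with
  all its derivatives.\<close>

inductive_set step_class :: "(real \<Rightarrow> real) set" where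
  flat: "(\<lambda>s. c * (flat_exp i (2 * s - 1) * flat_exp j (1 - s))) \<in> step_class"
| add: "f \<in> step_class \<Longrightarrow> g \<in> step_class \<Longrightarrow> (\<lambda>s. f s + g s) \<in> step_class"

lemma step_class_derivative:
  assumes "f \<in> step_class"
  shows "\<exists>f'\<in>step_class. \<forall>s. (f has_real_derivative f' s) (at s)"
  using assms
proof induction
  case (flat c i j)
  let ?E = "\<lambda>i j s. flat_exp i (2 * s - 1) * flat_exp j (1 - s)"
  \<comment> \<open>The factors 2 and -1 are the inner derivatives of \<open>2 * s - 1\<close> and
    \<open>1 - s\<close>; each of the two \<open>flat_exp\<close> factors contributes two
    terms.\<close>
  let ?f' = "\<lambda>s. (2 * c * ?E (i + 2) j s + (- 2 * c * i) * ?E (i + 1) j s) +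
      (- c * ?E i (j + 2) s + (c * j) * ?E i (j + 1) s)"
  have f': "?f' \<in> step_class" by (intro step_class.intros)
  have "((\<lambda>s. c * ?E i j s) has_real_derivative ?f' s) (at s)" for s
    by (auto intro!: derivative_eq_intros DERIV_chain2[OF has_derivative_flat_exp] simp: algebra_simps)
  then show ?case by (intro bexI[OF _ f'] allI)
next
  case (add f g)
  obtain f' g' where "f' \<in> step_class" "\<forall>s. (f has_real_derivative f' s) (at s)"
    "g' \<in> step_class" "\<forall>s. (g has_real_derivative g' s) (at s)"
    using add.IH by blast
  then show ?case by (intro bexI[of _ "\<lambda>s. f' s + g' s"]) (auto intro: DERIV_add step_class.add)
qed

text \<open>The step is the normalised primitive of a bump living between 1/2 and 1. The primitive
  is constant where the bump vanishes and strictly larger at 1 than at 1/2, so it can be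
  normalised.\<close>

lemma ex_smooth_step:
  "\<exists>h :: real \<Rightarrow> real. (\<forall>s \<le> 1 / 2. h s = 0) \<and> (\<forall>s \<ge> 1. h s = 1) \<and> (\<forall>s. 0 \<le> h s \<and> h s \<le> 1) \<and>
     (\<forall>\<phi>::'a::real_normed_vector \<Rightarrow> real. smooth_on UNIV \<phi> \<longrightarrow> smooth_on UNIV (\<lambda>x. h (\<phi> x)))"
proof -
  let ?E = "\<lambda>s. 1 * (flat_exp 0 (2 * s - 1) * flat_exp 0 (1 - s))"
  have E: "?E \<in> step_class" by (rule step_class.flat)
  have cont: "isCont ?E s" for s
    using step_class_derivative[OF E] by (auto intro: DERIV_isCont)
  have "\<exists>F. \<forall>s. -\<infinity> < ereal s \<longrightarrow> ereal s < \<infinity> \<longrightarrow> (F has_vector_derivative ?E s) (at s)"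
    by (rule einterval_antiderivative) (use cont in auto)
  then obtain F where F: "(F has_real_derivative ?E s) (at s)" for s
    by (auto simp: has_real_derivative_iff_has_vector_derivative)
  have mono: "F s \<le> F t" if "s \<le> t" for s t
    by (rule DERIV_nonneg_imp_nondecreasing[OF that])
      (use F in \<open>fastforce simp: flat_exp_nonneg\<close>)
  have less: "F (1 / 2) < F 1"
    by (rule DERIV_pos_imp_increasing_open)
      (use F in \<open>auto simp: flat_exp_def intro!: exI continuous_at_imp_continuous_on DERIV_isCont\<close>)
  have flat: "(F has_real_derivative 0) (at s)" if "s \<le> 1 / 2 \<or> 1 \<le> s" for s
    using F[of s] that by (auto simp: flat_exp_def)
  have F_cont: "continuous_on X F" for X
    by (intro continuous_at_imp_continuous_on ballI DERIV_isCont[OF F])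
  have left: "F s = F (1 / 2)" if "s \<le> 1 / 2" for s
  proof (cases "s = 1 / 2")
    case True
    then show ?thesis by (simp only:)
  next
    case False
    show ?thesis
      by (rule DERIV_isconst_end[of s "1/2" F, symmetric])
        (use that False flat F_cont in auto)
  qed
  have right: "F s = F 1" if "1 \<le> s" for s
  proof (cases "s = 1")
    case False
    show ?thesis
      by (rule DERIV_isconst_end[of 1 s F])
        (use that False flat F_cont in auto)
  qed simp
  define h where "h s = (1 / (F 1 - F (1 / 2))) * (F s - F (1 / 2))" for s
  \<comment> \<open>\<open>h\<close> is outside \<open>step_class\<close>, but its derivative is a
    multiple of the bump, so the class stays closed under derivatives when \<open>h\<close> is
    added.\<close>
  define C where "C = insert h step_class"
  have C: "\<exists>f'\<in>C. \<forall>x. (f has_real_derivative f' x) (at x)" if "f \<in> C" for f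
  proof (cases "f = h")
    case True
    have "(\<lambda>s. 1 / (F 1 - F (1 / 2)) * (flat_exp 0 (2 * s - 1) * flat_exp 0 (1 - s))) \<in> C"
      unfolding C_def by (intro insertI2 step_class.flat)
    then show ?thesis
      by (rule bexI[rotated])
        (use F less in \<open>auto simp: True h_def[abs_def] intro!: DERIV_cmult derivative_eq_intros\<close>)
  next
    case False
    then show ?thesis using that step_class_derivative[of f] unfolding C_def by blast
  qed
  show ?thesis
  proof (rule exI[of _ h], intro conjI allI impI)
    fix s :: real
    show "h s = 0" if "s \<le> 1 / 2" using left[OF that] by (simp add: h_def)
    show "h s = 1" if "s \<ge> 1" using right[OF that] less by (simp add: h_def)
    have "F (1 / 2) \<le> F s"
      using mono[of "1 / 2" s] left[of s] by (cases "s \<le> 1 / 2") auto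
    then show "0 \<le> h s" using less by (simp add: h_def)
    have "F s \<le> F 1" using mono[of s 1] right[of s] by (cases "s \<le> 1") auto
    then show "h s \<le> 1" using less by (simp add: h_def field_simps)
    show "smooth_on UNIV (\<lambda>x. h (\<phi> x))" if "smooth_on UNIV \<phi>" for \<phi> :: "'a \<Rightarrow> real"
      by (rule smooth_on_compose_real[OF open_UNIV _ C that]) (auto simp: C_def)
  qed
qed

text \<open>\<open>u\<close> is 1 on a whole neighbourhood W of K. If f vanishes off a compact set
  L, then (1 - u) f vanishes off the compact set L - W; with u = 1 on K alone this could
  fail.\<close>

definition cutoff_between ::
  "'a::real_normed_vector set \<Rightarrow> 'a set \<Rightarrow> ('a \<Rightarrow> real) \<Rightarrow> bool" where
  "cutoff_between K V u \<longleftrightarrow> smooth_on UNIV u \<and> (\<forall>x. 0 \<le> u x \<and> u x \<le> 1) \<and>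
     (\<exists>W. open W \<and> K \<subseteq> W \<and> (\<forall>x\<in>W. u x = 1)) \<and>
     (\<exists>C. compact C \<and> C \<subseteq> V \<and> (\<forall>x. x \<notin> C \<longrightarrow> u x = 0))"

text \<open>The combination is a smooth substitute for the maximum of u and u': it is 1 where either
  is 1, 0 where both are 0, and stays between 0 and 1.\<close>

lemma cutoff_between_Un:
  assumes "cutoff_between K V u" and "cutoff_between K' V u'"
  shows "cutoff_between (K \<union> K') V (\<lambda>x. 1 - (1 - u x) * (1 - u' x))"
proof -
  obtain W C where W: "open W" "K \<subseteq> W" "\<forall>x\<in>W. u x = 1"
    and C: "compact C" "C \<subseteq> V" "\<forall>x. x \<notin> C \<longrightarrow> u x = 0"
    using assms(1) unfolding cutoff_between_def by blast
  obtain W' C' where W': "open W'" "K' \<subseteq> W'" "\<forall>x\<in>W'. u' x = 1"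
    and C': "compact C'" "C' \<subseteq> V" "\<forall>x. x \<notin> C' \<longrightarrow> u' x = 0"
    using assms(2) unfolding cutoff_between_def by blast
  have u: "smooth_on UNIV u" "smooth_on UNIV u'" and le: "0 \<le> u x" "u x \<le> 1" "0 \<le> u' x" "u' x \<le> 1" for x
    using assms unfolding cutoff_between_def by auto
  show ?thesis
    unfolding cutoff_between_def
  proof (intro conjI allI)
    show "smooth_on UNIV (\<lambda>x. 1 - (1 - u x) * (1 - u' x))"
      by (intro smooth_on_diff smooth_on_mult open_UNIV smooth_on_const u)
    show "0 \<le> 1 - (1 - u x) * (1 - u' x)" for x
      using mult_le_one[of "1 - u x" "1 - u' x"] le[of x] by simp
    show "1 - (1 - u x) * (1 - u' x) \<le> 1" for x
      using le[of x] by simp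
    show "\<exists>W. open W \<and> K \<union> K' \<subseteq> W \<and> (\<forall>x\<in>W. 1 - (1 - u x) * (1 - u' x) = 1)"
      using W W' by (intro exI[of _ "W \<union> W'"]) auto
    show "\<exists>C. compact C \<and> C \<subseteq> V \<and> (\<forall>x. x \<notin> C \<longrightarrow> 1 - (1 - u x) * (1 - u' x) = 0)"
      using C C' by (intro exI[of _ "C \<union> C'"]) (auto intro: compact_Un)
  qed
qed

lemma cutoff_between_subset:
  "cutoff_between K V u \<Longrightarrow> K' \<subseteq> K \<Longrightarrow> V \<subseteq> V' \<Longrightarrow> cutoff_between K' V' u"
  unfolding cutoff_between_def by (meson subset_trans)

lemma ex_cutoff_ball:
  fixes x :: "'a::euclidean_space"
  assumes "r > 0"
  shows "\<exists>u. cutoff_between (ball x r) (cball x (2 * r)) u"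
proof -
  obtain h :: "real \<Rightarrow> real" where h: "\<forall>s \<le> 1 / 2. h s = 0" "\<forall>s \<ge> 1. h s = 1"
    "\<forall>s. 0 \<le> h s \<and> h s \<le> 1" "\<And>\<phi>::'a \<Rightarrow> real. smooth_on UNIV \<phi> \<Longrightarrow> smooth_on UNIV (\<lambda>x. h (\<phi> x))"
    using ex_smooth_step[where 'a = 'a] by blast
  \<comment> \<open>The squared distance is smooth, unlike the distance. Inside radius r the value
    is at least 1; outside radius 2 r it is at most 2 - 4, below the threshold 1/2 of
    \<open>h\<close>.\<close>
  define \<phi> where "\<phi> y = 2 - (1 / r\<^sup>2) * ((y - x) \<bullet> (y - x))" for y
  have "smooth_on UNIV \<phi>"
    unfolding \<phi>_def
    by (intro smooth_on_diff smooth_on_mult smooth_on_inner smooth_on_const smooth_on_id open_UNIV)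
  then have sm: "smooth_on UNIV (\<lambda>y. h (\<phi> y))" by (rule h(4))
  have \<phi>: "\<phi> y = 2 - (dist x y / r)\<^sup>2" for y
    by (simp add: \<phi>_def power_divide dist_norm norm_minus_commute flip: power2_norm_eq_inner)
  have "\<phi> y \<ge> 1" if "y \<in> ball x r" for y
    using that assms unfolding \<phi> by (simp add: power_le_one)
  moreover have "\<phi> y \<le> 1 / 2" if "y \<notin> cball x (2 * r)" for y
  proof -
    have "2 \<le> dist x y / r" using that assms by (simp add: field_simps)
    then have "2\<^sup>2 \<le> (dist x y / r)\<^sup>2" by (intro power_mono) auto
    then show ?thesis unfolding \<phi> by simp
  qed
  ultimately have "cutoff_between (ball x r) (cball x (2 * r)) (\<lambda>y. h (\<phi> y))"
    unfolding cutoff_between_def using sm h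
    by (intro conjI exI[of _ "ball x r"] exI[of _ "cball x (2 * r)"]) auto
  then show ?thesis by blast
qed

text \<open>By compactness finitely many balls, each with its doubled closed ball inside V, cover K;
  their cutoffs are joined by \<open>cutoff_between_Un\<close>.\<close>

lemma ex_cutoff:
  fixes K V :: "'a::euclidean_space set"
  assumes "compact K" and "open V" and "K \<subseteq> V"
  shows "\<exists>u. cutoff_between K V u"
proof -
  have "\<exists>r>0. cball x (2 * r) \<subseteq> V" if x: "x \<in> K" for x
  proof -
    have "x \<in> V" using x assms(3) by blast
    then obtain e where e: "e > 0" "cball x e \<subseteq> V"
      using assms(2) open_contains_cball_eq by blast
    then show ?thesis by (intro exI[of _ "e / 2"]) auto
  qed
  then obtain r where r: "\<And>x. x \<in> K \<Longrightarrow> r x > 0" "\<And>x. x \<in> K \<Longrightarrow> cball x (2 * r x) \<subseteq> V"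
    by metis
  obtain F where F: "F \<subseteq> K" "finite F" "K \<subseteq> (\<Union>x\<in>F. ball x (r x))"
  proof (rule compactE_image[OF assms(1), of K "\<lambda>x. ball x (r x)"])
    show "K \<subseteq> (\<Union>x\<in>K. ball x (r x))" using r(1) by auto
  qed auto
  have "\<exists>u. cutoff_between (\<Union>x\<in>F. ball x (r x)) V u"
    using F(2,1)
  proof induction
    case empty
    have "cutoff_between {} V (\<lambda>x. 0)"
      unfolding cutoff_between_def
      by (auto intro: smooth_on_const exI[of _ "{}"])
    then show ?case by auto
  next
    case (insert x F)
    then obtain u where "cutoff_between (\<Union>x\<in>F. ball x (r x)) V u" by auto
    moreover obtain u' where "cutoff_between (ball x (r x)) (cball x (2 * r x)) u'"
      using ex_cutoff_ball[of "r x" x] r(1)[of x] insert.prems by auto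
    then have "cutoff_between (ball x (r x)) V u'"
      using r(2)[of x] insert.prems by (auto intro: cutoff_between_subset)
    ultimately show ?case using cutoff_between_Un[of "ball x (r x)" V u'] by auto
  qed
  then show ?thesis using cutoff_between_subset[OF _ F(3)] by blast
qed

section \<open>The variation measure of a bounded functional on test functions\<close>

definition test_functions :: "'a::euclidean_space set \<Rightarrow> ('a \<Rightarrow> 'b::euclidean_space) set" where
  "test_functions U =
     {f. smooth_on UNIV f \<and> (\<exists>K. compact K \<and> K \<subseteq> U \<and> (\<forall>x. x \<notin> K \<longrightarrow> f x = 0))}"

lemma test_functions_lincomb:
  assumes "f \<in> test_functions U" and "g \<in> test_functions U"
  shows "(\<lambda>x. a *\<^sub>R f x + b *\<^sub>R g x) \<in> test_functions U"
proof -
  obtain K K' where "compact K" "K \<subseteq> U" "\<forall>x. x \<notin> K \<longrightarrow> f x = 0"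
    "compact K'" "K' \<subseteq> U" "\<forall>x. x \<notin> K' \<longrightarrow> g x = 0"
    using assms unfolding test_functions_def by blast
  then have "\<exists>K. compact K \<and> K \<subseteq> U \<and> (\<forall>x. x \<notin> K \<longrightarrow> a *\<^sub>R f x + b *\<^sub>R g x = 0)"
    by (intro exI[of _ "K \<union> K'"]) (auto intro: compact_Un)
  then show ?thesis
    using assms smooth_on_lincomb[OF open_UNIV] unfolding test_functions_def by blast
qed

lemma test_functions_zero: "(\<lambda>x. 0) \<in> test_functions U"
  unfolding test_functions_def by (auto intro: smooth_on_const exI[of _ "{}"])

lemma test_functions_mono: "U \<subseteq> V \<Longrightarrow> test_functions U \<subseteq> test_functions V"
  unfolding test_functions_def by blast

lemma test_functions_scaleR:
  assumes "u \<in> test_functions U" and "smooth_on UNIV f"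
  shows "(\<lambda>x. u x *\<^sub>R f x) \<in> test_functions U"
  using assms unfolding test_functions_def by (auto intro: smooth_on_scaleR[OF open_UNIV])

lemma test_functions_linear:
  assumes "bounded_linear h" and "f \<in> test_functions U"
  shows "(\<lambda>x. h (f x)) \<in> test_functions U"
proof -
  have "h 0 = 0" using assms(1) by (rule linear_simps(3))
  then show ?thesis
    using assms unfolding test_functions_def by (auto intro: smooth_on_linear[OF open_UNIV])
qed

lemma smooth_on_imp_continuous_on: "smooth_on S f \<Longrightarrow> continuous_on S f"
  by (meson continuous_at_imp_continuous_on differentiable_imp_continuous_within smooth_on_differentiable)

lemma test_functions_continuous: "f \<in> test_functions U \<Longrightarrow> continuous_on UNIV f"
  unfolding test_functions_def by (auto intro: smooth_on_imp_continuous_on)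

lemma test_functions_bounded:
  assumes "f \<in> test_functions U"
  obtains B where "B > 0" and "\<And>x. norm (f x) \<le> B"
proof -
  obtain K where K: "compact K" "\<forall>x. x \<notin> K \<longrightarrow> f x = 0"
    using assms unfolding test_functions_def by blast
  have "compact (f ` K)"
    using K(1) test_functions_continuous[OF assms] by (meson compact_continuous_image continuous_on_subset subset_UNIV)
  then obtain B where "B > 0" "\<forall>y\<in>f ` K. norm y \<le> B"
    using compact_imp_bounded bounded_pos by metis
  with K(2) show ?thesis by (intro that[of B]) (metis imageI less_imp_le norm_zero)+
qed

lemma cutoff_between_test_functions: "cutoff_between K V u \<Longrightarrow> u \<in> test_functions V"
  unfolding cutoff_between_def test_functions_def by blast

lemma integrable_test_function:
  fixes f :: "'a::euclidean_space \<Rightarrow> 'b::euclidean_space"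
  assumes "finite_measure \<nu>" and [measurable_cong]: "sets \<nu> = sets borel"
    and f: "f \<in> test_functions U"
  shows "integrable \<nu> f"
proof -
  interpret finite_measure \<nu> by fact
  obtain B where "\<And>x. norm (f x) \<le> B" using test_functions_bounded[OF f] by blast
  moreover have [measurable]: "f \<in> borel_measurable borel"
    by (rule borel_measurable_continuous_onI[OF test_functions_continuous[OF f]])
  ultimately show ?thesis by (intro integrable_const_bound[of _ B]) auto
qed

text \<open>Let m be the integer part of t. The summands with i < m are 1, those with i > m are 0,
  and the one with i = m lies between 0 and 1, so the sum and t lie in the same unit
  interval.\<close>

lemma sum_step_approx:
  fixes h :: "real \<Rightarrow> real" and t :: real
  assumes h: "\<forall>s \<le> 1 / 2. h s = 0" "\<forall>s \<ge> 1. h s = 1" "\<forall>s. 0 \<le> h s \<and> h s \<le> 1"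
    and "0 \<le> t" "t \<le> real N"
  shows "\<bar>t - (\<Sum>i<N. h (t - real i))\<bar> \<le> 1"
  using assms(5)
proof (induction N)
  case 0
  then show ?case using assms(4) by simp
next
  case (Suc N)
  show ?case
  proof (cases "t \<le> real N")
    case True
    then show ?thesis using Suc.IH h(1) by simp
  next
    case False
    then have "(\<Sum>i<N. h (t - real i)) = (\<Sum>i<N. 1)"
      using h(2) by (intro sum.cong) auto
    then show ?thesis using False Suc.prems h(3)[rule_format, of "t - real N"] by (simp add: abs_if)
  qed
qed

text \<open>The sum counts the naturals below both t and N. The excess 1 is the rounding error that
  the layer cake estimate has to pay.\<close>

lemma sum_indicator_less:
  fixes t :: real
  assumes "0 \<le> t"
  shows "(\<Sum>i<N. if real i < t then 1 else 0) \<le> t + 1"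
proof (induction N)
  case (Suc N)
  show ?case
  proof (cases "real N < t")
    case True
    have "(\<Sum>i<N. if real i < t then 1 else 0) \<le> (\<Sum>i<N. 1 :: real)" by (rule sum_mono) auto
    then show ?thesis using True by simp
  qed (use Suc in simp)
qed (use assms in simp)

text \<open>The locale serves both the vector valued functional built from the current and the
  scalar positive functionals of \<open>scalar_representation\<close>. The one-sided bound controls
  absolute values as well, because -f is admissible whenever f is.\<close>

locale bounded_test_functional =
  fixes U :: "'a::euclidean_space set" and L :: "('a \<Rightarrow> 'b::euclidean_space) \<Rightarrow> real" and M :: real
  assumes open_U: "open U"
    and linear_L: "f \<in> test_functions U \<Longrightarrow> g \<in> test_functions U \<Longrightarrow>
      L (\<lambda>x. a *\<^sub>R f x + b *\<^sub>R g x) = a * L f + b * L g"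
    and bounded_L: "f \<in> test_functions U \<Longrightarrow> (\<And>x. norm (f x) \<le> 1) \<Longrightarrow> L f \<le> M"
begin

lemma L_zero: "L (\<lambda>x. 0) = 0"
  using linear_L[OF test_functions_zero test_functions_zero, of 0 0] by simp

lemma L_scaleR: "f \<in> test_functions U \<Longrightarrow> L (\<lambda>x. a *\<^sub>R f x) = a * L f"
  using linear_L[of f f a 0] by simp

lemma L_add: "f \<in> test_functions U \<Longrightarrow> g \<in> test_functions U \<Longrightarrow> L (\<lambda>x. f x + g x) = L f + L g"
  using linear_L[of f g 1 1] by simp

lemma L_diff: "f \<in> test_functions U \<Longrightarrow> g \<in> test_functions U \<Longrightarrow> L (\<lambda>x. f x - g x) = L f - L g"
  using linear_L[of f g 1 "-1"] by simp

lemma L_sum: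
  assumes "finite I" and "\<And>i. i \<in> I \<Longrightarrow> f i \<in> test_functions U"
  shows "(\<lambda>x. \<Sum>i\<in>I. f i x) \<in> test_functions U \<and> L (\<lambda>x. \<Sum>i\<in>I. f i x) = (\<Sum>i\<in>I. L (f i))"
  using assms
proof (induction I rule: finite_induct)
  case empty
  then show ?case by (simp add: L_zero test_functions_zero)
next
  case (insert i I)
  then show ?case
    using test_functions_lincomb[of "f i" U "\<lambda>x. \<Sum>i\<in>I. f i x" 1 1] by (simp add: L_add)
qed

lemma L_le:
  assumes f: "f \<in> test_functions U" and "\<And>x. norm (f x) \<le> c" and "c > 0"
  shows "L f \<le> c * M"
proof -
  have g: "(\<lambda>x. (1 / c) *\<^sub>R f x) \<in> test_functions U"
    using test_functions_lincomb[OF f f, of "1 / c" 0] by simp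
  have "L (\<lambda>x. (1 / c) *\<^sub>R f x) \<le> M"
    by (rule bounded_L[OF g]) (use assms in \<open>simp add: field_simps\<close>)
  then show ?thesis using assms L_scaleR[OF f, of "1 / c"] by (simp add: field_simps)
qed

text \<open>Intersecting with U lets V range over all subsets of the ambient space, so the outer
  measure lives on the whole type and charges nothing outside U.\<close>

definition unit_tests :: "'a set \<Rightarrow> ('a \<Rightarrow> 'b) set" where
  "unit_tests V = {f \<in> test_functions (V \<inter> U). \<forall>x. norm (f x) \<le> 1}"

text \<open>For open V this is the total variation |L|(V); it can be a real number because M bounds
  the values of L.\<close>

definition open_variation :: "'a set \<Rightarrow> real" where
  "open_variation V = Sup (L ` unit_tests V)"

definition outer_variation :: "'a set \<Rightarrow> real" where
  "outer_variation A = Inf (open_variation ` {V. open V \<and> A \<subseteq> V})"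

section \<open>Variation of open sets\<close>

lemma unit_tests_U: "f \<in> unit_tests V \<Longrightarrow> f \<in> test_functions U"
  unfolding unit_tests_def using test_functions_mono[of "V \<inter> U" U] by blast

lemma unit_tests_zero: "(\<lambda>x. 0) \<in> unit_tests V"
  by (simp add: unit_tests_def test_functions_zero)

lemma L_unit_tests_le: "f \<in> unit_tests V \<Longrightarrow> L f \<le> M"
  by (rule bounded_L[OF unit_tests_U[of f V]]) (simp_all add: unit_tests_def)

lemma bdd_above_L: "bdd_above (L ` unit_tests V)"
  by (intro bdd_aboveI[of _ M]) (auto intro: L_unit_tests_le)

lemma L_le_open_variation: "f \<in> unit_tests V \<Longrightarrow> L f \<le> open_variation V"
  unfolding open_variation_def by (rule cSup_upper[OF imageI bdd_above_L])

lemma open_variation_leI: "(\<And>f. f \<in> unit_tests V \<Longrightarrow> L f \<le> c) \<Longrightarrow> open_variation V \<le> c"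
  unfolding open_variation_def by (rule cSup_least) (use unit_tests_zero in auto)

lemma open_variation_nonneg: "0 \<le> open_variation V"
  using L_le_open_variation[OF unit_tests_zero] L_zero by simp

lemma open_variation_mono: "V \<subseteq> V' \<Longrightarrow> open_variation V \<le> open_variation V'"
  by (rule open_variation_leI, rule L_le_open_variation)
    (use test_functions_mono[of "V \<inter> U" "V' \<inter> U"] in \<open>auto simp: unit_tests_def\<close>)

lemma open_variation_approx:
  assumes "e > 0"
  obtains f where "f \<in> unit_tests V" and "open_variation V - e < L f"
  using less_cSupD[of "L ` unit_tests V" "open_variation V - e"] assms unit_tests_zero that
  unfolding open_variation_def by auto

text \<open>A test function f on the union is split as u f + (1 - u) f, where the cutoff u is
  supported in V and is 1 near the part of the support of f that lies outside V'.\<close>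

lemma open_variation_Un:
  assumes "open V" and "open V'"
  shows "open_variation (V \<union> V') \<le> open_variation V + open_variation V'"
proof (rule open_variation_leI)
  fix f assume f: "f \<in> unit_tests (V \<union> V')"
  then obtain K where K: "compact K" "K \<subseteq> (V \<union> V') \<inter> U" "\<forall>x. x \<notin> K \<longrightarrow> f x = 0"
    and sm: "smooth_on UNIV f" and le: "\<forall>x. norm (f x) \<le> 1"
    unfolding unit_tests_def test_functions_def by blast
  have "compact (K - V')" "K - V' \<subseteq> V \<inter> U" using K assms by (auto intro: compact_diff)
  then obtain u where u: "cutoff_between (K - V') (V \<inter> U) u"
    using ex_cutoff[of "K - V'" "V \<inter> U"] assms open_U by blast
  then obtain W where W: "open W" "K - V' \<subseteq> W" "\<forall>x\<in>W. u x = 1"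
    and u': "smooth_on UNIV u" "\<And>x. 0 \<le> u x" "\<And>x. u x \<le> 1"
    unfolding cutoff_between_def by blast
  have shrink: "norm (c *\<^sub>R f x) \<le> 1" if "0 \<le> c" "c \<le> 1" for c x
    using that le by (simp add: mult_le_one)
  have 1: "(\<lambda>x. u x *\<^sub>R f x) \<in> unit_tests V"
    unfolding unit_tests_def
    using test_functions_scaleR[OF cutoff_between_test_functions[OF u] sm] shrink u' by blast
  have 2: "(\<lambda>x. (1 - u x) *\<^sub>R f x) \<in> unit_tests V'"
    unfolding unit_tests_def test_functions_def
  proof (intro CollectI conjI allI exI[of _ "K - W"] impI)
    show "smooth_on UNIV (\<lambda>x. (1 - u x) *\<^sub>R f x)"
      by (intro smooth_on_scaleR open_UNIV smooth_on_diff smooth_on_const u' sm)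
    show "compact (K - W)" by (rule compact_diff[OF K(1) W(1)])
    show "K - W \<subseteq> V' \<inter> U" using W K by blast
    show "(1 - u x) *\<^sub>R f x = 0" if "x \<notin> K - W" for x using that K W by auto
    show "norm ((1 - u x) *\<^sub>R f x) \<le> 1" for x using u' by (intro shrink) auto
  qed
  have "L f = L (\<lambda>x. u x *\<^sub>R f x + (1 - u x) *\<^sub>R f x)" by (simp add: algebra_simps)
  also have "\<dots> = L (\<lambda>x. u x *\<^sub>R f x) + L (\<lambda>x. (1 - u x) *\<^sub>R f x)"
    by (intro L_add unit_tests_U[OF 1] unit_tests_U[OF 2])
  also have "\<dots> \<le> open_variation V + open_variation V'"
    by (intro add_mono L_le_open_variation 1 2)
  finally show "L f \<le> open_variation V + open_variation V'" .
qed

lemma open_variation_empty: "open_variation {} = 0"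
proof (rule antisym[OF open_variation_leI open_variation_nonneg])
  fix f assume "f \<in> unit_tests {}"
  then have "f = (\<lambda>x. 0)" by (auto simp: unit_tests_def test_functions_def)
  then show "L f \<le> 0" by (simp add: L_zero)
qed

lemma open_variation_UN_finite:
  assumes "finite I" and "\<And>i. i \<in> I \<Longrightarrow> open (V i)"
  shows "open_variation (\<Union>i\<in>I. V i) \<le> (\<Sum>i\<in>I. open_variation (V i))"
  using assms
proof (induction I rule: finite_induct)
  case (insert i I)
  then have "open (\<Union>i\<in>I. V i)" by (intro open_UN) auto
  then show ?case using open_variation_Un[of "V i" "\<Union>i\<in>I. V i"] insert by fastforce
qed (simp add: open_variation_empty)

text \<open>A test function has compact support, so finitely many of the sets already contain it,
  and finite subadditivity bounds each L f separately. The values are extended because the series on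
  the right may diverge.\<close>

lemma open_variation_UN:
  assumes "\<And>i. open (V i)"
  shows "ennreal (open_variation (\<Union>i::nat. V i)) \<le> (\<Sum>i. ennreal (open_variation (V i)))"
proof -
  have "ennreal (L f) \<le> (\<Sum>i. ennreal (open_variation (V i)))" if f: "f \<in> unit_tests (\<Union>i. V i)" for f
  proof -
    obtain K where K: "compact K" "K \<subseteq> (\<Union>i. V i) \<inter> U" "\<forall>x. x \<notin> K \<longrightarrow> f x = 0"
      using f unfolding unit_tests_def test_functions_def by blast
    obtain I where I: "finite I" "K \<subseteq> (\<Union>i\<in>I. V i)"
      using compactE_image[OF K(1), of UNIV V] K(2) assms by auto
    have "f \<in> unit_tests (\<Union>i\<in>I. V i)"
      using f K I unfolding unit_tests_def test_functions_def by blast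
    then have "L f \<le> (\<Sum>i\<in>I. open_variation (V i))"
      using open_variation_UN_finite[OF I(1), of V] assms by (meson L_le_open_variation order_trans)
    then have "ennreal (L f) \<le> (\<Sum>i\<in>I. ennreal (open_variation (V i)))"
      by (simp add: ennreal_leI open_variation_nonneg sum_ennreal)
    also have "\<dots> \<le> (\<Sum>i. ennreal (open_variation (V i)))"
      by (rule sum_le_suminf) (use I in auto)
    finally show ?thesis .
  qed
  note le = this
  show ?thesis
  proof (cases "(\<Sum>i. ennreal (open_variation (V i))) = \<infinity>")
    case False
    then obtain r where r: "r \<ge> 0" "(\<Sum>i. ennreal (open_variation (V i))) = ennreal r"
      by (cases "\<Sum>i. ennreal (open_variation (V i))") auto
    have "open_variation (\<Union>i. V i) \<le> r"
      by (rule open_variation_leI) (use le r in \<open>auto simp: ennreal_le_iff\<close>)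
    then show ?thesis using r by (simp add: ennreal_leI)
  qed simp
qed

section \<open>Outer variation of arbitrary sets\<close>

lemma bdd_below_outer: "bdd_below (open_variation ` {V. open V \<and> A \<subseteq> V})"
  by (intro bdd_belowI[of _ 0]) (auto intro: open_variation_nonneg)

lemma outer_variation_le: "open V \<Longrightarrow> A \<subseteq> V \<Longrightarrow> outer_variation A \<le> open_variation V"
  unfolding outer_variation_def by (rule cInf_lower[OF _ bdd_below_outer]) blast

lemma outer_variation_geI:
  "(\<And>V. open V \<Longrightarrow> A \<subseteq> V \<Longrightarrow> c \<le> open_variation V) \<Longrightarrow> c \<le> outer_variation A"
  unfolding outer_variation_def by (rule cInf_greatest) (auto intro: exI[of _ UNIV])

lemma outer_variation_open: "open V \<Longrightarrow> outer_variation V = open_variation V"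
  by (rule antisym) (auto intro: outer_variation_le outer_variation_geI open_variation_mono)

lemma outer_variation_nonneg: "0 \<le> outer_variation A"
  by (rule outer_variation_geI) (rule open_variation_nonneg)

lemma outer_variation_mono: "A \<subseteq> B \<Longrightarrow> outer_variation A \<le> outer_variation B"
  by (rule outer_variation_geI, rule outer_variation_le) auto

lemma outer_variation_approx:
  assumes "e > 0"
  obtains V where "open V" and "A \<subseteq> V" and "open_variation V < outer_variation A + e"
proof -
  have "\<exists>y\<in>open_variation ` {V. open V \<and> A \<subseteq> V}. y < outer_variation A + e"
  proof (subst cInf_less_iff[OF _ bdd_below_outer, symmetric])
    show "open_variation ` {V. open V \<and> A \<subseteq> V} \<noteq> {}" by (auto intro: exI[of _ UNIV])
    show "Inf (open_variation ` {V. open V \<and> A \<subseteq> V}) < outer_variation A + e"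
      using assms by (simp add: outer_variation_def)
  qed
  then show ?thesis using that by blast
qed

lemma outer_measure_space_variation:
  "outer_measure_space (Pow UNIV) (\<lambda>A. ennreal (outer_variation A))"
  unfolding outer_measure_space_def
proof (intro conjI)
  show "positive (Pow UNIV) (\<lambda>A. ennreal (outer_variation A))"
    by (simp add: positive_def outer_variation_open open_variation_empty)
  show "increasing (Pow UNIV) (\<lambda>A. ennreal (outer_variation A))"
    by (simp add: increasing_def ennreal_leI outer_variation_mono)
  show "countably_subadditive (Pow UNIV) (\<lambda>A. ennreal (outer_variation A))"
    unfolding countably_subadditive_def
  proof (intro allI impI)
    fix A :: "nat \<Rightarrow> 'a set"
    show "ennreal (outer_variation (\<Union>i. A i)) \<le> (\<Sum>i. ennreal (outer_variation (A i)))"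
    proof (rule ennreal_le_epsilon)
      fix e :: real assume e: "e > 0"
      have "\<exists>V. open V \<and> A i \<subseteq> V \<and> open_variation V < outer_variation (A i) + e * (1 / 2) ^ Suc i" for i
        using e by (meson outer_variation_approx mult_pos_pos zero_less_power half_gt_zero zero_less_one)
      then obtain V where V: "\<And>i. open (V i)" "\<And>i. A i \<subseteq> V i"
        "\<And>i. open_variation (V i) < outer_variation (A i) + e * (1 / 2) ^ Suc i"
        by metis
      have "(\<Union>i. A i) \<subseteq> (\<Union>i. V i)" using V(2) by blast
      then have "outer_variation (\<Union>i. A i) \<le> open_variation (\<Union>i. V i)"
        using V(1) by (intro outer_variation_le) auto
      then have "ennreal (outer_variation (\<Union>i. A i)) \<le> (\<Sum>i. ennreal (open_variation (V i)))"
        using open_variation_UN[OF V(1)] by (meson ennreal_leI order_trans)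
      also have "\<dots> \<le> (\<Sum>i. ennreal (outer_variation (A i)) + ennreal (e * (1 / 2) ^ Suc i))"
      proof (rule suminf_le)
        show "ennreal (open_variation (V i)) \<le> ennreal (outer_variation (A i)) + ennreal (e * (1 / 2) ^ Suc i)" for i
          using V(3)[of i] e outer_variation_nonneg
          by (simp add: ennreal_leI less_imp_le flip: ennreal_plus)
      qed auto
      also have "\<dots> = (\<Sum>i. ennreal (outer_variation (A i))) + (\<Sum>i. ennreal (e * (1 / 2) ^ Suc i))"
        by (rule suminf_add[symmetric]) auto
      also have "(\<Sum>i. ennreal (e * (1 / 2) ^ Suc i)) = ennreal e"
      proof (rule suminf_ennreal_eq)
        show "(\<lambda>i. e * (1 / 2) ^ Suc i) sums e"
          using sums_mult[OF power_half_series, of e] by simp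
      qed (use e in simp)
      finally show "ennreal (outer_variation (\<Union>i. A i)) \<le> (\<Sum>i. ennreal (outer_variation (A i))) + ennreal e" .
    qed
  qed
qed

text \<open>This is Caratheodory's inequality for open G. Take f almost extremal on V \<inter> G,
  vanishing off a compact K, and then g almost extremal on V - K. No point sees both, so f + g still
  has norm at most one and is admissible on V. Removing K instead of G keeps the second set open,
  and V - K contains A - G because K lies in G.\<close>

lemma outer_variation_split:
  assumes "open G"
  shows "outer_variation (G \<inter> A) + outer_variation (A - G) \<le> outer_variation A"
proof (rule outer_variation_geI)
  fix V assume V: "open V" "A \<subseteq> V"
  show "outer_variation (G \<inter> A) + outer_variation (A - G) \<le> open_variation V"
  proof (rule field_le_epsilon)
    fix e :: real assume e: "e > 0"
    obtain f where f: "f \<in> unit_tests (V \<inter> G)" "open_variation (V \<inter> G) - e / 2 < L f"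
      using open_variation_approx[of "e / 2"] e by auto
    then obtain K where K: "compact K" "K \<subseteq> V \<inter> G \<inter> U" "\<forall>x. x \<notin> K \<longrightarrow> f x = 0"
      unfolding unit_tests_def test_functions_def by blast
    obtain g where g: "g \<in> unit_tests (V - K)" "open_variation (V - K) - e / 2 < L g"
      using open_variation_approx[of "e / 2"] e by auto
    have "f \<in> test_functions (V \<inter> U)" "g \<in> test_functions (V \<inter> U)"
      using f(1) g(1) test_functions_mono[of "V \<inter> G \<inter> U" "V \<inter> U"]
        test_functions_mono[of "(V - K) \<inter> U" "V \<inter> U"]
      unfolding unit_tests_def by blast+
    then have "(\<lambda>x. f x + g x) \<in> test_functions (V \<inter> U)"
      using test_functions_lincomb[of f _ g 1 1] by simp
    moreover have "norm (f x + g x) \<le> 1" for x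
    proof (cases "x \<in> K")
      case True
      then have "g x = 0" using g(1) unfolding unit_tests_def test_functions_def by blast
      then show ?thesis using f(1) by (simp add: unit_tests_def)
    next
      case False
      then show ?thesis using K g(1) by (simp add: unit_tests_def)
    qed
    ultimately have "L (\<lambda>x. f x + g x) \<le> open_variation V"
      by (intro L_le_open_variation) (simp add: unit_tests_def)
    then have "L f + L g \<le> open_variation V"
      using L_add[OF unit_tests_U[OF f(1)] unit_tests_U[OF g(1)]] by simp
    moreover have "outer_variation (G \<inter> A) \<le> open_variation (V \<inter> G)"
      using V assms by (intro outer_variation_le) auto
    moreover have "outer_variation (A - G) \<le> open_variation (V - K)"
      using V K by (intro outer_variation_le open_Diff compact_imp_closed) auto
    ultimately show "outer_variation (G \<inter> A) + outer_variation (A - G) \<le> open_variation V + e"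
      using f(2) g(2) by simp
  qed
qed

section \<open>The variation as a finite Borel measure\<close>

definition variation :: "'a measure" where
  "variation = measure_of UNIV (sets borel) (\<lambda>A. ennreal (outer_variation A))"

lemma sets_variation [measurable_cong, simp]: "sets variation = sets borel"
  unfolding variation_def using sets.sigma_sets_eq[of "borel :: 'a measure"] by simp

lemma space_variation [simp]: "space variation = UNIV"
  unfolding variation_def by simp

text \<open>The outer variation is countably additive on the Caratheodory sets; by
  \<open>outer_variation_split\<close> these include the open sets and hence all Borel sets.\<close>

lemma emeasure_variation:
  assumes "B \<in> sets borel"
  shows "emeasure variation B = ennreal (outer_variation B)"
proof -
  interpret P: sigma_algebra UNIV "Pow UNIV :: 'a set set" by (rule sigma_algebra_Pow)
  define \<Lambda> where "\<Lambda> = lambda_system UNIV (Pow UNIV) (\<lambda>A. ennreal (outer_variation A))"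
  have ms: "measure_space UNIV \<Lambda> (\<lambda>A. ennreal (outer_variation A))"
    unfolding \<Lambda>_def by (rule P.caratheodory_lemma[OF outer_measure_space_variation])
  have "G \<in> \<Lambda>" if "open G" for G
    unfolding \<Lambda>_def lambda_system_def
  proof (intro CollectI conjI ballI PowI subset_UNIV)
    fix A
    have "ennreal (outer_variation A) \<le> ennreal (outer_variation (G \<inter> A)) + ennreal (outer_variation ((UNIV - G) \<inter> A))"
    proof -
      have "subadditive (Pow UNIV) (\<lambda>A. ennreal (outer_variation A))"
        using outer_measure_space_variation P.countably_subadditive_subadditive
        unfolding outer_measure_space_def by blast
      from subadditiveD[OF this, of "G \<inter> A" "(UNIV - G) \<inter> A"] show ?thesis
        by (simp add: Int_Un_distrib2[symmetric] Int_assoc Diff_Int_distrib2 Un_commute)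
    qed
    moreover have "ennreal (outer_variation (G \<inter> A)) + ennreal (outer_variation ((UNIV - G) \<inter> A)) \<le> ennreal (outer_variation A)"
      using outer_variation_split[OF that, of A] outer_variation_nonneg
      by (simp add: Diff_eq Int_commute ennreal_leI flip: ennreal_plus)
    ultimately show "ennreal (outer_variation (G \<inter> A)) + ennreal (outer_variation ((UNIV - G) \<inter> A)) = ennreal (outer_variation A)"
      by (rule antisym[rotated])
  qed
  then have "sets borel \<subseteq> \<Lambda>"
    using ms sigma_algebra.sigma_sets_subset[of UNIV \<Lambda> "{S. open S}"]
    by (auto simp: measure_space_def borel_def)
  then have "measure_space UNIV (sets borel) (\<lambda>A. ennreal (outer_variation A))"
    using measure_down[OF ms] sets.sigma_algebra_axioms[of "borel :: 'a measure"] by simp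
  then show ?thesis
    unfolding variation_def measure_space_def
    by (intro emeasure_measure_of_sigma) (use assms in auto)
qed

lemma emeasure_variation_open: "open V \<Longrightarrow> emeasure variation V = ennreal (open_variation V)"
  by (simp add: emeasure_variation outer_variation_open)

sublocale variation: finite_measure variation
  by standard (simp add: emeasure_variation_open)

lemma measure_variation_open: "open V \<Longrightarrow> measure variation V = open_variation V"
  by (simp add: measure_def emeasure_variation_open open_variation_nonneg)

lemma open_variation_U: "open_variation UNIV = open_variation U"
  by (simp add: open_variation_def unit_tests_def)

text \<open>Test functions see only U, so U carries the same finite mass as the whole space and its
  complement is null.\<close>

lemma AE_variation: "AE x in variation. x \<in> U"
proof (rule AE_I')
  have "measure variation (- U) = measure variation UNIV - measure variation U"
    using variation.finite_measure_compl[of U] open_U by (simp add: Compl_eq_Diff_UNIV)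
  then have "measure variation (- U) = 0"
    by (simp add: measure_variation_open open_U open_variation_U)
  then show "- U \<in> null_sets variation"
    using open_U by (auto simp: null_sets_def variation.emeasure_eq_measure)
qed auto

text \<open>
  The layer cake decomposition: with a smooth step \<open>h\<close>, the function \<open>\<phi>\<close> is within \<open>e\<close> of the sum
  of the \<open>e h(\<phi>/e - i)\<close>, each of which is supported in the open set \<open>\<phi> > i e\<close>.
\<close>

lemma L_le_integral:
  assumes \<phi>: "\<phi> \<in> test_functions U" and b: "norm b \<le> 1"
  shows "L (\<lambda>x. \<phi> x *\<^sub>R b) \<le> (\<integral>x. \<bar>\<phi> x\<bar> \<partial>variation)"
proof -
  obtain h :: "real \<Rightarrow> real" where h: "\<forall>s \<le> 1 / 2. h s = 0" "\<forall>s \<ge> 1. h s = 1"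
    "\<forall>s. 0 \<le> h s \<and> h s \<le> 1" "\<And>\<phi>::'a \<Rightarrow> real. smooth_on UNIV \<phi> \<Longrightarrow> smooth_on UNIV (\<lambda>x. h (\<phi> x))"
    using ex_smooth_step[where 'a = 'a] by blast
  obtain B where B: "B > 0" "\<And>x. \<bar>\<phi> x\<bar> \<le> B"
    using test_functions_bounded[OF \<phi>] by auto
  have tb: "(\<lambda>x. \<psi> x *\<^sub>R b) \<in> test_functions V'" if "\<psi> \<in> test_functions V'" for \<psi> :: "'a \<Rightarrow> real" and V'
    using that by (rule test_functions_scaleR) (rule smooth_on_const)
  have layer: "(\<lambda>x. h (\<psi> x / e - i)) \<in> test_functions ({x. i * e < \<psi> x} \<inter> U)"
    if \<psi>: "\<psi> \<in> test_functions U" and e: "e > 0" and i: "i \<ge> 0" for \<psi> :: "'a \<Rightarrow> real" and e i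
    unfolding test_functions_def
  proof (intro CollectI conjI)
    have sm: "smooth_on UNIV \<psi>" using \<psi> by (simp add: test_functions_def)
    then have "smooth_on UNIV (\<lambda>x. (1 / e) * \<psi> x - i)"
      by (intro smooth_on_diff smooth_on_mult smooth_on_const open_UNIV)
    from h(4)[OF this] show "smooth_on UNIV (\<lambda>x. h (\<psi> x / e - i))" by simp
    obtain K where K: "compact K" "K \<subseteq> U" "\<forall>x. x \<notin> K \<longrightarrow> \<psi> x = 0"
      using \<psi> unfolding test_functions_def by blast
    \<comment> \<open>Since \<open>h\<close> vanishes up to 1/2, the layer is supported in this
      closed set, whose trace on K is a compact subset of the open set
      \<open>{x. i * e < \<psi> x}\<close>. A step rising already at 0 would leave no such
      margin.\<close>
    have "closed {x. (i + 1 / 2) * e \<le> \<psi> x}"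
      using smooth_on_imp_continuous_on[OF sm] by (intro closed_Collect_le continuous_intros)
    then have "compact (K \<inter> {x. (i + 1 / 2) * e \<le> \<psi> x})" by (rule compact_Int_closed[OF K(1)])
    moreover have "K \<inter> {x. (i + 1 / 2) * e \<le> \<psi> x} \<subseteq> {x. i * e < \<psi> x} \<inter> U"
      using e K(2) by (auto simp: algebra_simps)
    moreover have "h (\<psi> x / e - i) = 0" if "x \<notin> K \<inter> {x. (i + 1 / 2) * e \<le> \<psi> x}" for x
    proof -
      have "\<psi> x < (i + 1 / 2) * e"
      proof (cases "x \<in> K")
        case False
        then show ?thesis using K(3) e i by simp
      qed (use that in auto)
      then have "\<psi> x / e - i \<le> 1 / 2" using e by (simp add: field_simps)
      then show ?thesis using h(1) by blast
    qed
    ultimately show "\<exists>K. compact K \<and> K \<subseteq> {x. i * e < \<psi> x} \<inter> U \<and> (\<forall>x. x \<notin> K \<longrightarrow> h (\<psi> x / e - i) = 0)"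
      by blast
  qed
  have layer_le: "L (\<lambda>x. h (\<psi> x / e - i) *\<^sub>R c) \<le> measure variation {x. i * e < \<psi> x}"
    if "\<psi> \<in> test_functions U" "e > 0" "i \<ge> 0" "norm c \<le> 1" for \<psi> :: "'a \<Rightarrow> real" and e i c
  proof -
    have "open {x. i * e < \<psi> x}"
      using test_functions_continuous[OF that(1)] by (intro open_Collect_less continuous_intros)
    moreover have "(\<lambda>x. h (\<psi> x / e - i) *\<^sub>R c) \<in> unit_tests {x. i * e < \<psi> x}"
      unfolding unit_tests_def
      using test_functions_scaleR[OF layer[OF that(1-3)] smooth_on_const[of _ c]] h(3) that(4)
      by (auto intro!: mult_le_one)
    ultimately show ?thesis by (simp add: measure_variation_open L_le_open_variation)
  qed
  have tU: "f \<in> test_functions U" if "f \<in> test_functions (V \<inter> U)" for f :: "'a \<Rightarrow> real" and V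
    using that test_functions_mono[of "V \<inter> U" U] by blast
  have m\<phi>: "(\<lambda>x. - \<phi> x) \<in> test_functions U"
    using test_functions_lincomb[OF \<phi> \<phi>, of "-1" 0] by simp
  \<comment> \<open>Two errors are collected: e times the total mass from the rounding in
    \<open>sum_indicator_less\<close>, and e times M from replacing \<phi> by a sum of layers that
    differs from it by at most e.\<close>
  have key: "L (\<lambda>x. \<phi> x *\<^sub>R b) \<le> (\<integral>x. \<bar>\<phi> x\<bar> \<partial>variation) + e * (measure variation UNIV + M)"
    if e: "e > 0" for e
  proof -
    \<comment> \<open>N layers of height e reach the bound B of |\<phi>|.\<close>
    obtain N where N: "B / e \<le> real N" using real_arch_simple by blast
    have [measurable]: "\<phi> \<in> borel_measurable borel"
      by (rule borel_measurable_continuous_onI[OF test_functions_continuous[OF \<phi>]])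
    \<comment> \<open>\<open>f\<close> and \<open>g\<close> slice the positive and the negative part
      of \<phi>. At each point one of the two families vanishes, so the nonsmooth parts never have
      to be formed.\<close>
    define f where "f i = (\<lambda>x. h (\<phi> x / e - real i))" for i
    define g where "g i = (\<lambda>x. h (- \<phi> x / e - real i))" for i
    define \<psi> where "\<psi> x = (\<Sum>i<N. e * (f i x - g i x))" for x
    have fg: "f i \<in> test_functions U" "g i \<in> test_functions U" for i
      using tU[OF layer[OF \<phi> e, of "real i"]] tU[OF layer[OF m\<phi> e, of "real i"]] by (simp_all add: f_def g_def)
    have fgb: "(\<lambda>x. e *\<^sub>R (f i x *\<^sub>R b) + (- e) *\<^sub>R (g i x *\<^sub>R b)) \<in> test_functions U" for i
      by (intro test_functions_lincomb tb fg)
    have \<psi>_eq: "(\<lambda>x. \<psi> x *\<^sub>R b) = (\<lambda>x. \<Sum>i<N. e *\<^sub>R (f i x *\<^sub>R b) + (- e) *\<^sub>R (g i x *\<^sub>R b))"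
      by (simp add: \<psi>_def scaleR_sum_left algebra_simps)
    have \<psi>: "(\<lambda>x. \<psi> x *\<^sub>R b) \<in> test_functions U"
      and L\<psi>: "L (\<lambda>x. \<psi> x *\<^sub>R b) = (\<Sum>i<N. L (\<lambda>x. e *\<^sub>R (f i x *\<^sub>R b) + (- e) *\<^sub>R (g i x *\<^sub>R b)))"
      unfolding \<psi>_eq
      using L_sum[of "{..<N}" "\<lambda>i x. e *\<^sub>R (f i x *\<^sub>R b) + (- e) *\<^sub>R (g i x *\<^sub>R b)"] fgb by blast+
    have approx: "\<bar>\<phi> x - \<psi> x\<bar> \<le> e" for x
    proof -
      have "\<bar>\<phi> x / e - (\<Sum>i<N. f i x - g i x)\<bar> \<le> 1"
      proof (cases "\<phi> x \<ge> 0")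
        case True
        then have "- \<phi> x / e \<le> 0" using e by simp
        then have "- \<phi> x / e - real i \<le> 1 / 2" for i using of_nat_0_le_iff[of i] by linarith
        then have "g i x = 0" for i unfolding g_def using h(1) by blast
        moreover have "\<phi> x / e \<le> real N"
          using N B(2)[of x] e by (meson abs_le_D1 divide_right_mono less_imp_le order_trans)
        ultimately show ?thesis
          using sum_step_approx[OF h(1-3), of "\<phi> x / e" N] True e by (simp add: f_def)
      next
        case False
        then have "\<phi> x / e \<le> 0" using e False by (intro divide_nonpos_pos) auto
        then have "\<phi> x / e - real i \<le> 1 / 2" for i using of_nat_0_le_iff[of i] by linarith
        then have "f i x = 0" for i unfolding f_def using h(1) by blast
        moreover have "- \<phi> x / e \<le> real N"
          using N B(2)[of x] e by (meson abs_le_D2 divide_right_mono less_imp_le order_trans)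
        moreover have "0 \<le> - \<phi> x / e" using False e by (simp add: divide_le_0_iff)
        ultimately have "\<bar>- \<phi> x / e - (\<Sum>i<N. g i x)\<bar> \<le> 1"
          unfolding g_def by (intro sum_step_approx[OF h(1-3)])
        moreover have "(\<Sum>i<N. f i x - g i x) = - (\<Sum>i<N. g i x)"
          using \<open>\<And>i. f i x = 0\<close> by (simp add: sum_negf)
        ultimately show ?thesis by linarith
      qed
      then have "e * \<bar>\<phi> x / e - (\<Sum>i<N. f i x - g i x)\<bar> \<le> e * 1"
        using e by (intro mult_left_mono) auto
      also have "e * \<bar>\<phi> x / e - (\<Sum>i<N. f i x - g i x)\<bar> = \<bar>\<phi> x - \<psi> x\<bar>"
      proof -
        have "\<psi> x = e * (\<Sum>i<N. f i x - g i x)" by (simp only: \<psi>_def sum_distrib_left)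
        then have "\<phi> x - \<psi> x = e * (\<phi> x / e - (\<Sum>i<N. f i x - g i x))"
          using e by (simp add: right_diff_distrib)
        then show ?thesis using e by (simp only: abs_mult abs_of_pos)
      qed
      finally show ?thesis by simp
    qed
    have "L (\<lambda>x. e *\<^sub>R (f i x *\<^sub>R b) + (- e) *\<^sub>R (g i x *\<^sub>R b))
        \<le> e * (measure variation {x. real i * e < \<phi> x} + measure variation {x. real i * e < - \<phi> x})" for i
    proof -
      have "L (\<lambda>x. g i x *\<^sub>R (- b)) = - L (\<lambda>x. g i x *\<^sub>R b)"
        using L_scaleR[OF tb[OF fg(2)[of i]], of "-1"] by simp
      then have "- L (\<lambda>x. g i x *\<^sub>R b) \<le> measure variation {x. real i * e < - \<phi> x}"
        using layer_le[OF m\<phi> e, of "real i" "- b"] b by (simp add: g_def)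
      moreover have "L (\<lambda>x. f i x *\<^sub>R b) \<le> measure variation {x. real i * e < \<phi> x}"
        using layer_le[OF \<phi> e, of "real i" b] b by (simp add: f_def)
      moreover have "L (\<lambda>x. e *\<^sub>R (f i x *\<^sub>R b) + (- e) *\<^sub>R (g i x *\<^sub>R b))
          = e * (L (\<lambda>x. f i x *\<^sub>R b) + - L (\<lambda>x. g i x *\<^sub>R b))"
        using linear_L[OF tb[OF fg(1)] tb[OF fg(2)], of e i "- e" i] by (simp add: algebra_simps)
      ultimately show ?thesis using e by (simp only: mult_le_cancel_left_pos add_mono)
    qed
    then have "L (\<lambda>x. \<psi> x *\<^sub>R b) \<le> (\<Sum>i<N. e * (measure variation {x. real i * e < \<phi> x} + measure variation {x. real i * e < - \<phi> x}))"
      unfolding L\<psi> by (rule sum_mono)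
    also have "\<dots> = (\<integral>x. (\<Sum>i<N. e * (indicator {x. real i * e < \<phi> x} x + indicator {x. real i * e < - \<phi> x} x)) \<partial>variation)"
      by (subst Bochner_Integration.integral_sum)
        (auto simp: variation.emeasure_eq_measure intro!: sum.cong integrable_real_indicator
          Bochner_Integration.integrable_add Bochner_Integration.integrable_mult_right)
    also have "\<dots> \<le> (\<integral>x. \<bar>\<phi> x\<bar> + e \<partial>variation)"
    proof (rule integral_mono)
      fix x
      have "(\<Sum>i<N. indicator {x. real i * e < \<phi> x} x + indicator {x. real i * e < - \<phi> x} x)
          = (\<Sum>i<N. if real i < \<bar>\<phi> x\<bar> / e then 1 else 0 :: real)"
      proof (intro sum.cong refl)
        fix i
        \<comment> \<open>The threshold is nonnegative, so \<phi> and -\<phi> cannot both exceed it,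
          and the two indicators add up to the one for |\<phi>|.\<close>
        have c: "0 \<le> e * real i" using e by simp
        show "indicator {x. real i * e < \<phi> x} x + indicator {x. real i * e < - \<phi> x} x
            = (if real i < \<bar>\<phi> x\<bar> / e then 1 else 0 :: real)"
          using e by (auto simp: indicator_def field_simps abs_if) (use c in linarith)+
      qed
      also have "\<dots> \<le> \<bar>\<phi> x\<bar> / e + 1" using e by (intro sum_indicator_less) auto
      finally have "e * (\<Sum>i<N. indicator {x. real i * e < \<phi> x} x + indicator {x. real i * e < - \<phi> x} x)
          \<le> e * (\<bar>\<phi> x\<bar> / e + 1)"
        using e by (simp only: mult_left_mono less_imp_le)
      also have "\<dots> = \<bar>\<phi> x\<bar> + e" using e by (simp add: distrib_left)
      finally show "(\<Sum>i<N. e * (indicator {x. real i * e < \<phi> x} x + indicator {x. real i * e < - \<phi> x} x)) \<le> \<bar>\<phi> x\<bar> + e"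
        by (simp only: sum_distrib_left)
    next
      show "integrable variation (\<lambda>x. \<bar>\<phi> x\<bar> + e)"
        using integrable_test_function[OF variation.finite_measure_axioms _ \<phi>] by auto
    qed (auto simp: variation.emeasure_eq_measure intro!: integrable_real_indicator
          Bochner_Integration.integrable_add Bochner_Integration.integrable_mult_right Bochner_Integration.integrable_sum)
    also have "\<dots> = (\<integral>x. \<bar>\<phi> x\<bar> \<partial>variation) + e * measure variation UNIV"
      using integrable_test_function[OF variation.finite_measure_axioms _ \<phi>]
      by (subst Bochner_Integration.integral_add) auto
    finally have 1: "L (\<lambda>x. \<psi> x *\<^sub>R b) \<le> (\<integral>x. \<bar>\<phi> x\<bar> \<partial>variation) + e * measure variation UNIV" .
    have d: "(\<lambda>x. \<phi> x *\<^sub>R b - \<psi> x *\<^sub>R b) \<in> test_functions U"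
      using test_functions_lincomb[OF tb[OF \<phi>] \<psi>, of 1 "-1"] by simp
    have 2: "L (\<lambda>x. \<phi> x *\<^sub>R b - \<psi> x *\<^sub>R b) \<le> e * M"
    proof (rule L_le[OF d _ e])
      fix x
      have "norm (\<phi> x *\<^sub>R b - \<psi> x *\<^sub>R b) = \<bar>\<phi> x - \<psi> x\<bar> * norm b"
        by (simp flip: scaleR_left_diff_distrib)
      also have "\<dots> \<le> e * 1" using approx b e by (intro mult_mono) auto
      finally show "norm (\<phi> x *\<^sub>R b - \<psi> x *\<^sub>R b) \<le> e" by simp
    qed
    show ?thesis using 1 2 L_diff[OF tb[OF \<phi>] \<psi>] by (simp add: algebra_simps)
  qed
  show ?thesis
  proof (rule field_le_epsilon)
    fix d :: real assume d: "d > 0"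
    have C: "0 \<le> measure variation UNIV + M"
      using L_unit_tests_le[OF unit_tests_zero] by (simp add: L_zero)
    \<comment> \<open>The summand 1 keeps the denominator positive when the mass and M both
      vanish.\<close>
    define e where "e = d / (measure variation UNIV + M + 1)"
    have "e > 0" using d C by (simp add: e_def)
    moreover have "e * (measure variation UNIV + M) \<le> d"
      using d C by (simp add: e_def field_simps)
    ultimately show "L (\<lambda>x. \<phi> x *\<^sub>R b) \<le> (\<integral>x. \<bar>\<phi> x\<bar> \<partial>variation) + d"
      using key[of e] by linarith
  qed
qed

end

section \<open>Representation of bounded functionals\<close>

text \<open>\<open>L_le_integral\<close> only bounds from above; the reverse estimate comes from
  applying it to u - f, where the cutoff u dominates f and an almost extremal g. Positivity gives
  \<Lambda> u \<ge> \<Lambda> g, so \<Lambda> u falls short of the total mass, and hence of the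
  integral of u, by at most e.\<close>

lemma positive_test_functional_integral_le:
  fixes \<Lambda> :: "('a::euclidean_space \<Rightarrow> real) \<Rightarrow> real"
  assumes "bounded_test_functional U \<Lambda> M"
    and pos: "\<And>f. f \<in> test_functions U \<Longrightarrow> (\<And>x. 0 \<le> f x) \<Longrightarrow> 0 \<le> \<Lambda> f"
    and f: "f \<in> test_functions U" and f_le: "\<And>x. \<bar>f x\<bar> \<le> 1"
  shows "(\<integral>x. f x \<partial>bounded_test_functional.variation U \<Lambda>) \<le> \<Lambda> f"
proof (rule field_le_epsilon)
  fix e :: real assume e: "e > 0"
  interpret bounded_test_functional U \<Lambda> M by fact
  obtain g where g: "g \<in> unit_tests UNIV" "open_variation UNIV - e < \<Lambda> g"
    using open_variation_approx[OF e] by blast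
  then have gU: "g \<in> test_functions U" and g_le: "\<bar>g x\<bar> \<le> 1" for x
    by (auto simp: unit_tests_def)
  obtain K where K: "compact K" "K \<subseteq> U" "\<forall>x. x \<notin> K \<longrightarrow> g x = 0"
    using gU unfolding test_functions_def by blast
  obtain K' where K': "compact K'" "K' \<subseteq> U" "\<forall>x. x \<notin> K' \<longrightarrow> f x = 0"
    using f unfolding test_functions_def by blast
  obtain u where u: "cutoff_between (K \<union> K') U u"
    using ex_cutoff[of "K \<union> K'" U] K K' open_U by (auto simp: compact_Un)
  have uU: "u \<in> test_functions U" by (rule cutoff_between_test_functions[OF u])
  have u01: "0 \<le> u x" "u x \<le> 1" and u1: "x \<in> K \<union> K' \<Longrightarrow> u x = 1" for x
    using u unfolding cutoff_between_def by auto
  have ge: "g x \<le> u x" "f x \<le> u x" for x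
    using u1[of x] u01[of x] g_le[of x] f_le[of x] K(3) K'(3) by (cases "x \<in> K"; cases "x \<in> K'"; simp)+
  have diff: "(\<lambda>x. u x - h x) \<in> test_functions U" if "h \<in> test_functions U" for h
    using test_functions_lincomb[OF uU that, of 1 "-1"] by simp
  have "0 \<le> \<Lambda> (\<lambda>x. u x - g x)" by (rule pos[OF diff[OF gU]]) (simp add: ge)
  then have "\<Lambda> g \<le> \<Lambda> u" using L_diff[OF uU gU] by simp
  moreover have "\<Lambda> u - \<Lambda> f \<le> (\<integral>x. u x \<partial>variation) - (\<integral>x. f x \<partial>variation)"
  proof -
    have "\<Lambda> u - \<Lambda> f = \<Lambda> (\<lambda>x. (u x - f x) *\<^sub>R 1)" using L_diff[OF uU f] by simp
    also have "\<dots> \<le> (\<integral>x. \<bar>u x - f x\<bar> \<partial>variation)" by (rule L_le_integral[OF diff[OF f]]) simp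
    also have "\<dots> = (\<integral>x. u x - f x \<partial>variation)" using ge by simp
    also have "\<dots> = (\<integral>x. u x \<partial>variation) - (\<integral>x. f x \<partial>variation)"
      using integrable_test_function[OF variation.finite_measure_axioms sets_variation] uU f
      by (intro Bochner_Integration.integral_diff)
    finally show ?thesis .
  qed
  moreover have "(\<integral>x. u x \<partial>variation) \<le> (\<integral>x. 1 \<partial>variation)"
    using integrable_test_function[OF variation.finite_measure_axioms sets_variation uU] u01
    by (intro integral_mono) auto
  then have "(\<integral>x. u x \<partial>variation) \<le> open_variation UNIV" by (simp add: measure_variation_open)
  ultimately show "(\<integral>x. f x \<partial>variation) \<le> \<Lambda> f + e" using g(2) by linarith
qed

text \<open>The one-sided estimate is applied to f / B and to -f / B, with B a bound for
  |f|.\<close>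

lemma positive_test_functional_integral:
  fixes \<Lambda> :: "('a::euclidean_space \<Rightarrow> real) \<Rightarrow> real"
  assumes \<Lambda>: "bounded_test_functional U \<Lambda> M"
    and pos: "\<And>f. f \<in> test_functions U \<Longrightarrow> (\<And>x. 0 \<le> f x) \<Longrightarrow> 0 \<le> \<Lambda> f"
    and f: "f \<in> test_functions U"
  shows "\<Lambda> f = (\<integral>x. f x \<partial>bounded_test_functional.variation U \<Lambda>)"
proof -
  interpret bounded_test_functional U \<Lambda> M by fact
  obtain B where B: "B > 0" "\<And>x. \<bar>f x\<bar> \<le> B" using test_functions_bounded[OF f] by auto
  have "c * (\<integral>x. f x \<partial>variation) \<le> c * \<Lambda> f" if "\<bar>c\<bar> = 1 / B" for c
  proof -
    have A: "(\<lambda>x. c *\<^sub>R f x) \<in> test_functions U" using test_functions_lincomb[OF f f, of c 0] by simp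
    have B: "\<bar>c *\<^sub>R f x\<bar> \<le> 1" for x using B that by (simp add: abs_mult)
    have "(\<integral>x. c *\<^sub>R f x \<partial>variation) \<le> \<Lambda> (\<lambda>x. c *\<^sub>R f x)"
      by (rule positive_test_functional_integral_le[OF \<Lambda> _ A B]) (rule pos)
    then show ?thesis using L_scaleR[OF f, of c] by simp
  qed
  from this[of "1 / B"] this[of "- (1 / B)"] B(1) show ?thesis by simp
qed

section \<open>Densities with respect to the variation\<close>

context bounded_test_functional
begin

lemma scalar_representation:
  assumes b: "norm b \<le> 1"
  obtains g where "integrable variation g"
    and "\<And>\<phi>. \<phi> \<in> test_functions U \<Longrightarrow> L (\<lambda>x. \<phi> x *\<^sub>R b) = (\<integral>x. \<phi> x * g x \<partial>variation)"
proof -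
  define \<Lambda> where "\<Lambda> \<phi> = L (\<lambda>x. \<phi> x *\<^sub>R b) + (\<integral>x. \<phi> x \<partial>variation)" for \<phi>
  have tb: "(\<lambda>x. \<phi> x *\<^sub>R c) \<in> test_functions V" if "\<phi> \<in> test_functions V" for \<phi> :: "'a \<Rightarrow> real" and c :: 'b and V
    by (rule test_functions_scaleR[OF that smooth_on_const])
  have int: "integrable variation \<phi>" if "\<phi> \<in> test_functions U" for \<phi> :: "'a \<Rightarrow> real"
    by (rule integrable_test_function[OF variation.finite_measure_axioms sets_variation that])
  have "bounded_test_functional U \<Lambda> (M + measure variation UNIV)"
  proof
    fix \<phi> \<psi> :: "'a \<Rightarrow> real" and s t :: real
    assume \<phi>: "\<phi> \<in> test_functions U" and \<psi>: "\<psi> \<in> test_functions U"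
    have "L (\<lambda>x. (s *\<^sub>R \<phi> x + t *\<^sub>R \<psi> x) *\<^sub>R b) = s * L (\<lambda>x. \<phi> x *\<^sub>R b) + t * L (\<lambda>x. \<psi> x *\<^sub>R b)"
      using linear_L[OF tb[OF \<phi>] tb[OF \<psi>], of s b t b] by (simp add: scaleR_add_left)
    then show "\<Lambda> (\<lambda>x. s *\<^sub>R \<phi> x + t *\<^sub>R \<psi> x) = s * \<Lambda> \<phi> + t * \<Lambda> \<psi>"
      using int[OF \<phi>] int[OF \<psi>] by (simp add: \<Lambda>_def algebra_simps)
  next
    fix \<phi> :: "'a \<Rightarrow> real" assume \<phi>: "\<phi> \<in> test_functions U" and le: "\<And>x. norm (\<phi> x) \<le> 1"
    have "L (\<lambda>x. \<phi> x *\<^sub>R b) \<le> M"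
      by (rule bounded_L[OF tb[OF \<phi>]]) (use le b in \<open>simp add: mult_le_one\<close>)
    moreover have "(\<integral>x. \<phi> x \<partial>variation) \<le> (\<integral>x. 1 \<partial>variation)"
      by (rule integral_mono) (use int[OF \<phi>] le in \<open>auto simp: abs_le_iff\<close>)
    ultimately show "\<Lambda> \<phi> \<le> M + measure variation UNIV" by (simp add: \<Lambda>_def)
  qed (rule open_U)
  then interpret \<Lambda>: bounded_test_functional U \<Lambda> "M + measure variation UNIV" .
  \<comment> \<open>Applying \<open>L_le_integral\<close> to -b shows that L in the direction b is
    never below minus the integral of a nonnegative \<phi>.\<close>
  have pos: "0 \<le> \<Lambda> \<phi>" if \<phi>: "\<phi> \<in> test_functions U" and nonneg: "\<And>x. 0 \<le> \<phi> x" for \<phi>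
  proof -
    have "- L (\<lambda>x. \<phi> x *\<^sub>R b) = L (\<lambda>x. \<phi> x *\<^sub>R (- b))"
      using L_scaleR[OF tb[OF \<phi>, of b], of "-1"] by simp
    also have "\<dots> \<le> (\<integral>x. \<bar>\<phi> x\<bar> \<partial>variation)" by (rule L_le_integral[OF \<phi>]) (use b in simp)
    finally show ?thesis using nonneg by (simp add: \<Lambda>_def)
  qed
  \<comment> \<open>One copy of the variation bounds the part coming from L, the other the integral
    that was added. The comparison passes from open sets to outer measures and yields absolute
    continuity.\<close>
  have open_le: "\<Lambda>.open_variation V \<le> 2 * open_variation V" if V: "open V" for V
  proof (rule \<Lambda>.open_variation_leI)
    fix \<phi> assume \<phi>: "\<phi> \<in> \<Lambda>.unit_tests V"
    have "(\<lambda>x. \<phi> x *\<^sub>R b) \<in> unit_tests V"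
      using \<phi> b tb[of \<phi> "V \<inter> U"] by (auto simp: \<Lambda>.unit_tests_def unit_tests_def mult_le_one)
    then have "L (\<lambda>x. \<phi> x *\<^sub>R b) \<le> open_variation V" by (rule L_le_open_variation)
    moreover have "(\<integral>x. \<phi> x \<partial>variation) \<le> (\<integral>x. indicator V x \<partial>variation)"
    proof (rule integral_mono)
      show "integrable variation \<phi>" by (rule int[OF \<Lambda>.unit_tests_U[OF \<phi>]])
      show "\<phi> x \<le> indicator V x" for x
        using \<phi> by (auto simp: \<Lambda>.unit_tests_def test_functions_def abs_le_iff indicator_def)
    qed (use V in \<open>auto simp: variation.emeasure_eq_measure intro!: integrable_real_indicator\<close>)
    then have "(\<integral>x. \<phi> x \<partial>variation) \<le> open_variation V"
      using V by (simp add: measure_variation_open)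
    ultimately show "\<Lambda> \<phi> \<le> 2 * open_variation V" by (simp add: \<Lambda>_def)
  qed
  have outer_le: "\<Lambda>.outer_variation B / 2 \<le> outer_variation B" for B
  proof (rule outer_variation_geI)
    fix V assume "open V" "B \<subseteq> V"
    then show "\<Lambda>.outer_variation B / 2 \<le> open_variation V"
      using \<Lambda>.outer_variation_le[of V B] open_le[of V] by simp
  qed
  have ac: "absolutely_continuous variation \<Lambda>.variation"
    unfolding absolutely_continuous_def
  proof
    fix B assume "B \<in> null_sets variation"
    then have B: "B \<in> sets borel" "outer_variation B \<le> 0"
      by (auto simp: null_sets_def emeasure_variation ennreal_eq_0_iff)
    then show "B \<in> null_sets \<Lambda>.variation"
      using outer_le[of B] by (auto simp: null_sets_def \<Lambda>.emeasure_variation ennreal_eq_0_iff)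
  qed
  obtain D where D: "D \<in> borel_measurable variation"
    "AE x in variation. RN_deriv variation \<Lambda>.variation x = ennreal (D x)" "\<And>x. 0 \<le> D x"
    using variation.real_RN_deriv[OF \<Lambda>.variation.finite_measure_axioms ac] by auto
  have "\<Lambda>.variation = density variation (RN_deriv variation \<Lambda>.variation)"
    using variation.density_RN_deriv[OF ac] by simp
  also have "\<dots> = density variation (\<lambda>x. ennreal (D x))"
    by (rule density_cong) (use D in auto)
  finally have dens: "\<Lambda>.variation = density variation (\<lambda>x. ennreal (D x))" .
  have D_int: "integrable variation D"
  proof (rule integrableI_nonneg)
    have "(\<integral>\<^sup>+x. ennreal (D x) \<partial>variation) = emeasure \<Lambda>.variation UNIV"
      unfolding dens using D(1) by (subst emeasure_density) (auto simp: space_variation)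
    then show "(\<integral>\<^sup>+x. ennreal (D x) \<partial>variation) < \<infinity>"
      by (simp add: \<Lambda>.variation.emeasure_eq_measure)
  qed (use D in auto)
  show ?thesis
  \<comment> \<open>The 1 is the density of the measure that was added.\<close>
  proof (rule that[of "\<lambda>x. D x - 1"])
    show "integrable variation (\<lambda>x. D x - 1)" using D_int by simp
    fix \<phi> :: "'a \<Rightarrow> real" assume \<phi>: "\<phi> \<in> test_functions U"
    have [measurable]: "\<phi> \<in> borel_measurable borel"
      by (rule borel_measurable_continuous_onI[OF test_functions_continuous[OF \<phi>]])
    obtain B where B: "\<And>x. \<bar>\<phi> x\<bar> \<le> B" using test_functions_bounded[OF \<phi>] by auto
    have "integrable variation (\<lambda>x. D x * \<phi> x)"
    proof (rule Bochner_Integration.integrable_bound)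
      show "integrable variation (\<lambda>x. B * D x)" using D_int by simp
      show "AE x in variation. norm (D x * \<phi> x) \<le> norm (B * D x)"
        using B D(3) by (intro AE_I2) (simp add: abs_mult mult.commute mult_left_mono order_trans[OF B abs_ge_self])
    qed (use D(1) in measurable)
    moreover have "\<Lambda> \<phi> = (\<integral>x. \<phi> x \<partial>\<Lambda>.variation)"
      by (rule positive_test_functional_integral[OF \<Lambda>.bounded_test_functional_axioms _ \<phi>]) (rule pos)
    moreover have "(\<integral>x. \<phi> x \<partial>\<Lambda>.variation) = (\<integral>x. D x * \<phi> x \<partial>variation)"
      unfolding dens by (subst integral_density) (use D in auto)
    ultimately show "L (\<lambda>x. \<phi> x *\<^sub>R b) = (\<integral>x. \<phi> x * (D x - 1) \<partial>variation)"
      using int[OF \<phi>] by (simp add: \<Lambda>_def algebra_simps)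
  qed
qed

text \<open>The scalar densities in the coordinate directions are assembled into v. No bound on the
  norm of v is claimed here; normalisation is done later, with the dual norm.\<close>

theorem representation:
  obtains v where "integrable variation v"
    and "\<And>f. f \<in> test_functions U \<Longrightarrow> L f = (\<integral>x. f x \<bullet> v x \<partial>variation)"
proof -
  have "\<exists>g. integrable variation g \<and>
      (\<forall>\<phi>\<in>test_functions U. L (\<lambda>x. \<phi> x *\<^sub>R b) = (\<integral>x. \<phi> x * g x \<partial>variation))" if "b \<in> Basis" for b :: 'b
    using scalar_representation[of b] norm_Basis[OF that] by (metis order_refl)
  then obtain g where g: "\<And>b. b \<in> Basis \<Longrightarrow> integrable variation (g b)"
    "\<And>b \<phi>. b \<in> Basis \<Longrightarrow> \<phi> \<in> test_functions U \<Longrightarrow> L (\<lambda>x. \<phi> x *\<^sub>R b) = (\<integral>x. \<phi> x * g b x \<partial>variation)"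
    by metis
  show ?thesis
  proof (rule that[of "\<lambda>x. \<Sum>b\<in>Basis. g b x *\<^sub>R b"])
    show "integrable variation (\<lambda>x. \<Sum>b\<in>Basis. g b x *\<^sub>R b)" using g(1) by auto
    fix f :: "'a \<Rightarrow> 'b" assume f: "f \<in> test_functions U"
    have fb: "(\<lambda>x. f x \<bullet> b) \<in> test_functions U" for b
      by (rule test_functions_linear[OF bounded_linear_inner_left f])
    have fb': "(\<lambda>x. (f x \<bullet> b) *\<^sub>R b) \<in> test_functions U" for b
      by (rule test_functions_scaleR[OF fb smooth_on_const])
    have int: "integrable variation (\<lambda>x. (f x \<bullet> b) * g b x)" if "b \<in> Basis" for b
    proof -
      have [measurable]: "(\<lambda>x. f x \<bullet> b) \<in> borel_measurable borel"
        by (rule borel_measurable_continuous_onI[OF test_functions_continuous[OF fb]])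
      obtain B where B: "\<And>x. \<bar>f x \<bullet> b\<bar> \<le> B" using test_functions_bounded[OF fb[of b]] by auto
      show ?thesis
      proof (rule Bochner_Integration.integrable_bound)
        show "integrable variation (\<lambda>x. B * g b x)" using g(1)[OF that] by simp
        show "AE x in variation. norm ((f x \<bullet> b) * g b x) \<le> norm (B * g b x)"
          by (intro AE_I2) (simp add: abs_mult mult_right_mono order_trans[OF B abs_ge_self])
      qed (use g(1)[OF that] in measurable)
    qed
    have "L f = L (\<lambda>x. \<Sum>b\<in>Basis. (f x \<bullet> b) *\<^sub>R b)" by (simp add: euclidean_representation)
    also have "\<dots> = (\<Sum>b\<in>Basis. L (\<lambda>x. (f x \<bullet> b) *\<^sub>R b))"
      using L_sum[of Basis "\<lambda>b x. (f x \<bullet> b) *\<^sub>R b"] fb' by auto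
    also have "\<dots> = (\<Sum>b\<in>Basis. \<integral>x. (f x \<bullet> b) * g b x \<partial>variation)"
      by (intro sum.cong refl g(2) fb)
    also have "\<dots> = (\<integral>x. (\<Sum>b\<in>Basis. (f x \<bullet> b) * g b x) \<partial>variation)"
      using int by (intro Bochner_Integration.integral_sum[symmetric])
    also have "\<dots> = (\<integral>x. f x \<bullet> (\<Sum>b\<in>Basis. g b x *\<^sub>R b) \<partial>variation)"
      by (simp add: inner_sum_right mult.commute)
    finally show "L f = (\<integral>x. f x \<bullet> (\<Sum>b\<in>Basis. g b x *\<^sub>R b) \<partial>variation)" .
  qed
qed

end

section \<open>Integrands orthogonal to all test functions\<close>

lemma test_functions_exhaust_open:
  fixes V :: "'a::euclidean_space set"
  assumes "open V"
  obtains u :: "nat \<Rightarrow> 'a \<Rightarrow> real" where "\<And>i. u i \<in> test_functions V"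
    and "\<And>i x. 0 \<le> u i x" and "\<And>i x. u i x \<le> 1"
    and "\<And>x. (\<lambda>i. u i x) \<longlonglongrightarrow> indicator V x"
proof -
  obtain C where C: "\<And>i::nat. compact (C i)" "\<And>i. C i \<subseteq> V"
    "\<And>K. compact K \<Longrightarrow> K \<subseteq> V \<Longrightarrow> \<exists>N. \<forall>i\<ge>N. K \<subseteq> C i"
    using open_Union_compact_subsets[OF assms] by metis
  have "\<exists>u. cutoff_between (C i) V u" for i by (rule ex_cutoff[OF C(1) assms C(2)])
  then obtain u where u: "\<And>i. cutoff_between (C i) V (u i)" by metis
  show ?thesis
  proof (rule that[of u])
    show uV: "u i \<in> test_functions V" for i by (rule cutoff_between_test_functions[OF u])
    show "0 \<le> u i x" "u i x \<le> 1" for i x using u[of i] by (auto simp: cutoff_between_def)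
    show "(\<lambda>i. u i x) \<longlonglongrightarrow> indicator V x" for x
    proof (cases "x \<in> V")
      case True
      then obtain N where "\<forall>i\<ge>N. {x} \<subseteq> C i" using C(3)[of "{x}"] by auto
      then have "\<forall>i\<ge>N. u i x = 1" using u unfolding cutoff_between_def by (meson insert_subset subsetD)
      then show ?thesis using True by (intro tendsto_eventually) (auto simp: eventually_sequentially)
    next
      case False
      then have "u i x = 0" for i using uV[of i] by (auto simp: test_functions_def)
      then show ?thesis using False by simp
    qed
  qed
qed

text \<open>This is the fundamental lemma of the calculus of variations. The truncation of f to V is
  integrable and defines a finite signed measure; it vanishes on open sets by dominated convergence
  of test functions to indicators, and on Borel sets because the open sets are an
  intersection-stable generator. The set X admits measures on the whole space as well as measures on
  U.\<close>

lemma AE_zero_if_integral_test_functions_zero: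
  fixes f :: "'a::euclidean_space \<Rightarrow> real"
  assumes sets: "sets \<nu> = sets (restrict_space borel X)" and "open V" and "V \<subseteq> X"
    and int: "integrable \<nu> (\<lambda>x. indicator V x * f x)"
    and zero: "\<And>\<phi>. \<phi> \<in> test_functions V \<Longrightarrow> (\<integral>x. \<phi> x * f x \<partial>\<nu>) = 0"
  shows "AE x in \<nu>. x \<in> V \<longrightarrow> f x = 0"
proof -
  define g where "g x = indicator V x * f x" for x
  have g: "integrable \<nu> g" unfolding g_def[abs_def] by (rule int)
  have space: "space \<nu> = X" using sets_eq_imp_space_eq[OF sets] by (simp add: space_restrict_space)
  have meas: "h \<in> borel_measurable \<nu>" if "h \<in> borel_measurable borel" for h :: "'a \<Rightarrow> real"
    using measurable_restrict_space1[OF that, of X] by (simp only: measurable_cong_sets[OF sets refl])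
  have intA: "integrable \<nu> (\<lambda>x. indicator A x * g x)" if "A \<in> sets borel" for A
  proof -
    have "X \<inter> A \<in> sets \<nu>" unfolding sets sets_restrict_space using that by blast
    from integrable_mult_indicator[OF this g]
    have "integrable \<nu> (\<lambda>x. indicator (X \<inter> A) x * g x)" by simp
    also have "(\<lambda>x. indicator (X \<inter> A) x * g x) = (\<lambda>x. indicator A x * g x)"
      using \<open>V \<subseteq> X\<close> by (auto simp: g_def indicator_def fun_eq_iff)
    finally show ?thesis .
  qed
  have op: "(\<integral>x. indicator G x * g x \<partial>\<nu>) = 0" if "open G" for G :: "'a set"
  proof -
    have "open (V \<inter> G)" using that \<open>open V\<close> by auto
    then obtain u :: "nat \<Rightarrow> 'a \<Rightarrow> real" where u: "\<And>i. u i \<in> test_functions (V \<inter> G)"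
      "\<And>i x. 0 \<le> u i x" "\<And>i x. u i x \<le> 1" "\<And>x. (\<lambda>i. u i x) \<longlonglongrightarrow> indicator (V \<inter> G) x"
      by (rule test_functions_exhaust_open) (rule that)
    have um: "u i \<in> borel_measurable \<nu>" for i
      by (rule meas[OF borel_measurable_continuous_onI[OF test_functions_continuous[OF u(1)]]])
    have ug: "u i x * g x = u i x * f x" for i x
      using u(1)[of i] by (auto simp: g_def test_functions_def indicator_def)
    have "(\<lambda>i. \<integral>x. u i x * g x \<partial>\<nu>) \<longlonglongrightarrow> (\<integral>x. indicator G x * g x \<partial>\<nu>)"
    proof (rule integral_dominated_convergence[where w = "\<lambda>x. norm (g x)"])
      have "(\<lambda>i. u i x * g x) \<longlonglongrightarrow> indicator (V \<inter> G) x * g x" for x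
        by (intro tendsto_mult u tendsto_const)
      moreover have "indicator (V \<inter> G) x * g x = indicator G x * g x" for x
        by (simp add: g_def indicator_def)
      ultimately show "AE x in \<nu>. (\<lambda>i. u i x * g x) \<longlonglongrightarrow> indicator G x * g x" by simp
      show "AE x in \<nu>. norm (u i x * g x) \<le> norm (g x)" for i
        using u(2,3) by (intro AE_I2) (simp add: abs_mult mult_left_le_one_le)
      show "(\<lambda>x. indicator G x * g x) \<in> borel_measurable \<nu>"
        using intA[of G] that by (auto intro: borel_open)
      show "(\<lambda>x. u i x * g x) \<in> borel_measurable \<nu>" for i
        using um g by (intro borel_measurable_times) auto
    qed (use g in auto)
    moreover have "(\<integral>x. u i x * g x \<partial>\<nu>) = 0" for i
      unfolding ug by (rule zero[OF subsetD[OF test_functions_mono u(1)]]) simp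
    ultimately show ?thesis by (simp add: LIMSEQ_const_iff)
  qed
  have zeroA: "(\<integral>x. indicator A x * g x \<partial>\<nu>) = 0" if A: "A \<in> sets borel" for A :: "'a set"
  proof -
    have "Int_stable {S::'a set. open S}" "{S::'a set. open S} \<subseteq> Pow UNIV"
      "A \<in> sigma_sets UNIV {S. open S}"
      using A by (auto simp: Int_stable_def borel_def)
    then show ?thesis
    proof (induction rule: sigma_sets_induct_disjoint)
      case empty
      show ?case by simp
    next
      case (basic G)
      then show ?case by (simp add: op)
    next
      case (compl A)
      have "A \<in> sets borel" using compl.hyps by (simp add: borel_def)
      then have "(\<integral>x. g x - indicator A x * g x \<partial>\<nu>) = (\<integral>x. g x \<partial>\<nu>) - (\<integral>x. indicator A x * g x \<partial>\<nu>)"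
        by (intro Bochner_Integration.integral_diff g intA)
      also have "(\<integral>x. g x \<partial>\<nu>) = 0" using op[of UNIV] by simp
      finally show ?case using compl.IH by (simp add: indicator_diff algebra_simps)
    next
      case (union A)
      note A = union.hyps union.IH
      have Ab: "A i \<in> sets borel" for i using A(2) by (auto simp: borel_def)
      have "(\<lambda>n. \<integral>x. indicator (\<Union>i<n. A i) x * g x \<partial>\<nu>) \<longlonglongrightarrow> (\<integral>x. indicator (\<Union>i. A i) x * g x \<partial>\<nu>)"
      proof (rule integral_dominated_convergence[where w = "\<lambda>x. norm (g x)"])
        show "AE x in \<nu>. (\<lambda>n. indicator (\<Union>i<n. A i) x * g x) \<longlonglongrightarrow> indicator (\<Union>i. A i) x * g x"
          by (intro AE_I2 tendsto_mult LIMSEQ_indicator_UN tendsto_const)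
        show "AE x in \<nu>. norm (indicator (\<Union>i<n. A i) x * g x) \<le> norm (g x)" for n
          by (intro AE_I2) (simp add: indicator_def)
        show "(\<lambda>x. indicator (\<Union>i. A i) x * g x) \<in> borel_measurable \<nu>"
          "(\<lambda>x. indicator (\<Union>i<n. A i) x * g x) \<in> borel_measurable \<nu>" for n
          using intA Ab by (auto intro!: borel_measurable_integrable)
      qed (use g in auto)
      moreover have "(\<integral>x. indicator (\<Union>i<n. A i) x * g x \<partial>\<nu>) = 0" for n
      proof -
        have "indicator (\<Union>i<n. A i) x = (\<Sum>i<n. indicator (A i) x :: real)" for x
          using A(1) by (intro indicator_UN_disjoint) (auto simp: disjoint_family_on_def)
        then have "(\<integral>x. indicator (\<Union>i<n. A i) x * g x \<partial>\<nu>) = (\<integral>x. (\<Sum>i<n. indicator (A i) x * g x) \<partial>\<nu>)"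
          by (simp add: sum_distrib_right)
        also have "\<dots> = (\<Sum>i<n. \<integral>x. indicator (A i) x * g x \<partial>\<nu>)"
          by (intro Bochner_Integration.integral_sum intA Ab)
        finally show ?thesis using A(3) by simp
      qed
      ultimately show ?case by (simp add: LIMSEQ_const_iff)
    qed
  qed
  have "AE x in \<nu>. g x = 0"
  proof (rule density_unique_real[OF g integrable_zero])
    fix A assume "A \<in> sets \<nu>"
    then obtain B where "B \<in> sets borel" "A = X \<inter> B" unfolding sets sets_restrict_space by auto
    moreover have "(\<integral>x. indicator A x *\<^sub>R g x \<partial>\<nu>) = (\<integral>x. indicator B x * g x \<partial>\<nu>)" if "A = X \<inter> B" for B
      by (rule Bochner_Integration.integral_cong) (use that space in \<open>auto simp: indicator_def\<close>)
    ultimately show "set_lebesgue_integral \<nu> A g = set_lebesgue_integral \<nu> A (\<lambda>x. 0)"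
      using zeroA by (simp add: set_lebesgue_integral_def)
  qed
  then show ?thesis by eventually_elim (auto simp: g_def)
qed

section \<open>Rumin covectors and the dual norm\<close>

lemma subspace_Lam: "subspace (Lam d)"
proof (rule subspaceI)
  show "0 \<in> Lam d" by (simp add: Lam_def)
  show "x + y \<in> Lam d" if "x \<in> Lam d" "y \<in> Lam d" for x y :: "'a ext"
    using Lam_lincomb[OF that, of 1 1] by simp
  show "c *\<^sub>R x \<in> Lam d" if "x \<in> Lam d" for c and x :: "'a ext"
    using Lam_lincomb[OF that that, of c 0] by simp
qed

lemma wedge_add_left: "(a + b) \<and>\<^sub>e c = a \<and>\<^sub>e c + b \<and>\<^sub>e c"
  using wedge_lincomb[of 1 a 1 b c] by simp

lemma wedge_scaleR_left: "(r *\<^sub>R a) \<and>\<^sub>e c = r *\<^sub>R (a \<and>\<^sub>e c)"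
  using wedge_lincomb[of r a 0 a c] by simp

lemma wedge_zero_left: "0 \<and>\<^sub>e c = 0"
  using wedge_scaleR_left[of 0 0 c] by simp

lemma wedge_Lam:
  assumes "a \<in> Lam i" and "b \<in> Lam j"
  shows "a \<and>\<^sub>e b \<in> Lam (i + j)"
  unfolding Lam_def
proof (intro CollectI allI impI)
  fix K assume "(a \<and>\<^sub>e b) $ K \<noteq> 0"
  then obtain I where "I \<in> Pow K" "shuffle_sign I (K - I) * a $ I * b $ (K - I) \<noteq> 0"
    unfolding wedge_nth by (rule sum.not_neutral_contains_not_neutral)
  then have I: "I \<subseteq> K" "a $ I \<noteq> 0" "b $ (K - I) \<noteq> 0" by auto
  then have "int (card I) = i" "int (card (K - I)) = j" using assms by (auto simp: Lam_def)
  moreover have "card K = card I + card (K - I)"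
    using I(1) card_mono[of K I] by (simp add: card_Diff_subset)
  ultimately show "int (card K) = i + j" by simp
qed

lemma theta_Lam: "theta \<in> Lam 1"
  by (auto simp: theta_def Lam_def axis_def)

lemma dtheta_Lam: "(dtheta :: 'n::finite ext) \<in> Lam 2"
proof -
  have "axis {IX j, IY j} 1 \<in> Lam 2" for j :: 'n
    by (auto simp: Lam_def axis_def)
  then show ?thesis
    unfolding dtheta_def by (intro subspace_neg subspace_sum subspace_Lam)
qed

lemma subspace_rumin_covectors: "subspace (rumin_covectors k :: 'n::{finite,linorder} ext set)"
proof (cases "k \<le> CARD('n)")
  case True
  then show ?thesis by (simp add: rumin_covectors_def subspace_Lam)
next
  case False
  have "subspace {c \<in> Lam (int k). c \<and>\<^sub>e theta = 0 \<and> c \<and>\<^sub>e (dtheta :: 'n ext) = 0}"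
    using subspace_Lam[of "int k"]
    by (auto simp: subspace_def wedge_add_left wedge_scaleR_left wedge_zero_left)
  then show ?thesis using False by (simp add: rumin_covectors_def)
qed

text \<open>These are the possible values of null forms: by \<open>rumin_null_covectors\<close> and
  \<open>rumin_nullI\<close>, a smooth form on an open set is null exactly when all its values lie
  here. Quotients of spaces of forms thus reduce to pointwise linear algebra.\<close>

definition null_covectors :: "nat \<Rightarrow> 'n::{finite,linorder} ext set" where
  "null_covectors k =
     (if k \<le> CARD('n)
      then (\<lambda>(a, b). a \<and>\<^sub>e theta + b \<and>\<^sub>e dtheta) ` (Lam (int k - 1) \<times> Lam (int k - 2))
      else {0})"

lemma linear_null_covectors: "linear (\<lambda>(a, b). a \<and>\<^sub>e theta + b \<and>\<^sub>e dtheta)"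
  by (rule linearI) (auto simp: wedge_add_left wedge_scaleR_left scaleR_add_right)

lemma subspace_null_covectors: "subspace (null_covectors k)"
  unfolding null_covectors_def
  by (auto intro!: linear_subspace_image linear_null_covectors subspace_Times subspace_Lam)

lemma null_covectors_subset: "null_covectors k \<subseteq> rumin_covectors k"
proof
  fix c :: "'n::{finite,linorder} ext" assume c: "c \<in> null_covectors k"
  show "c \<in> rumin_covectors k"
  proof (cases "k \<le> CARD('n)")
    case True
    then obtain a b where "a \<in> Lam (int k - 1)" "b \<in> Lam (int k - 2)" "c = a \<and>\<^sub>e theta + b \<and>\<^sub>e dtheta"
      using c by (auto simp: null_covectors_def)
    then have "c \<in> Lam (int k)"
      using wedge_Lam[of a "int k - 1" theta 1] wedge_Lam[of b "int k - 2" dtheta 2] theta_Lam dtheta_Lam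
        subspace_add[OF subspace_Lam[of "int k"]] by auto
    then show ?thesis using True by (simp add: rumin_covectors_def)
  next
    case False
    then show ?thesis
      using c subspace_0[OF subspace_rumin_covectors[of k]] by (simp add: null_covectors_def)
  qed
qed

lemma rumin_null_covectors:
  assumes "\<omega> \<in> rumin_null V k" and "p \<in> V"
  shows "\<omega> p \<in> null_covectors k"
proof (cases "k \<le> CARD('a)")
  case True
  then obtain \<alpha> \<beta> where "\<alpha> \<in> forms V (int k - 1)" "\<beta> \<in> forms V (int k - 2)"
    "\<omega> p = \<alpha> p \<and>\<^sub>e theta + \<beta> p \<and>\<^sub>e dtheta"
    using assms by (auto simp: rumin_null_def rumin_I_def)
  then show ?thesis using True assms(2) by (force simp: null_covectors_def forms_def)
next
  case False
  then show ?thesis using assms by (simp add: rumin_null_def null_covectors_def)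
qed

text \<open>
  The equation \<open>\<omega> = \<alpha> \<and> \<theta> + \<beta> \<and> d\<theta>\<close> has constant coefficients in the left invariant coframe, so
  \<open>\<alpha>\<close> and \<open>\<beta>\<close> can be chosen as a linear image of \<open>\<omega>\<close>.
\<close>

lemma rumin_nullI:
  fixes \<omega> :: "'n::{finite,linorder} form"
  assumes "open V" and "smooth_on V \<omega>" and null: "\<And>p. p \<in> V \<Longrightarrow> \<omega> p \<in> null_covectors k"
  shows "\<omega> \<in> rumin_null V k"
proof (cases "k \<le> CARD('n)")
  case True
  let ?f = "\<lambda>(a, b). a \<and>\<^sub>e theta + b \<and>\<^sub>e (dtheta :: 'n ext)"
    and ?S = "Lam (int k - 1) \<times> Lam (int k - 2) :: ('n ext \<times> 'n ext) set"
  obtain g where g: "range g \<subseteq> ?S" "linear g" "\<And>c. c \<in> ?f ` ?S \<Longrightarrow> ?f (g c) = c"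
    using linear_exists_right_inverse_on[OF linear_null_covectors subspace_Times[OF subspace_Lam subspace_Lam]]
    by blast
  have bl: "bounded_linear g" using g(2) linear_conv_bounded_linear by blast
  define \<alpha> where "\<alpha> p = fst (g (\<omega> p))" for p
  define \<beta> where "\<beta> p = snd (g (\<omega> p))" for p
  have "smooth_on V \<alpha>" "smooth_on V \<beta>"
    unfolding \<alpha>_def \<beta>_def
    by (rule smooth_on_linear[OF assms(1) _ assms(2)],
        rule bounded_linear_compose[OF bounded_linear_fst bl] bounded_linear_compose[OF bounded_linear_snd bl])+
  moreover have "g c \<in> ?S" for c using g(1) by blast
  ultimately have "\<alpha> \<in> forms V (int k - 1)" "\<beta> \<in> forms V (int k - 2)"
    by (auto simp: forms_def \<alpha>_def \<beta>_def mem_Times_iff)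
  moreover have "\<omega> p = \<alpha> p \<and>\<^sub>e theta + \<beta> p \<and>\<^sub>e dtheta" if "p \<in> V" for p
    using g(3)[of "\<omega> p"] null[OF that] True by (simp add: null_covectors_def \<alpha>_def \<beta>_def case_prod_beta)
  ultimately show ?thesis using True by (auto simp: rumin_null_def rumin_I_def)
next
  case False
  then show ?thesis using null by (simp add: rumin_null_def null_covectors_def)
qed

section \<open>Test forms and their classes\<close>

lemma rumin_reps_iff:
  "\<omega> \<in> rumin_reps U k \<longleftrightarrow> smooth_on U \<omega> \<and> (\<forall>p\<in>U. \<omega> p \<in> rumin_covectors k)"
  by (auto simp: rumin_reps_def forms_def rumin_J_def rumin_covectors_def)

text \<open>On the open set U - K the form is zero and hence null. The support is therefore K minus
  an open set, which gives compactness.\<close>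

lemma test_function_rumin_spt:
  fixes \<omega> :: "'n::{finite,linorder} form"
  assumes "open U" and "compact K" and "K \<subseteq> U" and zero: "\<And>p. p \<notin> K \<Longrightarrow> \<omega> p = 0"
  shows "rumin_spt U k \<omega> \<subseteq> K" and "compact (rumin_spt U k \<omega>)"
proof -
  define G where "G = \<Union>{V. open V \<and> V \<subseteq> U \<and> \<omega> \<in> rumin_null V k}"
  have open_diff: "open (U - K)" using assms by (intro open_Diff compact_imp_closed)
  have "\<omega> \<in> rumin_null (U - K) k"
    by (rule rumin_nullI[OF open_diff smooth_on_cong[OF open_diff smooth_on_const[of _ 0]]])
      (use zero subspace_0[OF subspace_null_covectors] in auto)
  then show sub: "rumin_spt U k \<omega> \<subseteq> K"
    unfolding rumin_spt_def using open_diff by blast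
  have "open G" unfolding G_def by (rule open_Union) blast
  moreover have "rumin_spt U k \<omega> = K - G"
    using sub \<open>K \<subseteq> U\<close> unfolding rumin_spt_def G_def by blast
  ultimately show "compact (rumin_spt U k \<omega>)" using compact_diff[OF \<open>compact K\<close>] by simp
qed

lemma test_repsI:
  fixes \<omega> :: "'n::{finite,linorder} form"
  assumes "open U" and "\<omega> \<in> test_functions U" and "\<And>p. \<omega> p \<in> rumin_covectors k"
  shows "\<omega> \<in> test_reps U k"
proof -
  obtain K where "compact K" "K \<subseteq> U" "\<And>p. p \<notin> K \<Longrightarrow> \<omega> p = 0"
    using assms(2) unfolding test_functions_def by blast
  from test_function_rumin_spt(2)[OF assms(1) this] show ?thesis
    using assms smooth_on_subset[of UNIV \<omega> U] by (auto simp: test_reps_def rumin_reps_iff test_functions_def)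
qed

lemma rumin_class_eqI:
  fixes \<omega> \<eta> :: "'n::{finite,linorder} form"
  assumes "open U" and "(\<lambda>p. \<omega> p - \<eta> p) \<in> rumin_null U k"
  shows "rumin_class U k \<omega> = rumin_class U k \<eta>"
proof -
  have "(\<lambda>p. \<zeta> p - \<eta> p) \<in> rumin_null U k \<longleftrightarrow> (\<lambda>p. \<zeta> p - \<omega> p) \<in> rumin_null U k" for \<zeta>
    using rumin_null_lincomb[OF assms(1) _ assms(2), of "\<lambda>p. \<zeta> p - \<omega> p" 1 1]
      rumin_null_lincomb[OF assms(1) _ assms(2), of "\<lambda>p. \<zeta> p - \<eta> p" 1 "-1"]
    by (auto simp: algebra_simps)
  then show ?thesis by (simp add: rumin_class_def)
qed

section \<open>Comass and dual norm\<close>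

lemma comass_le_norm: "comass k c \<le> ereal (norm c)"
  unfolding comass_def
proof (rule SUP_least)
  fix v :: "'a ext" assume "v \<in> {v \<in> simple_integrable k. norm v = 1}"
  then show "ereal (c \<bullet> v) \<le> ereal (norm c)" using norm_cauchy_schwarz[of c v] by simp
qed

lemma comass_le_one: "norm c \<le> 1 \<Longrightarrow> comass k c \<le> 1"
  using comass_le_norm[of k c] by (metis ereal_less_eq(3) one_ereal_def order_trans)

text \<open>The hypothesis is stable under scaling, so all multiples of such a covector have comass
  at most one. This forces a functional of finite mass to vanish on test forms with such
  values.\<close>

lemma comass_le_one_if_orthogonal:
  assumes "\<And>v. v \<in> HLam k \<Longrightarrow> c \<bullet> v = 0"
  shows "comass k c \<le> 1"
  unfolding comass_def
proof (rule SUP_least)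
  fix v :: "'a ext" assume "v \<in> {v \<in> simple_integrable k. norm v = 1}"
  then have "v \<in> HLam k" by (simp add: HLam_def span_base)
  then show "ereal (c \<bullet> v) \<le> 1" using assms by simp
qed

lemma dual_norm_le_iff:
  "dual_norm k v \<le> ereal r \<longleftrightarrow> (\<forall>c\<in>rumin_covectors k. comass k c \<le> 1 \<longrightarrow> c \<bullet> v \<le> r)"
  unfolding dual_norm_def by (auto simp: SUP_le_iff)

lemma dual_norm_nonneg: "0 \<le> dual_norm k v"
  unfolding dual_norm_def
proof (rule SUP_upper2)
  show "(0 :: 'a ext) \<in> {c \<in> rumin_covectors k. comass k c \<le> 1}"
    using subspace_0[OF subspace_rumin_covectors] comass_le_one_if_orthogonal[of k 0] by auto
qed simp

text \<open>The supremum runs over an uncountable family, but a supremum of continuous functions is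
  lower semicontinuous: its strict superlevel sets are unions of open sets.\<close>

lemma borel_measurable_dual_norm: "dual_norm k \<in> borel_measurable borel"
proof (rule borel_measurableI_greater)
  fix a
  have "{v. a < dual_norm k v} = (\<Union>c\<in>{c \<in> rumin_covectors k. comass k c \<le> 1}. {v. a < ereal (c \<bullet> v)})"
    by (auto simp: dual_norm_def less_SUP_iff)
  also have "open \<dots>"
    by (intro open_UN ballI open_Collect_less continuous_intros)
  finally show "{v \<in> space borel. a < dual_norm k v} \<in> sets borel"
    using borel_open by simp
qed

text \<open>Closure under normalisation and change of sign turns the one-sided supremum in
  \<open>comass\<close> into a bound on absolute values of pairings.\<close>

lemma simple_integrable_scaleR:
  assumes "v \<in> simple_integrable k"
  shows "r *\<^sub>R v \<in> simple_integrable k"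
proof -
  have h: "r *\<^sub>R v \<in> simple_integrable_horizontal j" if v: "v \<in> simple_integrable_horizontal j" for v j
  proof -
    obtain c vs where "v = c *\<^sub>R wedge_list vs" "length vs = j" "set vs \<subseteq> horizontal"
      "integrable_distribution (spanned_distribution vs)"
      using v unfolding simple_integrable_horizontal_def by auto
    then show ?thesis
      unfolding simple_integrable_horizontal_def
      by (intro CollectI exI[of _ "r * c"] exI[of _ vs]) simp
  qed
  have "r *\<^sub>R hodge w = hodge (r *\<^sub>R w)" for w :: "'a ext"
    by (simp add: hodge_def vec_eq_iff)
  then show ?thesis
    using assms h unfolding simple_integrable_def by (auto split: if_splits)
qed

text \<open>For simple integrable x the pairing is at most the norm of x, and such bounds add up
  along linear combinations. A bound is not automatic, since the covectors of comass at most one may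
  form an unbounded set.\<close>

lemma HLam_bounded_pairing:
  assumes "v \<in> HLam k"
  shows "\<exists>C. \<forall>c. comass k c \<le> 1 \<longrightarrow> \<bar>c \<bullet> v\<bar> \<le> C"
proof -
  have "v \<in> span (simple_integrable k)" using assms by (simp add: HLam_def)
  then show ?thesis
  proof (induction rule: span_induct_alt)
    case base
    then show ?case by (auto intro: exI[of _ 0])
  next
    case (step r x y)
    obtain C where C: "\<And>c. comass k c \<le> 1 \<Longrightarrow> \<bar>c \<bullet> y\<bar> \<le> C" using step.IH by blast
    have unit: "c \<bullet> u \<le> 1" if "comass k c \<le> 1" "u \<in> simple_integrable k" "norm u = 1" for c u
    proof -
      have "ereal (c \<bullet> u) \<le> comass k c" unfolding comass_def by (rule SUP_upper) (use that in simp)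
      then show ?thesis using that(1) by (metis ereal_less_eq(3) one_ereal_def order_trans)
    qed
    have "\<bar>c \<bullet> x\<bar> \<le> norm x" if c: "comass k c \<le> 1" for c
    proof (cases "x = 0")
      case False
      have "c \<bullet> ((1 / norm x) *\<^sub>R x) \<le> 1" "c \<bullet> ((- 1 / norm x) *\<^sub>R x) \<le> 1"
        using False step.hyps by (intro unit[OF c] simple_integrable_scaleR; simp)+
      then show ?thesis using False by (simp add: abs_le_iff field_simps)
    qed simp
    then have "\<bar>c \<bullet> (r *\<^sub>R x + y)\<bar> \<le> \<bar>r\<bar> * norm x + C" if "comass k c \<le> 1" for c
      using C[OF that] that
      by (simp add: inner_add_right abs_mult add_mono mult_left_mono order_trans[OF abs_triangle_ineq])
    then show ?case by blast
  qed
qed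

text \<open>An orthonormal basis of \<open>HLam k\<close> turns the bounds of
  \<open>HLam_bounded_pairing\<close> into one constant, which later makes the dual norm of the
  density integrable. Outside \<open>HLam k\<close> the dual norm can be infinite, namely on vectors
  that pair nontrivially with a Rumin covector orthogonal to \<open>HLam k\<close>.\<close>

lemma dual_norm_le_norm:
  obtains C where "C \<ge> 0" and "\<And>v. v \<in> HLam k \<Longrightarrow> dual_norm k v \<le> ereal (C * norm v)"
proof -
  obtain B where B: "B \<subseteq> HLam k" "pairwise orthogonal B" "\<And>x. x \<in> B \<Longrightarrow> norm x = 1"
    "independent B" "span B = (HLam k :: 'a ext set)"
    using orthonormal_basis_subspace[of "HLam k"] by (metis HLam_def subspace_span)
  have fin: "finite B" using B(4) by (rule independent_imp_finite)
  obtain D where D: "\<And>b c. b \<in> B \<Longrightarrow> comass k c \<le> 1 \<Longrightarrow> \<bar>c \<bullet> b\<bar> \<le> D b"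
    using HLam_bounded_pairing B(1) by (metis subsetD)
  define C where "C = (\<Sum>b\<in>B. \<bar>D b\<bar>)"
  show ?thesis
  proof (rule that[of C])
    show "C \<ge> 0" by (simp add: C_def sum_nonneg)
    fix v :: "'a ext" assume v: "v \<in> HLam k"
    show "dual_norm k v \<le> ereal (C * norm v)"
      unfolding dual_norm_le_iff
    proof (intro ballI impI)
      fix c :: "'a ext" assume c: "comass k c \<le> 1"
      have "v = (\<Sum>b\<in>B. (v \<bullet> b) *\<^sub>R b)"
        using orthonormal_basis_expand[OF B(2,3) _ fin, of v] v B(5) by (simp add: inner_commute)
      then have "c \<bullet> v = (\<Sum>b\<in>B. (v \<bullet> b) * (c \<bullet> b))"
        by (metis (no_types, lifting) inner_scaleR_right inner_sum_right sum.cong)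
      also have "\<dots> \<le> (\<Sum>b\<in>B. norm v * \<bar>D b\<bar>)"
      proof (rule sum_mono)
        fix b assume b: "b \<in> B"
        have "(v \<bullet> b) * (c \<bullet> b) \<le> \<bar>v \<bullet> b\<bar> * \<bar>c \<bullet> b\<bar>" by (metis abs_ge_self abs_mult)
        also have "\<dots> \<le> norm v * \<bar>D b\<bar>"
          using Cauchy_Schwarz_ineq2[of v b] B(3)[OF b] D[OF b c] by (intro mult_mono) auto
        finally show "(v \<bullet> b) * (c \<bullet> b) \<le> norm v * \<bar>D b\<bar>" .
      qed
      finally show "c \<bullet> v \<le> C * norm v" by (simp add: C_def sum_distrib_left mult.commute)
    qed
  qed
qed

section \<open>Linear choice of representing vectors\<close>

lemma ex_linear_projection:
  fixes A :: "'a::euclidean_space set"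
  assumes "subspace A"
  obtains P where "linear P" and "\<And>x. P x \<in> A" and "\<And>x. x \<in> A \<Longrightarrow> P x = x"
  using linear_exists_left_inverse_on[OF linear_id assms, simplified] by blast

text \<open>
  By duality \<open>(A \<inter> H\<^sup>\<bottom>)\<^sup>\<bottom> = A\<^sup>\<bottom> + H\<close>, and \<open>R\<close> is a linear choice of the summand in \<open>H\<close>.
\<close>

lemma ex_linear_representative:
  fixes A H :: "'a::euclidean_space set"
  assumes A: "subspace A" and H: "subspace H"
  obtains R where "linear R" and "\<And>v. R v \<in> H"
    and "\<And>v. \<forall>c\<in>A. (\<forall>h\<in>H. c \<bullet> h = 0) \<longrightarrow> c \<bullet> v = 0 \<Longrightarrow> \<forall>c\<in>A. c \<bullet> R v = c \<bullet> v"
proof -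
  obtain P where P: "linear P" "\<And>x. P x \<in> A" "\<And>x. x \<in> A \<Longrightarrow> P x = x"
    using ex_linear_projection[OF A] by blast
  note adj = adjoint_works[OF P(1)] and lin = adjoint_linear[OF P(1)]
  \<comment> \<open>The vector \<open>adjoint P v\<close> encodes exactly the pairings of v with A.
    A right inverse of \<open>adjoint P\<close> on H therefore returns a vector of H with the same
    pairings, and does so linearly.\<close>
  obtain g where g: "range g \<subseteq> H" "linear g" "\<And>v. v \<in> adjoint P ` H \<Longrightarrow> adjoint P (g v) = v"
    using linear_exists_right_inverse_on[OF lin H] by blast
  show ?thesis
  proof (rule that[of "\<lambda>v. g (adjoint P v)"])
    show "linear (\<lambda>v. g (adjoint P v))" using linear_compose[OF lin g(2)] by (simp add: o_def)
    show "g (adjoint P v) \<in> H" for v using g(1) by blast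
    fix v assume v: "\<forall>c\<in>A. (\<forall>h\<in>H. c \<bullet> h = 0) \<longrightarrow> c \<bullet> v = 0"
    \<comment> \<open>In finite dimension the double orthogonal complement of the image of H is that
      image itself, so membership can be tested against orthogonal vectors.\<close>
    have "adjoint P v \<in> (adjoint P ` H)\<^sup>\<bottom>\<^sup>\<bottom>"
      unfolding orthogonal_comp_def orthogonal_def
    proof (intro CollectI ballI)
      fix y assume "y \<in> {x. \<forall>y\<in>adjoint P ` H. y \<bullet> x = 0}"
      then have "y \<bullet> adjoint P h = 0" if "h \<in> H" for h using that by (auto simp: inner_commute)
      then have "P y \<bullet> h = 0" if "h \<in> H" for h using that by (simp add: adj)
      then have "P y \<bullet> v = 0" using v P(2) by blast
      then show "y \<bullet> adjoint P v = 0" by (simp add: adj)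
    qed
    then have "adjoint P v \<in> adjoint P ` H"
      by (simp add: orthogonal_comp_self linear_subspace_image[OF lin H])
    from g(3)[OF this] have eq: "adjoint P (g (adjoint P v)) = adjoint P v" .
    show "\<forall>c\<in>A. c \<bullet> g (adjoint P v) = c \<bullet> v"
    proof
      fix c assume "c \<in> A"
      then show "c \<bullet> g (adjoint P v) = c \<bullet> v"
        using eq adj[of c "g (adjoint P v)"] adj[of c v] P(3) by simp
    qed
  qed
qed

section \<open>Mass and representability\<close>

text \<open>Scaled by the reciprocal of norm c + 1, with either sign, c has comass at most one; the
  summand 1 covers c = 0. With r = 0 the bound says that a vector of dual norm zero is annihilated
  by every Rumin covector.\<close>

lemma abs_inner_le_dual_norm:
  assumes "dual_norm k v \<le> ereal r" and c: "c \<in> rumin_covectors k"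
  shows "\<bar>c \<bullet> v\<bar> \<le> r * (norm c + 1)"
proof -
  have pos: "0 < norm c + 1" by (simp add: add_nonneg_pos)
  have "s * (c \<bullet> v) \<le> r" if s: "\<bar>s\<bar> = 1 / (norm c + 1)" for s
  proof -
    have "norm (s *\<^sub>R c) \<le> 1" using s pos by (simp add: divide_le_eq)
    then have "comass k (s *\<^sub>R c) \<le> 1" by (rule comass_le_one)
    moreover have "s *\<^sub>R c \<in> rumin_covectors k" by (rule subspace_mul[OF subspace_rumin_covectors c])
    ultimately have "(s *\<^sub>R c) \<bullet> v \<le> r" using assms(1) dual_norm_le_iff by blast
    then show ?thesis by simp
  qed
  from this[of "1 / (norm c + 1)"] this[of "- (1 / (norm c + 1))"] pos
  show ?thesis by (simp add: abs_le_iff field_simps)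
qed

text \<open>Both inequalities follow from one equivalence, which expresses homogeneity through real
  upper bounds and so avoids arithmetic with extended reals.\<close>

lemma dual_norm_normalized:
  assumes r: "dual_norm k v = ereal r" "r > 0"
  shows "dual_norm k ((1 / r) *\<^sub>R v) = 1"
proof -
  have le: "dual_norm k ((1 / r) *\<^sub>R v) \<le> ereal t \<longleftrightarrow> r \<le> r * t" for t
  proof -
    have "dual_norm k ((1 / r) *\<^sub>R v) \<le> ereal t \<longleftrightarrow> dual_norm k v \<le> ereal (r * t)"
      using r(2) by (simp add: dual_norm_le_iff divide_le_eq mult.commute)
    then show ?thesis using r(1) by simp
  qed
  have 1: "dual_norm k ((1 / r) *\<^sub>R v) \<le> ereal 1" by (simp add: le)
  moreover have "ereal 1 \<le> dual_norm k ((1 / r) *\<^sub>R v)"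
  proof (cases "dual_norm k ((1 / r) *\<^sub>R v)")
    case (real t)
    then have "r \<le> r * t" using le[of t] by simp
    then show ?thesis using real r(2) by simp
  qed (use 1 dual_norm_nonneg[of k "(1 / r) *\<^sub>R v"] in auto)
  ultimately show ?thesis by (simp add: one_ereal_def)
qed

section \<open>From finite mass to a representation\<close>

lemma finite_mass_imp_representable:
  fixes U :: "'n::{finite,linorder} heis set"
  assumes U: "open U"
    and lin: "\<And>\<omega> \<eta> a b. \<omega> \<in> test_reps U k \<Longrightarrow> \<eta> \<in> test_reps U k \<Longrightarrow>
      T (rumin_class U k (\<lambda>p. a *\<^sub>R \<omega> p + b *\<^sub>R \<eta> p)) = a * T (rumin_class U k \<omega>) + b * T (rumin_class U k \<eta>)"
    and mass: "mass U k T < \<infinity>"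
  shows "representable_by_integration U k T"
proof -
  define A :: "'n ext set" where "A = rumin_covectors k"
  define H :: "'n ext set" where "H = HLam k"
  define I :: "'n ext set" where "I = null_covectors k"
  have A: "subspace A" unfolding A_def by (rule subspace_rumin_covectors)
  have H: "subspace H" unfolding H_def HLam_def by (rule subspace_span)
  have I: "subspace I" "I \<subseteq> A"
    unfolding I_def A_def by (rule subspace_null_covectors, rule null_covectors_subset)

  have "\<exists>M. \<forall>\<omega>\<in>test_reps U k. (\<forall>p\<in>U. comass k (\<omega> p) \<le> 1) \<longrightarrow> T (rumin_class U k \<omega>) \<le> M"
  proof -
    have le: "ereal (T (rumin_class U k \<omega>)) \<le> mass U k T"
      if "\<omega> \<in> test_reps U k" "\<forall>p\<in>U. comass k (\<omega> p) \<le> 1" for \<omega>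
      unfolding mass_def by (rule SUP_upper) (use that in auto)
    show ?thesis
    proof (cases "mass U k T")
      case (real M)
      then show ?thesis using le by (intro exI[of _ M]) auto
    qed (use mass le in auto)
  qed
  then obtain M where M: "\<And>\<omega>. \<omega> \<in> test_reps U k \<Longrightarrow> (\<And>p. p \<in> U \<Longrightarrow> comass k (\<omega> p) \<le> 1) \<Longrightarrow>
      T (rumin_class U k \<omega>) \<le> M"
    by blast
  have T_scaleR: "T (rumin_class U k (\<lambda>p. r *\<^sub>R \<omega> p)) = r * T (rumin_class U k \<omega>)"
    if "\<omega> \<in> test_reps U k" for \<omega> r
    using lin[OF that that, of r 0] by simp

  obtain P where P: "linear P" "\<And>x. P x \<in> A" "\<And>x. x \<in> A \<Longrightarrow> P x = x"
    using ex_linear_projection[OF A] by blast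
  then have blP: "bounded_linear P" by (simp add: linear_conv_bounded_linear)
  obtain C where C: "C > 0" "\<And>x. norm (P x) \<le> norm x * C"
    using bounded_linear.pos_bounded[OF blP] by blast
  have P_test: "(\<lambda>p. P (\<omega> p)) \<in> test_reps U k" if "\<omega> \<in> test_functions U" for \<omega>
    using P(2) by (intro test_repsI U test_functions_linear[OF blP that]) (simp add: A_def)
  \<comment> \<open>\<open>P\<close> makes arbitrary covector valued test functions admissible, so
    the theory of bounded functionals applies. It enlarges norms by at most the factor C, whence the
    bound C * M.\<close>
  define L where "L \<omega> = T (rumin_class U k (\<lambda>p. P (\<omega> p)))" for \<omega>
  interpret L: bounded_test_functional U L "C * M"
  proof
    show "open U" by (rule U)
    fix f g :: "'n form" and a b assume "f \<in> test_functions U" "g \<in> test_functions U"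
    then show "L (\<lambda>x. a *\<^sub>R f x + b *\<^sub>R g x) = a * L f + b * L g"
      unfolding L_def using lin[OF P_test P_test, of f g a b] P(1)
      by (simp add: linear_add linear_scale)
  next
    fix f :: "'n form" assume f: "f \<in> test_functions U" and le: "\<And>x. norm (f x) \<le> 1"
    have "T (rumin_class U k (\<lambda>p. (1 / C) *\<^sub>R P (f p))) \<le> M"
    proof (rule M)
      show "(\<lambda>p. (1 / C) *\<^sub>R P (f p)) \<in> test_reps U k"
        using test_reps_lincomb[OF U P_test[OF f] P_test[OF f], of "1 / C" 0] by simp
      fix p
      have "norm (P (f p)) \<le> 1 * C"
        using C(2)[of "f p"] le[of p] C(1) by (meson mult_right_mono less_imp_le order_trans)
      then have "norm ((1 / C) *\<^sub>R P (f p)) \<le> 1" using C(1) by (simp add: divide_le_eq)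
      then show "comass k ((1 / C) *\<^sub>R P (f p)) \<le> 1" by (rule comass_le_one)
    qed
    then show "L f \<le> C * M"
      using T_scaleR[OF P_test[OF f], of "1 / C"] C(1) by (simp add: L_def divide_le_eq mult.commute)
  qed
  define \<mu> where "\<mu> = L.variation"
  have sets_\<mu> [measurable_cong, simp]: "sets \<mu> = sets borel" by (simp add: \<mu>_def)
  have space_\<mu> [simp]: "space \<mu> = UNIV" by (simp add: \<mu>_def)
  have AE_U: "AE p in \<mu>. p \<in> U" unfolding \<mu>_def by (rule L.AE_variation)
  obtain v0 where v0: "integrable \<mu> v0"
    and L_eq: "\<And>f. f \<in> test_functions U \<Longrightarrow> L f = (\<integral>p. f p \<bullet> v0 p \<partial>\<mu>)"
    using L.representation unfolding \<mu>_def by blast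
  have T_eq: "T (rumin_class U k \<omega>) = (\<integral>p. \<omega> p \<bullet> v0 p \<partial>\<mu>)"
    if "\<omega> \<in> test_functions U" "\<And>p. \<omega> p \<in> A" for \<omega>
    using L_eq[OF that(1)] P(3)[OF that(2)] by (simp add: L_def)
  have const: "(\<lambda>p. \<phi> p *\<^sub>R c) \<in> test_functions U" "\<And>p. \<phi> p *\<^sub>R c \<in> A" "(\<lambda>p. \<phi> p *\<^sub>R c) \<in> test_reps U k"
    if "\<phi> \<in> test_functions U" "c \<in> A" for \<phi> :: "'n heis \<Rightarrow> real" and c :: "'n ext"
  proof -
    show 1: "(\<lambda>p. \<phi> p *\<^sub>R c) \<in> test_functions U"
      by (rule test_functions_scaleR[OF that(1) smooth_on_const])
    show 2: "\<phi> p *\<^sub>R c \<in> A" for p by (rule subspace_mul[OF A that(2)])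
    show "(\<lambda>p. \<phi> p *\<^sub>R c) \<in> test_reps U k"
      by (rule test_repsI[OF U 1]) (use 2 in \<open>simp add: A_def\<close>)
  qed

  \<comment> \<open>Testing with \<phi> c settles one covector c up to a null set depending on c; a
    finite basis of the span of S then provides a single null set for all c in S.\<close>
  have AE_orthogonal: "AE p in \<mu>. \<forall>c\<in>S. c \<bullet> v0 p = 0"
    if S: "S \<subseteq> A" and zero: "\<And>c \<phi>. c \<in> S \<Longrightarrow> \<phi> \<in> test_functions U \<Longrightarrow> T (rumin_class U k (\<lambda>p. \<phi> p *\<^sub>R c)) = 0"
    for S :: "'n ext set"
  proof -
    have one: "AE p in \<mu>. c \<bullet> v0 p = 0" if c: "c \<in> S" for c
    proof -
      have "AE p in \<mu>. p \<in> U \<longrightarrow> c \<bullet> v0 p = 0"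
      proof (rule AE_zero_if_integral_test_functions_zero[where X = UNIV])
        show "sets \<mu> = sets (restrict_space borel UNIV)" by simp
        have "integrable \<mu> (\<lambda>p. c \<bullet> v0 p)" using v0 by simp
        then show "integrable \<mu> (\<lambda>p. indicator U p * (c \<bullet> v0 p))"
          using integrable_mult_indicator[of U \<mu> "\<lambda>p. c \<bullet> v0 p"] U by simp
        show "(\<integral>p. \<phi> p * (c \<bullet> v0 p) \<partial>\<mu>) = 0" if "\<phi> \<in> test_functions U" for \<phi>
          using T_eq[OF const(1,2)[OF that]] zero[OF c that] c S by auto
      qed (use U in auto)
      with AE_U show ?thesis by eventually_elim simp
    qed
    obtain B where B: "B \<subseteq> S" "independent B" "S \<subseteq> span B"
      using maximal_independent_subset by blast
    have "finite B" using B(2) by (rule independent_imp_finite)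
    then have "AE p in \<mu>. \<forall>c\<in>B. c \<bullet> v0 p = 0" using one B(1) by (intro AE_finite_allI) auto
    then show ?thesis
    proof eventually_elim
      case (elim p)
      have "subspace {c. c \<bullet> v0 p = 0}" by (auto simp: subspace_def inner_add_left)
      then have "span B \<subseteq> {c. c \<bullet> v0 p = 0}" using elim by (intro span_minimal) auto
      then show ?case using B(3) by blast
    qed
  qed
  have AE_H: "AE p in \<mu>. \<forall>c\<in>{c\<in>A. \<forall>h\<in>H. c \<bullet> h = 0}. c \<bullet> v0 p = 0"
  proof (rule AE_orthogonal)
    fix c :: "'n ext" and \<phi> :: "'n heis \<Rightarrow> real" assume c: "c \<in> {c\<in>A. \<forall>h\<in>H. c \<bullet> h = 0}" and \<phi>: "\<phi> \<in> test_functions U"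
    define t where "t = T (rumin_class U k (\<lambda>p. \<phi> p *\<^sub>R c))"
    \<comment> \<open>All multiples of the form have comass at most one, so all multiples of t are
      bounded by M, which forces t = 0.\<close>
    have le: "r * t \<le> M" for r
    proof -
      have rep: "(\<lambda>p. \<phi> p *\<^sub>R c) \<in> test_reps U k" using const(3)[OF \<phi>] c by blast
      have "T (rumin_class U k (\<lambda>p. r *\<^sub>R (\<phi> p *\<^sub>R c))) \<le> M"
      proof (rule M)
        show "(\<lambda>p. r *\<^sub>R (\<phi> p *\<^sub>R c)) \<in> test_reps U k"
          using test_reps_lincomb[OF U rep rep, of r 0] by simp
        show "comass k (r *\<^sub>R (\<phi> p *\<^sub>R c)) \<le> 1" for p
          by (rule comass_le_one_if_orthogonal) (use c in \<open>simp add: H_def\<close>)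
      qed
      then show ?thesis using T_scaleR[OF rep, of r] by (simp add: t_def)
    qed
    have "t = 0"
    proof (rule ccontr)
      assume "t \<noteq> 0"
      then show False using le[of "(M + 1) / t"] by simp
    qed
    then show "T (rumin_class U k (\<lambda>p. \<phi> p *\<^sub>R c)) = 0" by (simp add: t_def)
  qed blast
  \<comment> \<open>Forms with values in I represent the zero class, on which T vanishes. This makes
    the later integrals independent of the representative.\<close>
  have AE_I: "AE p in \<mu>. \<forall>c\<in>I. c \<bullet> v0 p = 0"
  proof (rule AE_orthogonal)
    fix c :: "'n ext" and \<phi> :: "'n heis \<Rightarrow> real" assume c: "c \<in> I" and \<phi>: "\<phi> \<in> test_functions U"
    have z: "(\<lambda>p. \<phi> p *\<^sub>R c - 0) \<in> rumin_null U k"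
    proof (rule rumin_nullI[OF U])
      show "smooth_on U (\<lambda>p. \<phi> p *\<^sub>R c - 0)"
        using \<phi> smooth_on_subset[of UNIV \<phi> U]
        by (auto simp: test_functions_def intro: smooth_on_scaleR[OF U] smooth_on_const)
      show "\<phi> p *\<^sub>R c - 0 \<in> null_covectors k" for p
        using subspace_mul[OF I(1) c] by (simp add: I_def)
    qed
    have "(\<lambda>p. 0) \<in> test_reps U k"
      using test_repsI[OF U test_functions_zero] subspace_0[OF A] by (simp add: A_def)
    then have "T (rumin_class U k (\<lambda>p. 0)) = 0" using T_scaleR[of "\<lambda>p. 0" 0] by simp
    then show "T (rumin_class U k (\<lambda>p. \<phi> p *\<^sub>R c)) = 0" using rumin_class_eqI[OF U z] by simp
  qed (rule I(2))

  obtain R where R: "linear R" "\<And>v. R v \<in> H"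
    "\<And>v. \<forall>c\<in>A. (\<forall>h\<in>H. c \<bullet> h = 0) \<longrightarrow> c \<bullet> v = 0 \<Longrightarrow> \<forall>c\<in>A. c \<bullet> R v = c \<bullet> v"
    by (rule ex_linear_representative[OF A H]) (rule that)
  define v1 where "v1 p = R (v0 p)" for p
  have v1: "integrable \<mu> v1"
    unfolding v1_def by (rule integrable_bounded_linear[OF _ v0]) (use R(1) in \<open>simp add: linear_conv_bounded_linear\<close>)
  have [measurable]: "v1 \<in> borel_measurable borel"
    using borel_measurable_integrable[OF v1] by simp
  have v1_H: "v1 p \<in> H" for p by (simp add: v1_def R(2))
  have v1_v0: "AE p in \<mu>. \<forall>c\<in>A. c \<bullet> v1 p = c \<bullet> v0 p"
    using AE_H by eventually_elim (use R(3) in \<open>simp add: v1_def\<close>)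
  have v1_I: "AE p in \<mu>. \<forall>c\<in>I. c \<bullet> v1 p = 0"
    using v1_v0 AE_I by eventually_elim (use I(2) in auto)

  obtain D where D: "D \<ge> 0" "\<And>v::'n ext. v \<in> H \<Longrightarrow> dual_norm k v \<le> ereal (D * norm v)"
    using dual_norm_le_norm[of k] unfolding H_def by blast
  \<comment> \<open>\<open>v1\<close> has values in \<open>HLam k\<close>, where the dual norm is
    finite, so the conversion to a real number loses nothing.\<close>
  define N where "N p = real_of_ereal (dual_norm k (v1 p))" for p
  have N_eq: "dual_norm k (v1 p) = ereal (N p)" for p
    using D(2)[OF v1_H[of p]] dual_norm_nonneg[of k "v1 p"]
    by (cases "dual_norm k (v1 p)") (auto simp: N_def)
  have N_nonneg: "0 \<le> N p" for p
    using dual_norm_nonneg[of k "v1 p"] N_eq[of p] by simp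
  have [measurable]: "N \<in> borel_measurable borel"
    unfolding N_def[abs_def] using borel_measurable_dual_norm[of k, where 'a = 'n] by measurable
  have N_int: "integrable \<mu> N"
  proof (rule Bochner_Integration.integrable_bound)
    show "integrable \<mu> (\<lambda>p. D * norm (v1 p))" using v1 by simp
    show "AE p in \<mu>. norm (N p) \<le> norm (D * norm (v1 p))"
      using D N_nonneg N_eq v1_H by (intro AE_I2) (metis abs_of_nonneg ereal_less_eq(3) mult_nonneg_nonneg norm_ge_zero real_norm_def)
  qed simp
  define \<mu>2 where "\<mu>2 = density \<mu> (\<lambda>p. ennreal (N p))"
  have sets_\<mu>2 [measurable_cong, simp]: "sets \<mu>2 = sets borel" and space_\<mu>2 [simp]: "space \<mu>2 = UNIV"
    by (simp_all add: \<mu>2_def)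
  have \<mu>2_finite: "emeasure \<mu>2 UNIV < \<infinity>"
    using N_int N_nonneg by (simp add: \<mu>2_def emeasure_density nn_integral_eq_integral)
  define \<mu>3 where "\<mu>3 = restrict_space \<mu>2 U"
  \<comment> \<open>Where N is 0, so is 1 / N by convention; \<open>v2\<close> is then 0 and still
    lies in \<open>HLam k\<close>. The density N gives no mass to these points.\<close>
  define v2 where "v2 p = (1 / N p) *\<^sub>R v1 p" for p
  have [measurable]: "v2 \<in> borel_measurable borel" unfolding v2_def by measurable
  have sets_\<mu>3: "sets \<mu>3 = sets (restrict_space borel U)"
    unfolding \<mu>3_def by (rule sets_restrict_space_cong) simp
  have space_\<mu>3: "space \<mu>3 = U" by (simp add: \<mu>3_def space_restrict_space)
  have emeasure_\<mu>3: "emeasure \<mu>3 B = emeasure \<mu>2 B" if "B \<subseteq> U" for B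
    unfolding \<mu>3_def by (rule emeasure_restrict_space) (use U that in auto)
  have AE_\<mu>3: "(AE p in \<mu>3. Q p) \<longleftrightarrow> (AE p in \<mu>. 0 < N p \<longrightarrow> p \<in> U \<longrightarrow> Q p)" for Q
    unfolding \<mu>3_def \<mu>2_def using U by (subst AE_restrict_space_iff) (auto simp: AE_density)

  show ?thesis
    unfolding representable_by_integration_def
  proof (intro exI[of _ \<mu>3] exI[of _ v2] conjI ballI)
    show "radon_measure_on U \<mu>3"
      unfolding radon_measure_on_def
    proof (intro conjI allI impI ballI)
      show "sets \<mu>3 = sets (restrict_space borel U)" by (rule sets_\<mu>3)
      show "emeasure \<mu>3 K < \<infinity>" if "compact K \<and> K \<subseteq> U" for K
        using that \<mu>2_finite emeasure_mono[of K UNIV \<mu>2] by (auto simp: emeasure_\<mu>3)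
      fix B assume "B \<in> sets \<mu>3"
      then have B: "B \<in> sets borel" "B \<subseteq> U"
        using U unfolding sets_\<mu>3 sets_restrict_space by auto
      have "emeasure \<mu>3 B = (SUP K\<in>{K. K \<subseteq> B \<and> compact K}. emeasure \<mu>2 K)"
        unfolding emeasure_\<mu>3[OF B(2)] by (rule inner_regular) (use B \<mu>2_finite in auto)
      also have "\<dots> = (SUP K\<in>{K. compact K \<and> K \<subseteq> B}. emeasure \<mu>3 K)"
        using B(2) by (intro SUP_cong) (auto simp: emeasure_\<mu>3)
      finally show "emeasure \<mu>3 B = (SUP K\<in>{K. compact K \<and> K \<subseteq> B}. emeasure \<mu>3 K)" .
    qed
    have v2_\<mu>3: "v2 \<in> borel_measurable \<mu>3"
      unfolding \<mu>3_def by (rule measurable_restrict_space1) simp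
    then show "v2 \<in> borel_measurable (completion \<mu>3)" by (rule measurable_completion)
    show "v2 p \<in> HLam k" for p
      using subspace_mul[OF H v1_H] by (simp add: v2_def H_def)
    show "AE p in \<mu>3. dual_norm k (v2 p) = 1"
      unfolding AE_\<mu>3 by (intro AE_I2 impI) (use dual_norm_normalized[OF N_eq] in \<open>simp add: v2_def\<close>)
    fix \<omega> assume \<omega>: "\<omega> \<in> test_reps U k"
    have sm: "smooth_on U \<omega>" and \<omega>A: "\<And>p. p \<in> U \<Longrightarrow> \<omega> p \<in> A" and cpt: "compact (rumin_spt U k \<omega>)"
      using \<omega> by (auto simp: test_reps_def rumin_reps_iff A_def)
    \<comment> \<open>A representative is smooth only on U and has compact support only modulo null
      forms. Its product with u is a test function on the whole space and represents the same
      class.\<close>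
    obtain u where u: "cutoff_between (rumin_spt U k \<omega>) U u"
      using ex_cutoff[OF cpt U] by (auto simp: rumin_spt_def)
    have u_sm: "smooth_on UNIV u" using u by (simp add: cutoff_between_def)
    obtain K where K: "compact K" "K \<subseteq> U" "\<And>p. p \<notin> K \<Longrightarrow> u p = 0"
      using u unfolding cutoff_between_def by blast
    define \<omega>' where "\<omega>' p = u p *\<^sub>R \<omega> p" for p
    have oK: "open (- K)" using K(1) by (simp add: compact_imp_closed open_Compl)
    have sm': "smooth_on U \<omega>'"
      unfolding \<omega>'_def by (intro smooth_on_scaleR U sm smooth_on_subset[OF u_sm]) simp
    have "smooth_on (- K) \<omega>'"
      by (rule smooth_on_cong[OF oK smooth_on_const[of _ 0]]) (simp add: \<omega>'_def K(3))
    with sm' have "smooth_on (U \<union> - K) \<omega>'" by (simp only: smooth_on_Un)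
    moreover have "U \<union> - K = UNIV" using K(2) by blast
    ultimately have sm'': "smooth_on UNIV \<omega>'" by simp
    have \<omega>': "\<omega>' \<in> test_functions U"
      unfolding test_functions_def
      by (intro CollectI conjI sm'' exI[of _ K] K(1,2)) (simp add: \<omega>'_def K(3))
    have \<omega>'_A: "\<omega>' p \<in> A" for p
      using \<omega>A[of p] K(2) K(3)[of p] subspace_mul[OF A] subspace_0[OF A]
      by (cases "p \<in> K") (auto simp: \<omega>'_def)
    \<comment> \<open>On the support the cutoff is 1; off the support the value of \<omega> is
      itself a null covector.\<close>
    have diff_I: "\<omega> p - \<omega>' p \<in> I" if p: "p \<in> U" for p
    proof (cases "p \<in> rumin_spt U k \<omega>")
      case True
      then have "u p = 1" using u unfolding cutoff_between_def by blast
      then show ?thesis using subspace_0[OF I(1)] by (simp add: \<omega>'_def)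
    next
      case False
      then obtain V where "p \<in> V" "\<omega> \<in> rumin_null V k" using p unfolding rumin_spt_def by blast
      then have "\<omega> p \<in> I" unfolding I_def by (intro rumin_null_covectors)
      from subspace_mul[OF I(1) this, of "1 - u p"] show ?thesis
        by (simp add: \<omega>'_def algebra_simps)
    qed
    have "(\<lambda>p. \<omega> p - \<omega>' p) \<in> rumin_null U k"
      by (rule rumin_nullI[OF U smooth_on_diff[OF U sm sm']]) (use diff_I in \<open>simp add: I_def\<close>)
    then have "T (rumin_class U k \<omega>) = T (rumin_class U k \<omega>')"
      using rumin_class_eqI[OF U] by metis
    also have "\<dots> = (\<integral>p. \<omega>' p \<bullet> v0 p \<partial>\<mu>)" by (rule T_eq[OF \<omega>' \<omega>'_A])
    also have "\<dots> = (\<integral>p. \<omega>' p \<bullet> v1 p \<partial>\<mu>)"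
    proof (rule integral_cong_AE)
      have [measurable]: "\<omega>' \<in> borel_measurable borel"
        by (rule borel_measurable_continuous_onI[OF test_functions_continuous[OF \<omega>']])
      have [measurable]: "v0 \<in> borel_measurable borel" using borel_measurable_integrable[OF v0] by simp
      show "(\<lambda>p. \<omega>' p \<bullet> v0 p) \<in> borel_measurable \<mu>" "(\<lambda>p. \<omega>' p \<bullet> v1 p) \<in> borel_measurable \<mu>"
        by measurable
      show "AE p in \<mu>. \<omega>' p \<bullet> v0 p = \<omega>' p \<bullet> v1 p"
        using v1_v0 by eventually_elim (use \<omega>'_A in auto)
    qed
    also have "\<dots> = (\<integral>p. N p *\<^sub>R (\<omega>' p \<bullet> v2 p) \<partial>\<mu>)"
    proof (rule Bochner_Integration.integral_cong[OF refl])
      fix p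
      show "\<omega>' p \<bullet> v1 p = N p *\<^sub>R (\<omega>' p \<bullet> v2 p)"
      \<comment> \<open>Where N vanishes the density cannot restore \<open>v1\<close> from
        \<open>v2\<close>, but there the pairing is zero by \<open>abs_inner_le_dual_norm\<close>
        with bound 0.\<close>
      proof (cases "N p = 0")
        case True
        then show ?thesis
          using abs_inner_le_dual_norm[of k "v1 p" 0 "\<omega>' p"] N_eq[of p] \<omega>'_A[of p] by (simp add: A_def)
      qed (simp add: v2_def)
    qed
    also have "\<dots> = (\<integral>p. \<omega>' p \<bullet> v2 p \<partial>\<mu>2)"
    proof -
      have [measurable]: "\<omega>' \<in> borel_measurable borel"
        by (rule borel_measurable_continuous_onI[OF test_functions_continuous[OF \<omega>']])
      show ?thesis unfolding \<mu>2_def using N_nonneg by (subst integral_density) auto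
    qed
    also have "\<dots> = (\<integral>p. indicator U p *\<^sub>R (\<omega>' p \<bullet> v2 p) \<partial>\<mu>2)"
      by (rule Bochner_Integration.integral_cong) (use K in \<open>auto simp: indicator_def \<omega>'_def\<close>)
    also have "\<dots> = (\<integral>p. \<omega>' p \<bullet> v2 p \<partial>\<mu>3)"
      unfolding \<mu>3_def by (subst integral_restrict_space) (use U in auto)
    \<comment> \<open>The cutoff is removed again: \<omega> - \<omega>' takes null covectors as
      values on U, and \<open>v1\<close> is almost everywhere orthogonal to these.\<close>
    also have "\<dots> = (\<integral>p. \<omega> p \<bullet> v2 p \<partial>\<mu>3)"
    proof (rule integral_cong_AE)
      have "\<eta> \<in> borel_measurable \<mu>3" if "smooth_on U \<eta>" for \<eta> :: "'n form"
        using borel_measurable_continuous_on_restrict[OF smooth_on_imp_continuous_on[OF that]]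
        by (simp only: measurable_cong_sets[OF sets_\<mu>3 refl])
      from this[OF sm] this[OF sm'] v2_\<mu>3
      show "(\<lambda>p. \<omega>' p \<bullet> v2 p) \<in> borel_measurable \<mu>3" "(\<lambda>p. \<omega> p \<bullet> v2 p) \<in> borel_measurable \<mu>3"
        by (auto intro: borel_measurable_inner)
      show "AE p in \<mu>3. \<omega>' p \<bullet> v2 p = \<omega> p \<bullet> v2 p"
        unfolding AE_\<mu>3 using v1_I
      proof eventually_elim
        case (elim p)
        show ?case
        proof (intro impI)
          assume "p \<in> U"
          then have "(\<omega> p - \<omega>' p) \<bullet> v1 p = 0" using elim diff_I by blast
          then show "\<omega>' p \<bullet> v2 p = \<omega> p \<bullet> v2 p" by (simp add: v2_def inner_diff_left)
        qed
      qed
    qed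
    also have "\<dots> = (\<integral>p. \<omega> p \<bullet> v2 p \<partial>completion \<mu>3)"
    proof (rule integral_completion[symmetric])
      have "\<omega> \<in> borel_measurable \<mu>3"
        using borel_measurable_continuous_on_restrict[OF smooth_on_imp_continuous_on[OF sm]]
        by (simp only: measurable_cong_sets[OF sets_\<mu>3 refl])
      then show "(\<lambda>p. \<omega> p \<bullet> v2 p) \<in> borel_measurable \<mu>3"
        using v2_\<mu>3 by (rule borel_measurable_inner)
    qed
    finally show "T (rumin_class U k \<omega>) = (\<integral>p. \<omega> p \<bullet> v2 p \<partial>completion \<mu>3)" .
  qed
qed

section \<open>From a representation to finite mass\<close>

lemma representing_measure_null_off_spt:
  fixes U :: "'n::{finite,linorder} heis set"
  assumes U: "open U" and \<mu>: "radon_measure_on U \<mu>"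
    and v: "v \<in> borel_measurable (completion \<mu>)"
    and v_norm: "AE p in \<mu>. dual_norm k (v p) = 1"
    and T: "\<And>\<omega>. \<omega> \<in> test_reps U k \<Longrightarrow> T (rumin_class U k \<omega>) = (\<integral>p. \<omega> p \<bullet> v p \<partial>completion \<mu>)"
  shows "AE p in \<mu>. p \<in> current_spt U k T"
proof -
  have sets_\<mu>: "sets \<mu> = sets (restrict_space borel U)"
    and finite_\<mu>: "\<And>K. compact K \<Longrightarrow> K \<subseteq> U \<Longrightarrow> emeasure \<mu> K < \<infinity>"
    using \<mu> by (auto simp: radon_measure_on_def)
  have space_\<mu>: "space \<mu> = U" using sets_eq_imp_space_eq[OF sets_\<mu>] by (simp add: space_restrict_space)
  have in_sets: "B \<in> sets \<mu>" if "B \<in> sets borel" "B \<subseteq> U" for B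
    using that U unfolding sets_\<mu> by (simp add: sets_restrict_space_iff)
  define \<F> where "\<F> = {V. open V \<and> V \<subseteq> U \<and> V \<in> null_sets \<mu>}"
  \<comment> \<open>On a small ball around a point off the support, v is almost everywhere
    orthogonal to all Rumin covectors, so its dual norm is at most 0 there. As this norm is 1 almost
    everywhere, the ball must be a null set.\<close>
  have cover: "U - current_spt U k T \<subseteq> \<Union>\<F>"
  proof
    fix q assume "q \<in> U - current_spt U k T"
    then obtain V where V: "open V" "V \<subseteq> U" "q \<in> V"
      and zero: "\<And>\<omega>. \<omega> \<in> test_reps U k \<Longrightarrow> rumin_spt U k \<omega> \<subseteq> V \<Longrightarrow> T (rumin_class U k \<omega>) = 0"
      unfolding current_spt_def by blast
    obtain r where r: "r > 0" "cball q r \<subseteq> V" using V open_contains_cball_eq by blast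
    let ?B = "ball q r"
    have B: "?B \<subseteq> cball q r" "?B \<subseteq> U" "cball q r \<subseteq> U"
      using r V ball_subset_cball[of q r] by blast+
    have "AE p in \<mu>. p \<in> ?B \<longrightarrow> c \<bullet> v p = 0" if c: "c \<in> rumin_covectors k" for c
    proof -
      have cv: "(\<lambda>p. c \<bullet> v p) \<in> borel_measurable (completion \<mu>)"
        using v by (intro borel_measurable_inner) auto
      \<comment> \<open>v is measurable only for the completion; a version of the pairing that is
        measurable for \<mu> brings the integrals back to \<mu> itself.\<close>
      obtain f where f [measurable]: "f \<in> borel_measurable \<mu>" and f_eq: "AE p in \<mu>. c \<bullet> v p = f p"
        using completion_ex_borel_measurable_real[OF cv] by auto
      \<comment> \<open>Together with the finite measure of the closed ball, this bound makes the
        truncated pairing integrable.\<close>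
      have "AE p in \<mu>. \<bar>c \<bullet> v p\<bar> \<le> norm c + 1"
        using v_norm
        by eventually_elim (use abs_inner_le_dual_norm[of k _ 1, OF _ c] in \<open>simp add: one_ereal_def\<close>)
      with f_eq have f_bound: "AE p in \<mu>. \<bar>f p\<bar> \<le> norm c + 1" by eventually_elim simp
      have "AE p in \<mu>. p \<in> ?B \<longrightarrow> f p = 0"
      proof (rule AE_zero_if_integral_test_functions_zero[OF sets_\<mu>])
        have "emeasure \<mu> ?B \<le> emeasure \<mu> (cball q r)"
          using B by (intro emeasure_mono in_sets) auto
        then have "emeasure \<mu> ?B < \<infinity>" using finite_\<mu>[of "cball q r"] B by (auto intro: le_less_trans)
        then have ind: "integrable \<mu> (indicator ?B :: _ \<Rightarrow> real)"
          using B by (intro integrable_real_indicator in_sets) auto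
        show "integrable \<mu> (\<lambda>p. indicator ?B p * f p)"
        proof (rule Bochner_Integration.integrable_bound)
          show "integrable \<mu> (\<lambda>p. (norm c + 1) * indicator ?B p)" using ind by simp
          show "AE p in \<mu>. norm (indicator ?B p * f p) \<le> norm ((norm c + 1) * indicator ?B p)"
            using f_bound by eventually_elim (auto simp: indicator_def)
          show "(\<lambda>p. indicator ?B p * f p) \<in> borel_measurable \<mu>"
            using ind by (intro borel_measurable_times f) auto
        qed
        fix \<phi> :: "'n heis \<Rightarrow> real" assume \<phi>: "\<phi> \<in> test_functions ?B"
        have "\<phi> \<in> borel_measurable (restrict_space borel U)"
          by (rule measurable_restrict_space1[OF borel_measurable_continuous_onI[OF test_functions_continuous[OF \<phi>]]])
        then have \<phi>m [measurable]: "\<phi> \<in> borel_measurable \<mu>"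
          by (simp only: measurable_cong_sets[OF sets_\<mu> refl])
        define \<omega> where "\<omega> p = \<phi> p *\<^sub>R c" for p
        have \<omega>B: "\<omega> \<in> test_functions ?B"
          unfolding \<omega>_def by (rule test_functions_scaleR[OF \<phi> smooth_on_const])
        then have \<omega>: "\<omega> \<in> test_reps U k"
          using test_functions_mono[OF B(2)] subspace_mul[OF subspace_rumin_covectors c]
          by (intro test_repsI[OF U]) (auto simp: \<omega>_def)
        obtain K where K: "compact K" "K \<subseteq> ?B" "\<And>p. p \<notin> K \<Longrightarrow> \<omega> p = 0"
          using \<omega>B unfolding test_functions_def by blast
        have "rumin_spt U k \<omega> \<subseteq> K"
        proof (rule test_function_rumin_spt(1)[OF U K(1)])
          show "K \<subseteq> U" using K(2) B(2) by blast
        qed (rule K(3))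
        then have "rumin_spt U k \<omega> \<subseteq> V" using K(2) B(1) r(2) by blast
        from zero[OF \<omega> this] have "(\<integral>p. \<phi> p * (c \<bullet> v p) \<partial>completion \<mu>) = 0"
          using T[OF \<omega>] by (simp add: \<omega>_def)
        moreover have "(\<integral>p. \<phi> p * (c \<bullet> v p) \<partial>completion \<mu>) = (\<integral>p. \<phi> p * f p \<partial>completion \<mu>)"
        proof (rule integral_cong_AE)
          show "AE p in completion \<mu>. \<phi> p * (c \<bullet> v p) = \<phi> p * f p"
            by (rule AE_completion) (use f_eq in eventually_elim, simp)
        qed (intro borel_measurable_times cv measurable_completion[OF f] measurable_completion[OF \<phi>m])+
        moreover have "(\<integral>p. \<phi> p * f p \<partial>completion \<mu>) = (\<integral>p. \<phi> p * f p \<partial>\<mu>)"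
          by (rule integral_completion) measurable
        ultimately show "(\<integral>p. \<phi> p * f p \<partial>\<mu>) = 0" by simp
      qed (use B in auto)
      with f_eq show ?thesis by eventually_elim simp
    qed
    moreover obtain S :: "'n ext set" where S: "S \<subseteq> rumin_covectors k" "independent S" "rumin_covectors k \<subseteq> span S"
      using maximal_independent_subset by blast
    have "finite S" using S(2) by (rule independent_imp_finite)
    ultimately have "AE p in \<mu>. \<forall>c\<in>S. p \<in> ?B \<longrightarrow> c \<bullet> v p = 0"
      using S(1) by (intro AE_finite_allI) auto
    with v_norm have "AE p in \<mu>. p \<notin> ?B"
    proof eventually_elim
      case (elim p)
      show ?case
      proof
        assume p: "p \<in> ?B"
        have "subspace {c. c \<bullet> v p = 0}" by (auto simp: subspace_def inner_add_left)
        then have "span S \<subseteq> {c. c \<bullet> v p = 0}" using elim(2) p by (intro span_minimal) auto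
        then have "dual_norm k (v p) \<le> ereal 0" using S(3) unfolding dual_norm_le_iff by fastforce
        then show False using elim(1) by simp
      qed
    qed
    moreover have "?B \<in> sets \<mu>" using B by (intro in_sets) auto
    ultimately have "?B \<in> null_sets \<mu>"
      using AE_iff_null_sets by blast
    then show "q \<in> \<Union>\<F>" using r(1) B(2) unfolding \<F>_def by (intro UnionI[of ?B]) auto
  qed
  \<comment> \<open>The null open sets may be uncountably many; the Lindelof property extracts
    countably many with the same union.\<close>
  obtain \<G> where \<G>: "\<G> \<subseteq> \<F>" "countable \<G>" "\<Union>\<G> = \<Union>\<F>"
    using Lindelof[of \<F>] unfolding \<F>_def by blast
  have "(\<Union>V\<in>\<G>. V) \<in> null_sets \<mu>"
    by (rule null_sets_UN'[OF \<G>(2)]) (use \<G>(1) in \<open>auto simp: \<F>_def\<close>)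
  then have "AE p in \<mu>. p \<notin> \<Union>\<G>" by (intro AE_not_in) simp
  with AE_space show ?thesis
    by eventually_elim (use cover \<G>(3) space_\<mu> in auto)
qed

text \<open>Forms of comass at most one pair with v to at most 1 almost everywhere, and the measure
  is carried by the support of the current. Compactness makes the measure of the support finite, and
  this number bounds the mass.\<close>

lemma representable_imp_finite_mass:
  fixes U :: "'n::{finite,linorder} heis set"
  assumes U: "open U" and spt: "compact (current_spt U k T)"
    and rep: "representable_by_integration U k T"
  shows "mass U k T < \<infinity>"
proof -
  obtain \<mu> v where \<mu>: "radon_measure_on U \<mu>" and v: "v \<in> borel_measurable (completion \<mu>)"
    and v_norm: "AE p in \<mu>. dual_norm k (v p) = 1"
    and T: "\<And>\<omega>. \<omega> \<in> test_reps U k \<Longrightarrow> T (rumin_class U k \<omega>) = (\<integral>p. \<omega> p \<bullet> v p \<partial>completion \<mu>)"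
    using rep unfolding representable_by_integration_def by blast
  let ?S = "current_spt U k T"
  have S: "?S \<subseteq> U" unfolding current_spt_def by blast
  have sets_\<mu>: "sets \<mu> = sets (restrict_space borel U)" using \<mu> by (simp add: radon_measure_on_def)
  have S_sets: "?S \<in> sets \<mu>"
    using S U spt unfolding sets_\<mu> by (simp add: sets_restrict_space_iff borel_compact)
  have fin: "emeasure \<mu> ?S < \<infinity>" using \<mu> spt S by (simp add: radon_measure_on_def)
  have AE_S: "AE p in \<mu>. p \<in> ?S"
    by (rule representing_measure_null_off_spt[OF U \<mu> v v_norm T])
  have space_\<mu>: "space \<mu> = U" using sets_eq_imp_space_eq[OF sets_\<mu>] by (simp add: space_restrict_space)
  have ind: "integrable (completion \<mu>) (indicator ?S :: _ \<Rightarrow> real)"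
    using S_sets fin by (intro integrable_real_indicator) auto
  have "T (rumin_class U k \<omega>) \<le> measure (completion \<mu>) ?S"
    if \<omega>: "\<omega> \<in> test_reps U k" "\<forall>p\<in>U. comass k (\<omega> p) \<le> 1" for \<omega>
  proof (cases "integrable (completion \<mu>) (\<lambda>p. \<omega> p \<bullet> v p)")
    case True
    have "(\<integral>p. \<omega> p \<bullet> v p \<partial>completion \<mu>) \<le> (\<integral>p. indicator ?S p \<partial>completion \<mu>)"
    proof (rule integral_mono_AE[OF True ind])
      have "AE p in \<mu>. \<omega> p \<bullet> v p \<le> indicator ?S p"
        using AE_S v_norm AE_space
      proof eventually_elim
        case (elim p)
        then have "p \<in> U" using space_\<mu> by simp
        then have "\<omega> p \<in> rumin_covectors k" "comass k (\<omega> p) \<le> 1"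
          using \<omega> by (auto simp: test_reps_def rumin_reps_iff)
        then have "\<omega> p \<bullet> v p \<le> 1"
          using elim(2) dual_norm_le_iff[of k "v p" 1] by (simp add: one_ereal_def)
        then show ?case using elim(1) by simp
      qed
      then show "AE p in completion \<mu>. \<omega> p \<bullet> v p \<le> indicator ?S p" by (rule AE_completion)
    qed
    also have "\<dots> = measure (completion \<mu>) ?S"
      using S S_sets by simp
    finally show ?thesis by (simp add: T[OF \<omega>(1)])
  next
    \<comment> \<open>A nonintegrable integrand has integral 0 by convention, which satisfies the
      bound as well.\<close>
    case False
    then show ?thesis by (simp add: T[OF \<omega>(1)] not_integrable_integral_eq)
  qed
  then have "mass U k T \<le> ereal (measure (completion \<mu>) ?S)"
    unfolding mass_def by (intro SUP_least) auto
  also have "\<dots> < \<infinity>" by simp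
  finally show ?thesis .
qed

theorem corollary2p9:
  fixes U :: "'n::{finite,linorder} heis set"
    and k :: nat
    and T :: "'n form set \<Rightarrow> real"
  assumes "open U"
    and "k \<le> 2 * CARD('n) + 1"
    and "heis_current U k T"
    and "compact (current_spt U k T)"
  shows "mass U k T < \<infinity> \<longleftrightarrow> representable_by_integration U k T"
proof
  have lin: "T (rumin_class U k (\<lambda>p. a *\<^sub>R \<omega> p + b *\<^sub>R \<eta> p))
      = a * T (rumin_class U k \<omega>) + b * T (rumin_class U k \<eta>)"
    if "\<omega> \<in> test_reps U k" "\<eta> \<in> test_reps U k" for \<omega> \<eta> a b
    using assms(3) that by (simp add: heis_current_def)
  show "representable_by_integration U k T" if "mass U k T < \<infinity>"
    using assms(1) lin that by (rule finite_mass_imp_representable)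
  show "mass U k T < \<infinity>" if "representable_by_integration U k T"
    using assms(1,4) that by (rule representable_imp_finite_mass)
qed

end
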